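(* Let $\xi<\omega_1$ and let $L\subset\mathbb N$ be an infinite set such that $\mathbb N\setminus L$ is infinite and $L\cap\Lambda_i$ is infinite for every $i\in\mathbb N$. Let $X_L$ be the closed linear span of $(e_n)_{n\in L}$ in $X_\xi$. Then the space $\mathfrak X_\xi=X_\xi/X_L$ does not contain a normalized basic sequence generating an $\ell_1$-spreading model.
   Context: General notation. $\mathbb N=\{1,2,\dots\}$, $(e_n)$ is the unit vector basis of $c_{00}(\mathbb N)$, $e_n^*$ the coordinate functionals; an element $f\in c_{00}(\mathbb N)$ acts on $c_{00}(\mathbb N)$ by $f(x)=\sum_n f(n)x(n)$. For an interval $E\subset\mathbb N$, $Ef$ is the restriction of $f$ to $E$. $f<g$ means $\max\operatorname{supp}f<\min\operatorname{supp}g$. Schreier families. $\mathcal S_0=\{\{n\}:n\in\mathbb N\}\cup\{\emptyset\}$; $\mathcal S_{\xi+1}=\{F_1\cup\dots\cup F_m: m\in\mathbb N,\ F_i\in\mathcal S_\xi,\ m\le F_1<\dots<F_m\}$; for limit $\xi<\omega_1$ fix $\xi_n\nearrow\xi$ and set $\mathcal S_\xi=\{F: F\in\mathcal S_{\xi_n}\text{ and }n\le F\text{ for some }n\}$. In particular $\mathcal S_1=\{F\text{ finite}:\#F\le\min F\}\cup\{\emptyset\}$. The set $G_\xi$. Fix $\xi<\omega_1$. Let $m_1=2^5$, $m_{j+1}=m_j^5$, $n_1=2^6$, $n_{j+1}=(2n_j)^{s_j}$ where $2^{s_j}=m_{j+1}^3$. Put $G_0=\{\pm e_n^*:n\in\mathbb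 N\}$ and, for $j\in\mathbb N$, $G_1^j=\{m_{2j-1}^{-2}\sum_{i\in B}\varepsilon_ie_i^*: B\subset\mathbb N,\ 1\le\#B\le n_{2j-1},\ \varepsilon_i\in\{-1,1\}\}$, $G_1=\bigcup_jG_1^j$; for $f\in G_1^j$ put $\operatorname{ind}(f)=j$. Let $\mathcal U$ be the set of finite sequences $(f_1,\dots,f_d)$ with $f_1<\dots<f_d$, $f_i\in G_1^{j_i}$, $j_1<\dots<j_d$. Fix a partition $\mathbb N=M_1\cup M_2$ into infinite disjoint sets and an injective map $\sigma_1:\mathcal U\to M_2$ with $\sigma_1(f_1,\dots,f_{i+1})>\sigma_1(f_1,\dots,f_i)$ always. A special sequence is $(f_1,\dots,f_d)\in\mathcal U$ such that $\{\min\operatorname{supp}f_i:i\le d\}\in\mathcal S_\xi$, $f_1\in G_1^{j_1}$ with $j_1\in M_1$, and $f_{i+1}\in G_1^{\sigma_1(f_1,\dots,f_i)}$ for $1\le i<d$. Put $G_{sp}=\{E\sum_{i=1}^d\varepsilon_if_i:(f_1,\dots,f_d)\text{ special},\ \varepsilon_i\in\{-1,1\},\ E\text{ an interval}\}$, and for $\phi=E\sum\varepsilon_if_i\in G_{sp}$ put $\operatorname{ind}(\phi)=\{\operatorname{ind}(f_i):Ef_i\neq0\}$ (for $\phi\in G_1^j$, $\operatorname{ind}(\phi)$ is identified with $\{j\}$). Put $G_{\ell_2}=\{\sum_{i=1}^da_i\phi_i: d\in\mathbb N,\ a_i\in\mathbb Q,\ \sum a_i^2\le1,\ \phi_i\in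 G_{sp}\cup G_1,\ (\operatorname{ind}\phi_i)_{i=1}^d\text{ pairwise disjoint}\}$ and $G_\xi=G_0\cup G_1\cup G_{sp}\cup G_{\ell_2}$. The set $K_\xi$ and the space $X_\xi$. Let $(\Lambda_i)_{i\in\mathbb N}$ be a partition of $\mathbb N$ into pairwise disjoint infinite sets, and $\mathbb N=N_1\cup N_2$ a partition into two infinite sets. Let $\mathbb Q_s$ be the set of finite sequences $(f_1,\dots,f_d)$ of nonzero rational-valued elements of $c_{00}(\mathbb N)$ with $f_1<\dots<f_d$, and fix an injective $\sigma:\mathbb Q_s\to N_2$ with $m_{2\sigma(f_1,\dots,f_d)}^{1/2}>\max\{|f_i(e_l)|^{-1}:l\in\operatorname{supp}f_i,\ i\le d\}\cdot\max\operatorname{supp}f_d$. The $(\mathcal A_n,\theta)$-operation assigns to $f_1<\dots<f_d$, $d\le n$, the vector $\theta(f_1+\dots+f_d)$. $K_\xi$ is the minimal subset of $c_{00}(\mathbb N)$ such that: (1) $K_\xi$ is symmetric, closed under restriction of its elements to intervals, and $G_\xi\subset K_\xi$; (2) $K_\xi$ is closed under the $(\mathcal A_{n_{2j}},m_{2j}^{-1})$-operation for every $j$; (3) $K_\xi$ is closed under the $(\mathcal A_{n_{2j-1}},m_{2j-1}^{-1})$-operation applied to $n_{2j-1}$-attractor sequences, for every $j$; (4) $\sum_{i\in A}\lambda_if_i\in K_\xi$ whenever $A$ is finite, each $f_i\in K_\xi$ is the result of an $(\mathcal A_{n_{j_i}},m_{j_i}^{-1})$-operation on elements of $K_\xi$,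 $n_{j_i}\ne n_{j_k}$ for $i\neq k$, $\lambda_i\in\mathbb Q$ and $\sum\lambda_i^2\le1$; (5) $K_\xi$ is closed under rational convex combinations. Here $(f_1,\dots,f_d)\in\mathbb Q_s$ is an $n_{2j-1}$-attractor sequence if $d\le n_{2j-1}$, all $f_i\in K_\xi$, $f_1$ is the result of an $(\mathcal A_{n_{2j_1}},m_{2j_1}^{-1})$-operation on elements of $K_\xi$ for some $j_1\in N_1$ with $m_{2j_1}>n_{2j-1}^3$, each $f_{2i-1}$ with $i\ge2$ is the result of an $(\mathcal A_{n_{2r}},m_{2r}^{-1})$-operation on elements of $K_\xi$ with $r=\sigma(f_1,\dots,f_{2i-2})$, and each $f_{2i}=e^*_{\lambda_{2i}}$ for some $\lambda_{2i}\in\Lambda_{\sigma(f_1,\dots,f_{2i-1})}$. Put $\|x\|=\sup\{f(x):f\in K_\xi\}$ and let $X_\xi$ be the completion of $(c_{00}(\mathbb N),\|\cdot\|)$. A normalized basic sequence $(x_i)_{i\in\mathbb N}$ generates an $\ell_1$-spreading model if there is $C\ge1$ such that for every $F\in\mathcal S_1$ the sequence $(x_i)_{i\in F}$ is $C$-equivalent to the unit vector basis of $\ell_1^{\#F}$. *)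

theory Defs
  imports "HOL-Analysis.Analysis" "HOL-Library.Countable_Set_Type"
begin

section \<open>Countable ordinals and the Schreier families\<close>

text \<open>The type of all ordinals below the first uncountable one.\<close>

typedef omega1 = "Field (cardSuc natLeq)"
proof -
  have "infinite (Field (cardSuc natLeq))"
    using cardSuc_finite[OF natLeq_Card_order] by (simp add: Field_natLeq)
  then show ?thesis by (metis ex_in_conv finite.emptyI)
qed

instantiation omega1 :: wellorder
begin

definition less_eq_omega1 :: "omega1 \<Rightarrow> omega1 \<Rightarrow> bool" where
  "x \<le> y \<longleftrightarrow> (Rep_omega1 x, Rep_omega1 y) \<in> cardSuc natLeq"

definition less_omega1 :: "omega1 \<Rightarrow> omega1 \<Rightarrow> bool" where
  "(x::omega1) < y \<longleftrightarrow> x \<le> y \<and> x \<noteq> y"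

instance
proof -
  have W: "Well_order (cardSuc natLeq)"
    using cardSuc_Card_order[OF natLeq_Card_order] by (simp add: card_order_on_def)
  then have wf: "wf (cardSuc natLeq - Id)" and re: "refl_on (Field (cardSuc natLeq)) (cardSuc natLeq)"
    and tr': "trans (cardSuc natLeq)" and an: "antisym (cardSuc natLeq)"
    and to: "total_on (Field (cardSuc natLeq)) (cardSuc natLeq)"
    by (simp_all only: well_order_on_def order_on_defs)
  have rf: "x \<le> x" for x :: omega1
    unfolding less_eq_omega1_def by (rule refl_onD[OF re Rep_omega1])
  have tr: "x \<le> z" if "x \<le> y" "y \<le> z" for x y z :: omega1
    using transD[OF tr'] that unfolding less_eq_omega1_def by blast
  have as: "x = y" if "x \<le> y" "y \<le> x" for x y :: omega1
  proof -
    have "Rep_omega1 x = Rep_omega1 y"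
      using antisymD[OF an] that unfolding less_eq_omega1_def by blast
    then show ?thesis by (simp add: Rep_omega1_inject)
  qed
  have tot: "x \<le> y \<or> y \<le> x" for x y :: omega1
  proof (cases "x = y")
    case False
    then have "Rep_omega1 x \<noteq> Rep_omega1 y" by (simp add: Rep_omega1_inject)
    with to Rep_omega1[of x] Rep_omega1[of y] show ?thesis
      unfolding less_eq_omega1_def total_on_def by simp
  qed (simp add: rf)
  have ind: "P a" if step: "\<And>x. (\<And>y. y < x \<Longrightarrow> P y) \<Longrightarrow> P x"
    for P and a :: omega1
  proof -
    have "wf (inv_image (cardSuc natLeq - Id) Rep_omega1)"
      using wf by (rule wf_inv_image)
    then show ?thesis
    proof (induction a rule: wf_induct_rule)
      case (less x)
      show ?case
      proof (rule step)
        fix y assume "y < x"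
        then show "P y"
          by (intro less.IH) (simp add: less_omega1_def less_eq_omega1_def Rep_omega1_inject)
      qed
    qed
  qed
  show "OFCLASS(omega1, wellorder_class)"
  proof (standard, goal_cases)
    case 1 show ?case using as by (auto simp: less_omega1_def)
  next
    case 2 show ?case by (rule rf)
  next
    case 3 then show ?case by (rule tr)
  next
    case 4 then show ?case by (rule as)
  next
    case 5 show ?case by (rule tot)
  next
    case 6 then show ?case by (rule ind)
  qed
qed

end

lemma countable_below_omega1:
  includes cardinal_syntax
  shows "countable {..<\<xi>::omega1}"
proof -
  have C: "Card_order (cardSuc natLeq)"
    by (rule cardSuc_Card_order[OF natLeq_Card_order])
  have "|underS (cardSuc natLeq) (Rep_omega1 \<xi>)| <o cardSuc natLeq"
    by (rule card_of_underS[OF C Rep_omega1])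
  then have "|underS (cardSuc natLeq) (Rep_omega1 \<xi>)| \<le>o natLeq"
    by (simp add: cardSuc_ordLeq_ordLess[OF natLeq_Card_order card_of_Card_order])
  then have "countable (underS (cardSuc natLeq) (Rep_omega1 \<xi>))"
    by (simp add: countable_card_le_natLeq)
  moreover have "Rep_omega1 ` {..<\<xi>} \<subseteq> underS (cardSuc natLeq) (Rep_omega1 \<xi>)"
    by (auto simp: underS_def less_omega1_def less_eq_omega1_def Rep_omega1_inject)
  ultimately have "countable (Rep_omega1 ` {..<\<xi>})"
    by (rule countable_subset[rotated])
  then show ?thesis
    by (meson Rep_omega1_inject countable_image_inj_on inj_onI)
qed

lemma uncountable_omega1:
  includes cardinal_syntax
  shows "uncountable (UNIV :: omega1 set)"
proof
  assume "countable (UNIV :: omega1 set)"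
  then have "countable (Field (cardSuc natLeq))"
    by (metis countable_image type_definition.Rep_range type_definition_omega1)
  then have "|Field (cardSuc natLeq)| \<le>o natLeq"
    by (simp add: countable_card_le_natLeq)
  moreover have "natLeq <o cardSuc natLeq"
    by (rule cardSuc_greater[OF natLeq_Card_order])
  moreover have "|Field (cardSuc natLeq)| =o cardSuc natLeq"
    by (rule card_of_Field_ordIso[OF cardSuc_Card_order[OF natLeq_Card_order]])
  ultimately show False
    by (meson not_ordLess_ordLeq ordIso_ordLeq_trans ordIso_symmetric)
qed

definition ord_zero :: omega1 where
  "ord_zero = (LEAST \<zeta>. True)"

definition ord_suc :: "omega1 \<Rightarrow> omega1" where
  "ord_suc \<eta> = (LEAST \<zeta>. \<eta> < \<zeta>)"

definition ord_limit :: "omega1 \<Rightarrow> bool" where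
  "ord_limit \<eta> \<longleftrightarrow> \<eta> \<noteq> ord_zero \<and> (\<forall>\<zeta>. \<eta> \<noteq> ord_suc \<zeta>)"

text \<open>Throughout, the positive integers are the elements of \<open>{1..}\<close> in type \<open>nat\<close>; values of
  indexed families at index 0 are irrelevant.\<close>

definition fundamental_sequences :: "(omega1 \<Rightarrow> nat \<Rightarrow> omega1) \<Rightarrow> bool" where
  "fundamental_sequences s \<longleftrightarrow>
     (\<forall>\<eta>. ord_limit \<eta> \<longrightarrow>
        (\<forall>n\<ge>1. s \<eta> n < \<eta>) \<and> mono_on {1..} (s \<eta>) \<and> (\<forall>\<zeta><\<eta>. \<exists>n\<ge>1. \<zeta> < s \<eta> n))"

text \<open>Blocks \<open>F\<^sub>i\<close> may be empty, so \<open>F\<^sub>1 < \<dots> < F\<^sub>m\<close> is required for all pairs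
  and \<open>m \<le> F\<^sub>1\<close> for all blocks.\<close>

inductive in_schreier :: "(omega1 \<Rightarrow> nat \<Rightarrow> omega1) \<Rightarrow> omega1 \<Rightarrow> nat set \<Rightarrow> bool"
  for s where
  empty: "in_schreier s ord_zero {}"
| single: "n \<ge> 1 \<Longrightarrow> in_schreier s ord_zero {n}"
| suc: "Fs \<noteq> [] \<Longrightarrow> \<forall>F\<in>set Fs. in_schreier s \<eta> F \<Longrightarrow>
    sorted_wrt (\<lambda>F G. \<forall>k\<in>F. \<forall>l\<in>G. k < l) Fs \<Longrightarrow> \<forall>F\<in>set Fs. \<forall>k\<in>F. length Fs \<le> k \<Longrightarrow>
    in_schreier s (ord_suc \<eta>) (\<Union>(set Fs))"
| limit: "ord_limit \<eta> \<Longrightarrow> n \<ge> 1 \<Longrightarrow> in_schreier s (s \<eta> n) F \<Longrightarrow> \<forall>k\<in>F. n \<le> k \<Longrightarrow>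
    in_schreier s \<eta> F"

definition schreier :: "(omega1 \<Rightarrow> nat \<Rightarrow> omega1) \<Rightarrow> omega1 \<Rightarrow> nat set set" where
  "schreier s \<xi> = {F. in_schreier s \<xi> F}"

definition schreier_one :: "nat set set" where
  "schreier_one = {F. finite F \<and> F \<noteq> {} \<and> F \<subseteq> {1..} \<and> card F \<le> Min F} \<union> {{}}"

lemma ord_suc_greater: "\<eta> < ord_suc \<eta>"
proof -
  have "countable {..\<eta>}"
    using countable_below_omega1[of \<eta>]
    by (simp add: ivl_disj_un_singleton(2)[symmetric])
  then have "{..\<eta>} \<noteq> UNIV" using uncountable_omega1 by metis
  then obtain \<zeta> where "\<eta> < \<zeta>" by (metis UNIV_eq_I atMost_iff not_le)
  then show ?thesis unfolding ord_suc_def by (rule LeastI)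
qed

lemma ord_suc_le: "\<eta> < \<zeta> \<Longrightarrow> ord_suc \<eta> \<le> \<zeta>"
  unfolding ord_suc_def by (rule Least_le)

lemma ord_suc_inject: "ord_suc \<eta> = ord_suc \<zeta> \<longleftrightarrow> \<eta> = \<zeta>"
  by (metis linorder_neqE ord_suc_greater ord_suc_le leD)

lemma ord_zero_le: "ord_zero \<le> \<eta>"
  unfolding ord_zero_def by (rule Least_le) simp

lemma ord_suc_neq_zero: "ord_suc \<eta> \<noteq> ord_zero"
  by (metis leD ord_suc_greater ord_zero_le)

lemma schreier_zero: "schreier s ord_zero = insert {} {{n} | n. n \<ge> 1}"
  unfolding schreier_def
  by (auto elim: in_schreier.cases intro: in_schreier.intros
      simp: ord_suc_neq_zero[symmetric] ord_limit_def)

lemma schreier_suc: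
  "schreier s (ord_suc \<eta>) = {\<Union>(set Fs) | Fs. Fs \<noteq> [] \<and> set Fs \<subseteq> schreier s \<eta> \<and>
     sorted_wrt (\<lambda>F G. \<forall>k\<in>F. \<forall>l\<in>G. k < l) Fs \<and> (\<forall>F\<in>set Fs. \<forall>k\<in>F. length Fs \<le> k)}"
  (is "_ = ?R")
proof (rule set_eqI, rule iffI)
  fix F assume "F \<in> schreier s (ord_suc \<eta>)"
  then have "in_schreier s (ord_suc \<eta>) F" by (simp add: schreier_def)
  then show "F \<in> ?R"
    by (cases rule: in_schreier.cases)
      (auto simp: ord_suc_neq_zero ord_suc_inject ord_limit_def schreier_def)
next
  fix F assume "F \<in> ?R"
  then show "F \<in> schreier s (ord_suc \<eta>)"
    by (auto simp: schreier_def intro!: in_schreier.suc)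
qed

lemma schreier_limit:
  assumes "ord_limit \<eta>"
  shows "schreier s \<eta> = {F. \<exists>n\<ge>1. F \<in> schreier s (s \<eta> n) \<and> (\<forall>k\<in>F. n \<le> k)}"
proof (rule set_eqI, rule iffI)
  fix F assume "F \<in> schreier s \<eta>"
  then have "in_schreier s \<eta> F" by (simp add: schreier_def)
  then show "F \<in> {F. \<exists>n\<ge>1. F \<in> schreier s (s \<eta> n) \<and> (\<forall>k\<in>F. n \<le> k)}"
    by (cases rule: in_schreier.cases) (use assms in \<open>auto simp: ord_limit_def schreier_def\<close>)
next
  fix F assume "F \<in> {F. \<exists>n\<ge>1. F \<in> schreier s (s \<eta> n) \<and> (\<forall>k\<in>F. n \<le> k)}"
  then show "F \<in> schreier s \<eta>"
    using assms by (auto simp: schreier_def intro: in_schreier.limit)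
qed

lemma schreier_one_eq: "schreier s (ord_suc ord_zero) = schreier_one"
proof (rule set_eqI, rule iffI)
  fix F assume "F \<in> schreier s (ord_suc ord_zero)"
  then obtain Fs where Fs: "F = \<Union>(set Fs)" "set Fs \<subseteq> insert {} {{n} | n. n \<ge> 1}"
      "\<forall>G\<in>set Fs. \<forall>k\<in>G. length Fs \<le> k"
    unfolding schreier_suc schreier_zero by blast
  have block: "finite G \<and> card G \<le> 1 \<and> G \<subseteq> {1..}" if "G \<in> set Fs" for G
    using that Fs(2) by auto
  have fin: "finite F" and pos: "F \<subseteq> {1..}"
    using block by (auto simp: Fs(1))
  have "card F \<le> (\<Sum>G\<in>set Fs. card G)"
    unfolding Fs(1) by (rule card_Union_le_sum_card)
  also have "\<dots> \<le> (\<Sum>G\<in>set Fs. 1)" by (rule sum_mono) (use block in auto)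
  also have "\<dots> \<le> length Fs" by (simp add: card_length)
  finally have "card F \<le> length Fs" .
  moreover have "length Fs \<le> Min F" if "F \<noteq> {}"
    using Min_in[OF fin that] Fs(1,3) by blast
  ultimately show "F \<in> schreier_one"
    unfolding schreier_one_def using fin pos by force
next
  fix F assume F: "F \<in> schreier_one"
  show "F \<in> schreier s (ord_suc ord_zero)"
  proof (cases "F = {}")
    case True
    then show ?thesis
      unfolding schreier_suc schreier_zero by (auto intro!: exI[of _ "[{}]"])
  next
    case False
    then have *: "finite F" "F \<subseteq> {1..}" "card F \<le> Min F"
      using F by (auto simp: schreier_one_def)
    let ?Fs = "map (\<lambda>n. {n}) (sorted_list_of_set F)"
    have "?Fs \<noteq> []" using * False by simp
    moreover have "set ?Fs \<subseteq> insert {} {{n} | n. n \<ge> 1}" using * by auto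
    moreover have "sorted_wrt (\<lambda>F G. \<forall>k\<in>F. \<forall>l\<in>G. k < l) ?Fs"
      by (simp add: sorted_wrt_map)
    moreover have "\<forall>G\<in>set ?Fs. \<forall>k\<in>G. length ?Fs \<le> k"
      using * by (auto intro: order_trans[OF _ Min_le])
    moreover have "F = \<Union>(set ?Fs)" using * by auto
    ultimately show ?thesis
      unfolding schreier_suc schreier_zero by blast
  qed
qed


section \<open>Finitely supported sequences\<close>

typedef c00 = "{x :: nat \<Rightarrow> real. x 0 = 0 \<and> finite {n. x n \<noteq> 0}}"
  morphisms coord Abs_c00
  by (rule exI[of _ "\<lambda>_. 0"]) simp

setup_lifting type_definition_c00

instantiation c00 :: real_vector
begin

lift_definition zero_c00 :: c00 is "\<lambda>_. 0" by simp

lift_definition plus_c00 :: "c00 \<Rightarrow> c00 \<Rightarrow> c00" is "\<lambda>x y n. x n + y n"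
proof -
  fix x y :: "nat \<Rightarrow> real"
  assume "x 0 = 0 \<and> finite {n. x n \<noteq> 0}" "y 0 = 0 \<and> finite {n. y n \<noteq> 0}"
  moreover have "{n. x n + y n \<noteq> 0} \<subseteq> {n. x n \<noteq> 0} \<union> {n. y n \<noteq> 0}" by auto
  ultimately show "x 0 + y 0 = 0 \<and> finite {n. x n + y n \<noteq> 0}"
    by (auto intro: finite_subset)
qed

lift_definition uminus_c00 :: "c00 \<Rightarrow> c00" is "\<lambda>x n. - x n" by simp

lift_definition minus_c00 :: "c00 \<Rightarrow> c00 \<Rightarrow> c00" is "\<lambda>x y n. x n - y n"
proof -
  fix x y :: "nat \<Rightarrow> real"
  assume "x 0 = 0 \<and> finite {n. x n \<noteq> 0}" "y 0 = 0 \<and> finite {n. y n \<noteq> 0}"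
  moreover have "{n. x n - y n \<noteq> 0} \<subseteq> {n. x n \<noteq> 0} \<union> {n. y n \<noteq> 0}" by auto
  ultimately show "x 0 - y 0 = 0 \<and> finite {n. x n - y n \<noteq> 0}"
    by (auto intro: finite_subset)
qed

lift_definition scaleR_c00 :: "real \<Rightarrow> c00 \<Rightarrow> c00" is "\<lambda>a x n. a * x n" by simp

instance
  by standard (transfer; simp add: fun_eq_iff algebra_simps)+

end

lift_definition unit_vec :: "nat \<Rightarrow> c00" is "\<lambda>n k. if k = n \<and> k \<ge> 1 then 1 else 0"
  by simp

lift_definition restrict :: "nat set \<Rightarrow> c00 \<Rightarrow> c00" is "\<lambda>E x n. if n \<in> E then x n else 0"
  by (auto elim: rev_finite_subset)

definition supp :: "c00 \<Rightarrow> nat set" where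
  "supp x = {n. coord x n \<noteq> 0}"

definition act :: "c00 \<Rightarrow> c00 \<Rightarrow> real" where
  "act f x = (\<Sum>n\<in>supp f. coord f n * coord x n)"

definition block_less :: "c00 \<Rightarrow> c00 \<Rightarrow> bool" where
  "block_less f g \<longleftrightarrow> (\<forall>k\<in>supp f. \<forall>l\<in>supp g. k < l)"

definition nat_interval :: "nat set \<Rightarrow> bool" where
  "nat_interval E \<longleftrightarrow> (\<forall>a\<in>E. \<forall>b\<in>E. {a..b} \<subseteq> E)"

definition infinite_split :: "nat set \<Rightarrow> nat set \<Rightarrow> bool" where
  "infinite_split A B \<longleftrightarrow> A \<union> B = {1..} \<and> A \<inter> B = {} \<and> infinite A \<and> infinite B"


section \<open>The weights\<close>

fun mseq :: "nat \<Rightarrow> nat" where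
  "mseq 0 = 0"
| "mseq (Suc 0) = 2 ^ 5"
| "mseq (Suc (Suc j)) = mseq (Suc j) ^ 5"

definition sseq :: "nat \<Rightarrow> nat" where
  "sseq j = (THE s. 2 ^ s = mseq (Suc j) ^ 3)"

fun nseq :: "nat \<Rightarrow> nat" where
  "nseq 0 = 0"
| "nseq (Suc 0) = 2 ^ 6"
| "nseq (Suc (Suc j)) = (2 * nseq (Suc j)) ^ sseq (Suc j)"

lemma mseq_Suc: "mseq (Suc j) = 2 ^ (5 ^ Suc j)"
proof (induction j)
  case (Suc j)
  have "mseq (Suc (Suc j)) = (2 ^ (5 ^ Suc j)) ^ 5"
    by (simp only: mseq.simps(3) Suc)
  also have "\<dots> = 2 ^ (5 ^ Suc j * 5)"
    by (rule power_mult[symmetric])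
  also have "5 ^ Suc j * 5 = (5 ^ Suc (Suc j) :: nat)"
    by (simp only: power_Suc2)
  finally show ?case .
qed simp

lemma sseq_eq: "sseq j = 3 * 5 ^ Suc j"
proof -
  have "mseq (Suc j) ^ 3 = 2 ^ (5 ^ Suc j * 3)"
    unfolding mseq_Suc by (rule power_mult[symmetric])
  then show ?thesis
    unfolding sseq_def by (intro the_equality) (simp_all only: power_inject_exp one_less_numeral_iff
      semiring_norm mult.commute)
qed


section \<open>The ground set\<close>

definition G0_set :: "c00 set" where
  "G0_set = {f. \<exists>n\<ge>1. f = unit_vec n \<or> f = - unit_vec n}"

definition G1_level :: "nat \<Rightarrow> c00 set" where
  "G1_level j = {(1 / real (mseq (2 * j - 1)) ^ 2) *\<^sub>R (\<Sum>i\<in>B. \<epsilon> i *\<^sub>R unit_vec i) | B \<epsilon>.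
     B \<subseteq> {1..} \<and> finite B \<and> 1 \<le> card B \<and> card B \<le> nseq (2 * j - 1) \<and> (\<forall>i\<in>B. \<epsilon> i \<in> {-1, 1})}"

definition G1_set :: "c00 set" where
  "G1_set = (\<Union>j\<in>{1..}. G1_level j)"

definition ind :: "c00 \<Rightarrow> nat" where
  "ind f = (THE j. j \<ge> 1 \<and> f \<in> G1_level j)"

definition U_seqs :: "c00 list set" where
  "U_seqs = {fs. fs \<noteq> [] \<and> sorted_wrt block_less fs \<and>
     (\<exists>js. length js = length fs \<and> sorted_wrt (<) js \<and>
       (\<forall>i<length fs. js ! i \<ge> 1 \<and> fs ! i \<in> G1_level (js ! i)))}"

definition coding1 :: "nat set \<Rightarrow> (c00 list \<Rightarrow> nat) \<Rightarrow> bool" where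
  "coding1 M2 \<sigma>1 \<longleftrightarrow> inj_on \<sigma>1 U_seqs \<and> \<sigma>1 ` U_seqs \<subseteq> M2 \<and>
     (\<forall>fs f. fs \<in> U_seqs \<and> fs @ [f] \<in> U_seqs \<longrightarrow> \<sigma>1 fs < \<sigma>1 (fs @ [f]))"

text \<open>In the following definitions \<open>S\<close> is the Schreier family of order \<open>\<xi>\<close>.\<close>

definition special_seq :: "nat set set \<Rightarrow> nat set \<Rightarrow> (c00 list \<Rightarrow> nat) \<Rightarrow> c00 list \<Rightarrow> bool" where
  "special_seq S M1 \<sigma>1 fs \<longleftrightarrow> fs \<in> U_seqs \<and> (\<lambda>f. Min (supp f)) ` set fs \<in> S \<and>
     (\<exists>j\<in>M1. fs ! 0 \<in> G1_level j) \<and>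
     (\<forall>i. 1 \<le> i \<and> i < length fs \<longrightarrow> fs ! i \<in> G1_level (\<sigma>1 (take i fs)))"

definition Gsp_set :: "nat set set \<Rightarrow> nat set \<Rightarrow> (c00 list \<Rightarrow> nat) \<Rightarrow> c00 set" where
  "Gsp_set S M1 \<sigma>1 = {restrict E (\<Sum>i<length fs. \<epsilon> i *\<^sub>R fs ! i) | E \<epsilon> fs.
     special_seq S M1 \<sigma>1 fs \<and> (\<forall>i<length fs. \<epsilon> i \<in> {-1, 1}) \<and> nat_interval E}"

text \<open>\<open>has_ind S M1 \<sigma>1 \<phi> J\<close> says that \<open>J\<close> is the index set of \<open>\<phi>\<close>. It is a relation because the
  index set is defined through a representation of \<open>\<phi>\<close>; it does not depend on the representation,
  since an index \<open>j\<close> is read off the modulus of a nonzero coordinate.\<close>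

definition has_ind ::
  "nat set set \<Rightarrow> nat set \<Rightarrow> (c00 list \<Rightarrow> nat) \<Rightarrow> c00 \<Rightarrow> nat set \<Rightarrow> bool" where
  "has_ind S M1 \<sigma>1 \<phi> J \<longleftrightarrow>
     (\<exists>j\<ge>1. \<phi> \<in> G1_level j \<and> J = {j}) \<or>
     (\<exists>E \<epsilon> fs. special_seq S M1 \<sigma>1 fs \<and> (\<forall>i<length fs. \<epsilon> i \<in> {-1, 1}) \<and> nat_interval E \<and>
        \<phi> = restrict E (\<Sum>i<length fs. \<epsilon> i *\<^sub>R fs ! i) \<and>
        J = {ind (fs ! i) | i. i < length fs \<and> restrict E (fs ! i) \<noteq> 0})"

definition Gl2_set :: "nat set set \<Rightarrow> nat set \<Rightarrow> (c00 list \<Rightarrow> nat) \<Rightarrow> c00 set" where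
  "Gl2_set S M1 \<sigma>1 = {(\<Sum>i<d. a i *\<^sub>R \<phi> i) | (d :: nat) a \<phi>.
     d \<ge> 1 \<and> (\<forall>i<d. a i \<in> \<rat>) \<and> (\<Sum>i<d. (a i)\<^sup>2) \<le> 1 \<and>
     (\<forall>i<d. \<phi> i \<in> Gsp_set S M1 \<sigma>1 \<union> G1_set) \<and>
     (\<exists>J. (\<forall>i<d. has_ind S M1 \<sigma>1 (\<phi> i) (J i)) \<and> disjoint_family_on J {..<d})}"

definition G_set :: "nat set set \<Rightarrow> nat set \<Rightarrow> (c00 list \<Rightarrow> nat) \<Rightarrow> c00 set" where
  "G_set S M1 \<sigma>1 = G0_set \<union> G1_set \<union> Gsp_set S M1 \<sigma>1 \<union> Gl2_set S M1 \<sigma>1"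


section \<open>The norming set\<close>

definition Q_seqs :: "c00 list set" where
  "Q_seqs = {fs. fs \<noteq> [] \<and> sorted_wrt block_less fs \<and>
     (\<forall>f\<in>set fs. f \<noteq> 0 \<and> (\<forall>n. coord f n \<in> \<rat>))}"

definition coding :: "nat set \<Rightarrow> (c00 list \<Rightarrow> nat) \<Rightarrow> bool" where
  "coding N2 \<sigma> \<longleftrightarrow> inj_on \<sigma> Q_seqs \<and> \<sigma> ` Q_seqs \<subseteq> N2 \<and>
     (\<forall>fs\<in>Q_seqs. sqrt (real (mseq (2 * \<sigma> fs))) >
        Max {1 / \<bar>coord f l\<bar> | f l. f \<in> set fs \<and> l \<in> supp f} * real (Max (supp (last fs))))"

definition op_results :: "c00 set \<Rightarrow> nat \<Rightarrow> c00 set" where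
  "op_results K j = {(1 / real (mseq j)) *\<^sub>R sum_list fs | fs.
     fs \<noteq> [] \<and> length fs \<le> nseq j \<and> sorted_wrt block_less fs \<and> set fs \<subseteq> K}"

text \<open>The list entry \<open>fs ! i\<close> is the \<open>(i+1)\<close>-st term \<open>f\<^bsub>i+1\<^esub>\<close> of the sequence, so even positions
  \<open>i\<close> of the list are the odd-numbered terms; \<open>take i fs\<close> consists of the first \<open>i\<close> terms.\<close>

definition attractor_seq ::
  "nat set \<Rightarrow> (nat \<Rightarrow> nat set) \<Rightarrow> (c00 list \<Rightarrow> nat) \<Rightarrow> c00 set \<Rightarrow> nat \<Rightarrow> c00 list \<Rightarrow> bool" where
  "attractor_seq N1 \<Lambda> \<sigma> K j fs \<longleftrightarrow>
     fs \<in> Q_seqs \<and> length fs \<le> nseq (2 * j - 1) \<and> set fs \<subseteq> K \<and>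
     (\<exists>j1\<in>N1. mseq (2 * j1) > nseq (2 * j - 1) ^ 3 \<and> fs ! 0 \<in> op_results K (2 * j1)) \<and>
     (\<forall>i. 1 \<le> i \<and> i < length fs \<and> even i \<longrightarrow> fs ! i \<in> op_results K (2 * \<sigma> (take i fs))) \<and>
     (\<forall>i. i < length fs \<and> odd i \<longrightarrow> (\<exists>l\<in>\<Lambda> (\<sigma> (take i fs)). fs ! i = unit_vec l))"

definition K_closed ::
  "c00 set \<Rightarrow> nat set \<Rightarrow> (nat \<Rightarrow> nat set) \<Rightarrow> (c00 list \<Rightarrow> nat) \<Rightarrow> c00 set \<Rightarrow> bool" where
  "K_closed G N1 \<Lambda> \<sigma> K \<longleftrightarrow>
     (\<forall>f\<in>K. - f \<in> K) \<and> (\<forall>f\<in>K. \<forall>E. nat_interval E \<longrightarrow> restrict E f \<in> K) \<and> G \<subseteq> K \<and>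
     (\<forall>j\<ge>1. op_results K (2 * j) \<subseteq> K) \<and>
     (\<forall>j\<ge>1. \<forall>fs. attractor_seq N1 \<Lambda> \<sigma> K j fs \<longrightarrow>
        (1 / real (mseq (2 * j - 1))) *\<^sub>R sum_list fs \<in> K) \<and>
     (\<forall>(A :: nat set) c f js. finite A \<and>
        (\<forall>i\<in>A. js i \<ge> 1 \<and> f i \<in> K \<and> f i \<in> op_results K (js i) \<and> c i \<in> \<rat>) \<and>
        (\<forall>i\<in>A. \<forall>k\<in>A. i \<noteq> k \<longrightarrow> nseq (js i) \<noteq> nseq (js k)) \<and> (\<Sum>i\<in>A. (c i)\<^sup>2) \<le> 1 \<longrightarrow>
        (\<Sum>i\<in>A. c i *\<^sub>R f i) \<in> K) \<and>
     (\<forall>(A :: nat set) c f. finite A \<and>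
        (\<forall>i\<in>A. f i \<in> K \<and> c i \<in> \<rat> \<and> c i \<ge> 0) \<and> (\<Sum>i\<in>A. c i) = 1 \<longrightarrow>
        (\<Sum>i\<in>A. c i *\<^sub>R f i) \<in> K)"

definition K_set ::
  "c00 set \<Rightarrow> nat set \<Rightarrow> (nat \<Rightarrow> nat set) \<Rightarrow> (c00 list \<Rightarrow> nat) \<Rightarrow> c00 set" where
  "K_set G N1 \<Lambda> \<sigma> = \<Inter> {K. K_closed G N1 \<Lambda> \<sigma> K}"

lemma op_results_mono: "K \<subseteq> K' \<Longrightarrow> op_results K j \<subseteq> op_results K' j"
  unfolding op_results_def by blast

lemma attractor_seq_mono:
  "K \<subseteq> K' \<Longrightarrow> attractor_seq N1 \<Lambda> \<sigma> K j fs \<Longrightarrow> attractor_seq N1 \<Lambda> \<sigma> K' j fs"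
  unfolding attractor_seq_def using op_results_mono[of K K'] by blast

lemma K_set_lower: "K_closed G N1 \<Lambda> \<sigma> K \<Longrightarrow> K_set G N1 \<Lambda> \<sigma> \<subseteq> K"
  unfolding K_set_def by blast

lemma K_closed_K_set: "K_closed G N1 \<Lambda> \<sigma> (K_set G N1 \<Lambda> \<sigma>)"
proof -
  let ?K = "K_set G N1 \<Lambda> \<sigma>"
  have I: "f \<in> ?K" if "\<And>K. K_closed G N1 \<Lambda> \<sigma> K \<Longrightarrow> ?K \<subseteq> K \<Longrightarrow> f \<in> K" for f
    using that K_set_lower unfolding K_set_def by blast
  have 1: "- f \<in> ?K" if "f \<in> ?K" for f
    using that by (intro I) (auto simp: K_closed_def)
  have 2: "restrict E f \<in> ?K" if "f \<in> ?K" "nat_interval E" for f E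
    using that by (intro I) (auto simp: K_closed_def)
  have 3: "G \<subseteq> ?K"
    by (auto intro!: I simp: K_closed_def)
  have 4: "f \<in> ?K" if j: "1 \<le> j" and f: "f \<in> op_results ?K (2 * j)" for j f
  proof (rule I)
    fix K assume K: "K_closed G N1 \<Lambda> \<sigma> K" and sub: "?K \<subseteq> K"
    have "op_results K (2 * j) \<subseteq> K" using K j by (simp add: K_closed_def)
    then show "f \<in> K" using op_results_mono[OF sub] f by blast
  qed
  have 5: "(1 / real (mseq (2 * j - 1))) *\<^sub>R sum_list fs \<in> ?K"
    if j: "1 \<le> j" and fs: "attractor_seq N1 \<Lambda> \<sigma> ?K j fs" for j fs
  proof (rule I)
    fix K assume K: "K_closed G N1 \<Lambda> \<sigma> K" and sub: "?K \<subseteq> K"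
    show "(1 / real (mseq (2 * j - 1))) *\<^sub>R sum_list fs \<in> K"
      using K j attractor_seq_mono[OF sub fs] by (simp add: K_closed_def)
  qed
  have 6: "(\<Sum>i\<in>A. c i *\<^sub>R f i) \<in> ?K"
    if A: "finite A"
      "\<forall>i\<in>A. js i \<ge> 1 \<and> f i \<in> ?K \<and> f i \<in> op_results ?K (js i) \<and> c i \<in> \<rat>"
      "\<forall>i\<in>A. \<forall>k\<in>A. i \<noteq> k \<longrightarrow> nseq (js i) \<noteq> nseq (js k)" "(\<Sum>i\<in>A. (c i)\<^sup>2) \<le> 1"
    for A :: "nat set" and c f js
  proof (rule I)
    fix K assume K: "K_closed G N1 \<Lambda> \<sigma> K" and sub: "?K \<subseteq> K"
    have *: "\<forall>i\<in>A. js i \<ge> 1 \<and> f i \<in> K \<and> f i \<in> op_results K (js i) \<and> c i \<in> \<rat>"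
      using A(2) op_results_mono[OF sub] sub by blast
    from K have "\<forall>(A :: nat set) c f js. finite A \<and>
        (\<forall>i\<in>A. js i \<ge> 1 \<and> f i \<in> K \<and> f i \<in> op_results K (js i) \<and> c i \<in> \<rat>) \<and>
        (\<forall>i\<in>A. \<forall>k\<in>A. i \<noteq> k \<longrightarrow> nseq (js i) \<noteq> nseq (js k)) \<and> (\<Sum>i\<in>A. (c i)\<^sup>2) \<le> 1 \<longrightarrow>
        (\<Sum>i\<in>A. c i *\<^sub>R f i) \<in> K"
      unfolding K_closed_def by (elim conjE)
    from this[THEN spec, THEN spec, THEN spec, THEN spec, THEN mp, OF conjI[OF A(1) conjI[OF * conjI[OF A(3,4)]]]]
    show "(\<Sum>i\<in>A. c i *\<^sub>R f i) \<in> K" .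
  qed
  have 7: "(\<Sum>i\<in>A. c i *\<^sub>R f i) \<in> ?K"
    if A: "finite A" "\<forall>i\<in>A. f i \<in> ?K \<and> c i \<in> \<rat> \<and> c i \<ge> 0" "(\<Sum>i\<in>A. c i) = 1"
    for A :: "nat set" and c f
  proof (rule I)
    fix K assume K: "K_closed G N1 \<Lambda> \<sigma> K" and sub: "?K \<subseteq> K"
    have *: "\<forall>i\<in>A. f i \<in> K \<and> c i \<in> \<rat> \<and> c i \<ge> 0"
      using A(2) sub by blast
    from K have "\<forall>(A :: nat set) c f. finite A \<and>
        (\<forall>i\<in>A. f i \<in> K \<and> c i \<in> \<rat> \<and> c i \<ge> 0) \<and> (\<Sum>i\<in>A. c i) = 1 \<longrightarrow>
        (\<Sum>i\<in>A. c i *\<^sub>R f i) \<in> K"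
      unfolding K_closed_def by (elim conjE)
    from this[THEN spec, THEN spec, THEN spec, THEN mp, OF conjI[OF A(1) conjI[OF * A(3)]]]
    show "(\<Sum>i\<in>A. c i *\<^sub>R f i) \<in> K" .
  qed
  show ?thesis
    unfolding K_closed_def[of _ _ _ _ ?K]
    by (intro conjI ballI allI impI subsetI; (elim conjE)?;
        rule 1 2 3[THEN subsetD] 4 5 6 7; assumption)
qed

definition K_norm :: "c00 set \<Rightarrow> c00 \<Rightarrow> real" where
  "K_norm K x = (SUP f\<in>K. act f x)"


section \<open>Completions, quotients and basic sequences\<close>

text \<open>The type \<open>'x\<close>, together with the canonical embedding \<open>\<iota>\<close>, is a completion of
  \<open>c00\<close> with the norm \<open>N\<close>.\<close>

definition is_completion :: "(c00 \<Rightarrow> real) \<Rightarrow> (c00 \<Rightarrow> 'x::banach) \<Rightarrow> bool" where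
  "is_completion N \<iota> \<longleftrightarrow> linear \<iota> \<and> (\<forall>x. norm (\<iota> x) = N x) \<and> closure (range \<iota>) = UNIV"

definition closed_span :: "'x::real_normed_vector set \<Rightarrow> 'x set" where
  "closed_span A = closure (span A)"

text \<open>The type \<open>'y\<close>, together with the canonical surjection \<open>q\<close>, is the quotient of \<open>'x\<close> by the
  closed subspace \<open>Z\<close>: the norm of a coset \<open>x + Z\<close> is the distance of \<open>x\<close> to \<open>Z\<close>, so that in
  particular \<open>q\<close> has kernel \<open>Z\<close>.\<close>

definition is_quotient_map :: "'x::banach set \<Rightarrow> ('x \<Rightarrow> 'y::banach) \<Rightarrow> bool" where
  "is_quotient_map Z q \<longleftrightarrow> linear q \<and> surj q \<and> (\<forall>x. norm (q x) = infdist x Z)"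

text \<open>\<open>(x\<^sub>i)\<close>, \<open>i \<ge> 1\<close>, is a Schauder basis of its closed linear span.\<close>

definition basic_sequence :: "(nat \<Rightarrow> 'y::real_normed_vector) \<Rightarrow> bool" where
  "basic_sequence x \<longleftrightarrow>
     (\<forall>y\<in>closed_span (x ` {1..}). \<exists>!a :: nat \<Rightarrow> real. a 0 = 0 \<and> (\<lambda>i. a i *\<^sub>R x i) sums y)"

definition normalized :: "(nat \<Rightarrow> 'y::real_normed_vector) \<Rightarrow> bool" where
  "normalized x \<longleftrightarrow> (\<forall>i\<ge>1. norm (x i) = 1)"

definition equivalent_to_l1 :: "real \<Rightarrow> nat set \<Rightarrow> (nat \<Rightarrow> 'y::real_normed_vector) \<Rightarrow> bool" where
  "equivalent_to_l1 C F x \<longleftrightarrow>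
     (\<forall>a :: nat \<Rightarrow> real. (1 / C) * (\<Sum>i\<in>F. \<bar>a i\<bar>) \<le> norm (\<Sum>i\<in>F. a i *\<^sub>R x i) \<and>
        norm (\<Sum>i\<in>F. a i *\<^sub>R x i) \<le> C * (\<Sum>i\<in>F. \<bar>a i\<bar>))"

definition generates_l1_spreading_model :: "(nat \<Rightarrow> 'y::real_normed_vector) \<Rightarrow> bool" where
  "generates_l1_spreading_model x \<longleftrightarrow> (\<exists>C\<ge>1. \<forall>F\<in>schreier_one. equivalent_to_l1 C F x)"

end

theory Submission
  imports Defs "HOL-Complex_Analysis.Great_Picard"
begin

text \<open>
  Lifting vectors from the quotient to \<open>X\<^bsub>\<xi>\<^esub>\<close> preserves lower \<open>\<ell>\<^sub>1\<close>-estimates, so it suffices that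
  \<open>X\<^bsub>\<xi>\<^esub>\<close> has no bounded sequence with lower \<open>\<ell>\<^sub>1\<close>-estimates on Schreier sets; differences and a gliding
  hump reduce to block sequences of \<open>c00\<close>. For these, averages of a suitable fixed length of a
  subsequence have at most half the norm. Iterating, averages have arbitrarily small norm, which
  contradicts the lower estimate.

  The norm of an average is the maximum of an \<open>\<ell>\<^sub>2\<close>-sum over the weights \<open>m\<^sub>j\<close> and a ground part.
  A functional of weight \<open>m\<^sub>j\<close> takes essentially at most \<open>1 / m\<^sub>j\<close> on long averages, and the sequences of
  weighted norms of the blocks, being bounded in \<open>\<ell>\<^sub>2\<close>, have a coordinatewise convergent subsequence
  whose tails are almost orthogonal. The same argument kills the part coming from \<open>G\<^sub>1\<close>. For special
  functionals, regard special sequences as branches of a tree. By injectivity of \<open>\<sigma>\<^sub>1\<close>, the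
  \<open>\<ell>\<^sub>2\<close>-masses that functionals through the different children of a node put on a block add up to at
  most 1. Mass that persisted on functionals through arbitrarily late nodes would therefore
  concentrate along an infinite branch, which compactness of the Schreier family excludes; so the
  special functionals act almost orthogonally on a subsequence as well.
\<close>

section \<open>Sequences of real numbers\<close>

text \<open>What is iterated has to survive averaging, so the lower estimate is weakened to sums of
  N late blocks with equal coefficients, for every fixed N. Averages keep it with the same
  \<open>\<delta>\<close> while the bound is halved, and the case N = 1 is enough for the
  contradiction. All square sums come from duality: the norming set contains the rational
  l2-combinations of functionals of different weights, and of ground functionals with disjoint index
  sets, so their squared values on a vector of norm at most 1 add up to at most 1. If the values on
  different blocks are \<open>\<epsilon>\<close>-orthogonal, the sum of N blocks has mass at most N
  + \<open>\<epsilon>\<close> N^2, hence their average at most 1/N + \<open>\<epsilon>\<close>. The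
  obstacle in the tree is a term of a special sequence that straddles the end of a block. Infinitely
  many terms can do so, hence no finite set of nodes captures them, and such a term can also act on
  later blocks. They are controlled through \<open>G1_set\<close> alone, which is why averages that
  are small on \<open>G1_set\<close> are formed before the tree argument starts.\<close>

text \<open>The threshold for \<open>l\<close> depends on \<open>k\<close> alone. If each chosen
  index passes the threshold of its predecessor, then by monotonicity all later ones pass it
  too.\<close>

lemma strict_mono_subseq_pairwise:
  fixes P :: "nat \<Rightarrow> nat \<Rightarrow> bool"
  assumes "\<forall>\<^sub>F k in sequentially. \<forall>\<^sub>F l in sequentially. P k l"
  obtains r :: "nat \<Rightarrow> nat" where "strict_mono r" "\<And>a b. a < b \<Longrightarrow> P (r a) (r b)"
proof -
  obtain k0 where k0: "\<And>k. k \<ge> k0 \<Longrightarrow> \<exists>m. \<forall>l\<ge>m. P k l"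
    using assms unfolding eventually_sequentially by blast
  then obtain t where t: "\<And>k l. k \<ge> k0 \<Longrightarrow> l \<ge> t k \<Longrightarrow> P k l"
    by metis
  define r where "r = rec_nat k0 (\<lambda>_ x. max (Suc x) (t x))"
  have r: "r 0 = k0" "\<And>a. r (Suc a) = max (Suc (r a)) (t (r a))"
    by (simp_all add: r_def)
  have sm: "strict_mono r"
    by (rule strict_monoI_Suc) (simp add: r(2))
  have "P (r a) (r b)" if "a < b" for a b
  proof (rule t)
    show "k0 \<le> r a" using sm r(1) by (metis strict_mono_less_eq zero_le)
    have "t (r a) \<le> r (Suc a)" by (simp add: r(2))
    also have "\<dots> \<le> r b" using sm that by (simp add: strict_mono_less_eq)
    finally show "t (r a) \<le> r b" .
  qed
  with sm that show ?thesis by blast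
qed

text \<open>Expand the square: the diagonal contributes at most \<open>card F\<close>, every other
  pair at most \<open>\<epsilon>\<close>. Divided by the square of \<open>card F\<close> this bounds
  the mass of an average, the form in which almost orthogonality is used throughout.\<close>

lemma almost_orthogonal_sum_bound:
  fixes c :: "'i \<Rightarrow> nat \<Rightarrow> real" and \<epsilon> :: real
  assumes F: "finite F" and D: "\<And>k. k \<in> F \<Longrightarrow> (\<Sum>i\<in>I. (c i k)^2) \<le> 1"
    and O: "\<And>k l. k \<in> F \<Longrightarrow> l \<in> F \<Longrightarrow> k < l \<Longrightarrow> (\<Sum>i\<in>I. c i k * c i l) \<le> \<epsilon>"
    and e: "0 \<le> \<epsilon>"
  shows "(\<Sum>i\<in>I. (\<Sum>k\<in>F. c i k)^2) \<le> card F + \<epsilon> * (card F)^2"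
proof -
  have "(\<Sum>i\<in>I. (\<Sum>k\<in>F. c i k)^2) = (\<Sum>i\<in>I. \<Sum>k\<in>F. \<Sum>l\<in>F. c i k * c i l)"
    by (simp add: power2_eq_square sum_product)
  also have "\<dots> = (\<Sum>k\<in>F. \<Sum>l\<in>F. \<Sum>i\<in>I. c i k * c i l)"
    by (subst sum.swap, rule sum.cong[OF refl], rule sum.swap)
  also have "\<dots> \<le> (\<Sum>k\<in>F. \<Sum>l\<in>F. (if k = l then 1 else 0) + \<epsilon>)"
  proof (intro sum_mono)
    fix k l assume kl: "k \<in> F" "l \<in> F"
    show "(\<Sum>i\<in>I. c i k * c i l) \<le> (if k = l then 1 else 0) + \<epsilon>"
    proof (cases k l rule: linorder_cases)
      case less then show ?thesis using O[OF kl] by simp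
    next
      case equal then show ?thesis using D[OF kl(1)] e by (simp add: power2_eq_square)
    next
      case greater then show ?thesis using O[OF kl(2,1)] by (simp add: mult.commute)
    qed
  qed
  also have "\<dots> = card F + \<epsilon> * (card F)^2"
    using F by (simp add: sum.distrib power2_eq_square algebra_simps)
  finally show ?thesis .
qed

text \<open>Near-maximizers can be chosen independently for each \<open>i\<close>. A bound for every
  selection, one choice per level or per node, thus becomes a bound for the suprema.\<close>

lemma sum_Sup_le:
  fixes X :: "'i \<Rightarrow> real set"
  assumes "finite I" and ne: "\<And>i. i \<in> I \<Longrightarrow> X i \<noteq> {}" and bd: "\<And>i. i \<in> I \<Longrightarrow> bdd_above (X i)"
    and le: "\<And>x. (\<And>i. i \<in> I \<Longrightarrow> x i \<in> X i) \<Longrightarrow> (\<Sum>i\<in>I. x i) \<le> M"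
  shows "(\<Sum>i\<in>I. Sup (X i)) \<le> M"
proof (rule field_le_epsilon)
  fix e :: real assume e: "e > 0"
  define d where "d = e / (card I + 1)"
  have d: "d > 0" using e by (simp add: d_def)
  have "\<exists>x. x \<in> X i \<and> Sup (X i) - d < x" if "i \<in> I" for i
    using less_cSupD[OF ne[OF that], of "Sup (X i) - d"] d by auto
  then obtain x where x: "\<And>i. i \<in> I \<Longrightarrow> x i \<in> X i \<and> Sup (X i) - d < x i"
    by metis
  have "(\<Sum>i\<in>I. Sup (X i)) \<le> (\<Sum>i\<in>I. x i + d)"
    by (rule sum_mono) (use x in force)
  also have "\<dots> = (\<Sum>i\<in>I. x i) + card I * d" by (simp add: sum.distrib)
  also have "\<dots> \<le> M + e"
  proof -
    have "card I * d \<le> e" using e by (simp add: d_def field_simps)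
    then show ?thesis using le[of x] x by fastforce
  qed
  finally show "(\<Sum>i\<in>I. Sup (X i)) \<le> M + e" .
qed

lemma sum_squares_le_of_rational_dual:
  fixes x :: "'i \<Rightarrow> real"
  assumes "finite I" "0 \<le> M"
    and le: "\<And>c. (\<And>i. c i \<in> \<rat>) \<Longrightarrow> (\<Sum>i\<in>I. (c i)^2) \<le> 1 \<Longrightarrow> (\<Sum>i\<in>I. c i * x i) \<le> M"
  shows "(\<Sum>i\<in>I. (x i)^2) \<le> M^2"
proof -
  define s where "s = sqrt (\<Sum>i\<in>I. (x i)^2)"
  have s2: "s^2 = (\<Sum>i\<in>I. (x i)^2)" and s0: "s \<ge> 0"
    by (simp_all add: s_def sum_nonneg)
  have "s \<le> M"
  proof (cases "s = 0")
    case False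
    then have s: "s > 0" using s0 by simp
    \<comment> \<open>The factor \<open>u\<close> opens a gap below
      \<open>\<bar>x i\<bar> / s\<close> in which a rational coefficient can be found; it tends to 1
      at the end.\<close>
    have "u * s \<le> M" if u: "0 < u" "u < 1" for u
    proof -
      have "\<exists>c\<in>\<rat>. c^2 \<le> (x i / s)^2 \<and> u * (x i)^2 / s \<le> c * x i" for i
      proof (cases "x i = 0")
        case True then show ?thesis by (intro bexI[of _ 0]) auto
      next
        case False
        then have "u * (\<bar>x i\<bar> / s) < 1 * (\<bar>x i\<bar> / s)"
          by (intro mult_strict_right_mono) (use u s in auto)
        then obtain c where c: "c \<in> \<rat>" "u * (\<bar>x i\<bar> / s) < c" "c < \<bar>x i\<bar> / s"
          using Rats_dense_in_real[of "u * (\<bar>x i\<bar> / s)" "\<bar>x i\<bar> / s"] by auto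
        have c0: "0 < c" using c(2) u s False
          by (meson abs_ge_zero divide_nonneg_pos less_imp_le mult_nonneg_nonneg order_le_less_trans)
        have 1: "c^2 \<le> (x i / s)^2"
          using c(3) c0 s by (simp add: abs_le_square_iff[symmetric])
        have "u * (\<bar>x i\<bar> / s) * \<bar>x i\<bar> \<le> c * \<bar>x i\<bar>"
          using c(2) by (intro mult_right_mono) auto
        then have 2: "u * (x i)^2 / s \<le> c * \<bar>x i\<bar>"
          by (simp add: power2_eq_square)
        show ?thesis
        proof (cases "x i \<ge> 0")
          case True then show ?thesis using 1 2 c(1) by (intro bexI[of _ c]) auto
        next
          case False then show ?thesis using 1 2 c(1) by (intro bexI[of _ "- c"]) auto
        qed
      qed
      then obtain c where c: "\<And>i. c i \<in> \<rat>" "\<And>i. (c i)^2 \<le> (x i / s)^2"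
          "\<And>i. u * (x i)^2 / s \<le> c i * x i"
        by metis
      have "(\<Sum>i\<in>I. (c i)^2) \<le> (\<Sum>i\<in>I. (x i / s)^2)" by (rule sum_mono) (rule c)
      also have "\<dots> = 1"
        using s by (simp add: power_divide sum_divide_distrib[symmetric] s2[symmetric])
      finally have "(\<Sum>i\<in>I. c i * x i) \<le> M" using le[of c] c(1) by blast
      moreover have "(\<Sum>i\<in>I. u * (x i)^2 / s) = u * s^2 / s"
        by (simp add: sum_divide_distrib[symmetric] sum_distrib_left[symmetric] s2)
      then have "u * s = (\<Sum>i\<in>I. u * (x i)^2 / s)"
        using s by (simp add: power2_eq_square)
      moreover have "(\<Sum>i\<in>I. u * (x i)^2 / s) \<le> (\<Sum>i\<in>I. c i * x i)" by (rule sum_mono) (rule c)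
      ultimately show ?thesis by simp
    qed
    then show ?thesis by (rule field_le_mult_one_interval)
  qed (use assms in simp)
  then show ?thesis using s0 s2 by (metis power_mono)
qed

lemma sum_mult_le_sqrt:
  fixes a b :: "'i \<Rightarrow> real"
  shows "(\<Sum>i\<in>I. a i * b i) \<le> sqrt (\<Sum>i\<in>I. (a i)^2) * sqrt (\<Sum>i\<in>I. (b i)^2)"
  using real_le_rsqrt[OF Cauchy_Schwarz_ineq_sum[of a b I]] by (simp add: real_sqrt_mult)

lemma sum_squares_subset_le:
  fixes x :: "'i \<Rightarrow> real"
  assumes "finite I" "I' \<subseteq> I" "(\<Sum>i\<in>I. (x i)^2) \<le> M" shows "(\<Sum>i\<in>I'. (x i)^2) \<le> M"
  using sum_mono2[OF assms(1,2), of "\<lambda>i. (x i)^2"] assms(3) by simp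

lemma sum_mult_le_of_squares:
  fixes x z :: "'i \<Rightarrow> real"
  assumes "(\<Sum>i\<in>I. (x i)^2) \<le> A^2" "(\<Sum>i\<in>I. (z i)^2) \<le> B^2" "0 \<le> A" "0 \<le> B"
  shows "(\<Sum>i\<in>I. x i * z i) \<le> A * B"
proof -
  have "sqrt (\<Sum>i\<in>I. (x i)^2) \<le> A" "sqrt (\<Sum>i\<in>I. (z i)^2) \<le> B"
    using assms by (auto intro!: real_le_lsqrt sum_nonneg)
  then have "sqrt (\<Sum>i\<in>I. (x i)^2) * sqrt (\<Sum>i\<in>I. (z i)^2) \<le> A * B"
    by (intro mult_mono) (use assms in \<open>auto intro: sum_nonneg\<close>)
  then show ?thesis using sum_mult_le_sqrt[of x z I] by linarith
qed

lemma summable_tail_le: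
  fixes w :: "nat \<Rightarrow> real"
  assumes "\<And>j. 0 \<le> w j" "\<And>n. (\<Sum>j<n. w j) \<le> M" "0 < \<epsilon>"
  obtains J where "\<And>J' n. J \<le> J' \<Longrightarrow> (\<Sum>j\<in>{J'..<n}. w j) \<le> \<epsilon>"
proof -
  have "summable w"
    using assms(1,2) by (intro summableI_nonneg_bounded[of w M]) auto
  then obtain J where J: "\<And>m n. J \<le> m \<Longrightarrow> norm (\<Sum>j\<in>{m..<n}. w j) < \<epsilon>"
    using assms(3) unfolding summable_Cauchy by blast
  show ?thesis
    using J by (intro that[of J]) (metis abs_ge_self less_imp_le order_trans real_norm_def)
qed

text \<open>A subsequence converges coordinatewise to some \<open>v\<close> in the unit ball of l2.
  The cut \<open>J\<close> makes the tail of \<open>v\<close> small, the cut \<open>K k\<close> the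
  tail of the k-th sequence. Between the cuts a late sequence is close to \<open>v\<close>, and
  beyond \<open>K k\<close> the k-th one is small, so the tails are almost orthogonal. Below
  \<open>J\<close> nothing is claimed, since \<open>v\<close> need not vanish there.\<close>

lemma l2_bounded_subseq_sum_tail:
  fixes V :: "nat \<Rightarrow> nat \<Rightarrow> real" and \<epsilon> :: real
  assumes nn: "\<And>k j. 0 \<le> V k j" and bd: "\<And>k n. (\<Sum>j<n. (V k j)^2) \<le> 1" and e: "0 < \<epsilon>"
  obtains r :: "nat \<Rightarrow> nat" and J where "strict_mono r"
    "\<And>F n. finite F \<Longrightarrow> (\<Sum>j\<in>{J..<n}. (\<Sum>k\<in>F. V (r k) j)^2) \<le> card F + \<epsilon> * (card F)^2"
proof -
  have sub1: "(\<Sum>j\<in>A. (V k j)^2) \<le> 1" if "finite A" for k A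
  proof -
    obtain n where "A \<subseteq> {..<n}" using \<open>finite A\<close> by (meson finite_nat_iff_bounded)
    then have "(\<Sum>j\<in>A. (V k j)^2) \<le> (\<Sum>j<n. (V k j)^2)" by (intro sum_mono2) auto
    then show ?thesis using bd[of k n] by linarith
  qed
  have V1: "norm (V k j) \<le> 1" for k j
    using sub1[of "{j}" k] nn[of k j] by (simp add: abs_square_le_1)
  obtain r0 where r0: "strict_mono (r0 :: nat \<Rightarrow> nat)"
      "\<And>j. \<exists>l. (\<lambda>k. V (r0 k) j) \<longlonglongrightarrow> l"
    using function_convergent_subsequence[of UNIV V 1] V1 by auto
  then obtain v where v: "\<And>j. (\<lambda>k. V (r0 k) j) \<longlonglongrightarrow> v j" by metis
  define U where "U = (\<lambda>k. V (r0 k))"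
  have vn: "0 \<le> v j" for j using v[of j] nn by (intro LIMSEQ_le_const) auto
  have vb: "(\<Sum>j<n. (v j)^2) \<le> 1" for n
  proof (rule LIMSEQ_le_const2)
    show "(\<lambda>k. \<Sum>j<n. (V (r0 k) j)^2) \<longlonglongrightarrow> (\<Sum>j<n. (v j)^2)"
      by (intro tendsto_intros v)
  qed (use bd in auto)
  obtain J where J: "\<And>J' n. J \<le> J' \<Longrightarrow> (\<Sum>j\<in>{J'..<n}. (v j)^2) \<le> (\<epsilon>/4)^2"
    using summable_tail_le[of "\<lambda>j. (v j)^2" 1 "(\<epsilon>/4)^2"] vb e by auto
  have "\<exists>K\<ge>J. \<forall>n. (\<Sum>j\<in>{K..<n}. (U k j)^2) \<le> (\<epsilon>/4)^2" for k
  proof -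
    obtain K where "\<And>J' n. K \<le> J' \<Longrightarrow> (\<Sum>j\<in>{J'..<n}. (U k j)^2) \<le> (\<epsilon>/4)^2"
      using summable_tail_le[of "\<lambda>j. (U k j)^2" 1 "(\<epsilon>/4)^2"] bd e by (auto simp: U_def)
    then show ?thesis by (intro exI[of _ "max J K"]) auto
  qed
  then obtain K where K: "\<And>k. J \<le> K k" "\<And>k n. (\<Sum>j\<in>{K k..<n}. (U k j)^2) \<le> (\<epsilon>/4)^2"
    by metis
  have ev: "\<forall>\<^sub>F l in sequentially. (\<Sum>j\<in>{J..<K k}. U k j * U l j) \<le> \<epsilon> / 2" for k
  proof -
    have "(\<lambda>l. \<Sum>j\<in>{J..<K k}. U k j * U l j) \<longlonglongrightarrow> (\<Sum>j\<in>{J..<K k}. U k j * v j)"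
      unfolding U_def by (intro tendsto_intros v)
    moreover have "(\<Sum>j\<in>{J..<K k}. U k j * v j) < \<epsilon> / 2"
    proof -
      have "(\<Sum>j\<in>{J..<K k}. U k j * v j) \<le>
          sqrt (\<Sum>j\<in>{J..<K k}. (U k j)^2) * sqrt (\<Sum>j\<in>{J..<K k}. (v j)^2)"
        by (rule sum_mult_le_sqrt)
      also have "\<dots> \<le> 1 * (\<epsilon>/4)"
      proof (rule mult_mono)
        show "sqrt (\<Sum>j\<in>{J..<K k}. (U k j)^2) \<le> 1" using sub1[of "{J..<K k}"] by (simp add: U_def)
        show "sqrt (\<Sum>j\<in>{J..<K k}. (v j)^2) \<le> \<epsilon>/4" using J[of J "K k"] e
          by (intro real_le_lsqrt) (auto intro: sum_nonneg)
      qed (auto intro: sum_nonneg)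
      finally show ?thesis using e by simp
    qed
    ultimately have "\<forall>\<^sub>F l in sequentially. (\<Sum>j\<in>{J..<K k}. U k j * U l j) < \<epsilon> / 2"
      by (rule order_tendstoD(2))
    then show ?thesis by (rule eventually_mono) simp
  qed
  obtain r1 where r1: "strict_mono (r1 :: nat \<Rightarrow> nat)"
      "\<And>a b. a < b \<Longrightarrow> (\<Sum>j\<in>{J..<K (r1 a)}. U (r1 a) j * U (r1 b) j) \<le> \<epsilon> / 2"
    using strict_mono_subseq_pairwise[of "\<lambda>k l. (\<Sum>j\<in>{J..<K k}. U k j * U l j) \<le> \<epsilon> / 2"] ev
    by (auto simp: eventually_True)
  have off: "(\<Sum>j\<in>{J..<n}. U (r1 a) j * U (r1 b) j) \<le> \<epsilon>" if "a < b" for a b n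
  proof -
    let ?k = "r1 a" and ?l = "r1 b"
    have nn': "0 \<le> U ?k j * U ?l j" for j using nn by (simp add: U_def)
    have "(\<Sum>j\<in>{J..<n}. U ?k j * U ?l j) \<le> (\<Sum>j\<in>{J..<K ?k} \<union> {K ?k..<n}. U ?k j * U ?l j)"
      by (intro sum_mono2) (use nn' in auto)
    also have "\<dots> = (\<Sum>j\<in>{J..<K ?k}. U ?k j * U ?l j) + (\<Sum>j\<in>{K ?k..<n}. U ?k j * U ?l j)"
      by (rule sum.union_disjoint) auto
    also have "(\<Sum>j\<in>{K ?k..<n}. U ?k j * U ?l j) \<le>
        sqrt (\<Sum>j\<in>{K ?k..<n}. (U ?k j)^2) * sqrt (\<Sum>j\<in>{K ?k..<n}. (U ?l j)^2)"
      by (rule sum_mult_le_sqrt)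
    also have "\<dots> \<le> (\<epsilon>/4) * 1"
    proof (rule mult_mono)
      show "sqrt (\<Sum>j\<in>{K ?k..<n}. (U ?l j)^2) \<le> 1" using sub1[of "{K ?k..<n}"] by (simp add: U_def)
      show "sqrt (\<Sum>j\<in>{K ?k..<n}. (U ?k j)^2) \<le> \<epsilon>/4" using K(2) e
        by (intro real_le_lsqrt) (auto intro: sum_nonneg)
    qed (use e in \<open>auto intro: sum_nonneg\<close>)
    finally show ?thesis using r1(2)[OF that] e by linarith
  qed
  show ?thesis
  proof (rule that[of "r0 \<circ> r1" J])
    show "strict_mono (r0 \<circ> r1)" using r0(1) r1(1) by (rule strict_mono_o)
    fix F :: "nat set" and n assume F: "finite F"
    have "(\<Sum>j\<in>{J..<n}. (\<Sum>k\<in>F. U (r1 k) j)^2) \<le> card F + \<epsilon> * (card F)^2"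
      by (rule almost_orthogonal_sum_bound[OF F]) (use off sub1[of "{J..<n}"] e in \<open>auto simp: U_def\<close>)
    then show "(\<Sum>j\<in>{J..<n}. (\<Sum>k\<in>F. V ((r0 \<circ> r1) k) j)^2) \<le> card F + \<epsilon> * (card F)^2"
      by (simp add: U_def)
  qed
qed


section \<open>Compactness of the Schreier families\<close>

text \<open>In the successor step the first of the successive blocks misses part of a fixed finite set, so
  the remaining blocks, one fewer in number, cover everything beyond that finite set.\<close>

lemma schreier_compact:
  assumes fs: "fundamental_sequences s" and "infinite A"
  shows "\<exists>F. finite F \<and> F \<subseteq> A \<and> (\<forall>G\<in>schreier s \<xi>. \<not> F \<subseteq> G)"
  using \<open>infinite A\<close>
proof (induction \<xi> arbitrary: A rule: less_induct)
  case (less \<xi>)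
  \<comment> \<open>Putting this fixed element into \<open>F\<close> leaves finitely many cases: a
    member containing \<open>a\<close> has at most \<open>a\<close> blocks in the successor case,
    and stems from a level with index at most \<open>a\<close> in the limit case.\<close>
  obtain a where a: "a \<in> A" using less.prems by (metis finite.emptyI ex_in_conv)
  consider "\<xi> = ord_zero" | \<eta> where "\<xi> = ord_suc \<eta>" | "ord_limit \<xi>"
    unfolding ord_limit_def by blast
  then show ?case
  proof cases
    case 1
    obtain b where b: "b \<in> A" "b \<noteq> a"
      using less.prems by (metis finite.emptyI finite_insert finite_subset insertI1 subsetI singletonD)
    then show ?thesis
      using a unfolding 1 schreier_zero by (intro exI[of _ "{a, b}"]) auto
  next
    case 2
    have small: "\<exists>F. finite F \<and> F \<subseteq> B \<and> (\<forall>G\<in>schreier s \<eta>. \<not> F \<subseteq> G)" if "infinite B" for B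
      using less.IH[of \<eta> B] that ord_suc_greater 2 by blast
    have cov: "\<exists>F. finite F \<and> F \<subseteq> B \<and> (\<forall>Fs. length Fs \<le> m \<longrightarrow> set Fs \<subseteq> schreier s \<eta> \<longrightarrow>
        sorted_wrt (\<lambda>F G. \<forall>k\<in>F. \<forall>l\<in>G. k < l) Fs \<longrightarrow> \<not> F \<subseteq> \<Union>(set Fs))"
      if "infinite B" for B m
      using that
    proof (induction m arbitrary: B)
      case 0
      then obtain b where "b \<in> B" by (metis finite.emptyI ex_in_conv)
      then show ?case by (intro exI[of _ "{b}"]) auto
    next
      case (Suc m)
      obtain F0 where F0: "finite F0" "F0 \<subseteq> B" "\<forall>G\<in>schreier s \<eta>. \<not> F0 \<subseteq> G"
        using small[OF Suc.prems] by blast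
      define p where "p = Max (insert 0 F0)"
      have p: "x \<le> p" if "x \<in> F0" for x using that F0(1) by (simp add: p_def)
      have "infinite (B - {..p})" using Suc.prems by (simp add: Diff_infinite_finite)
      from Suc.IH[OF this] obtain F1 where F1: "finite F1" "F1 \<subseteq> B - {..p}"
        "\<And>Fs. length Fs \<le> m \<Longrightarrow> set Fs \<subseteq> schreier s \<eta> \<Longrightarrow>
          sorted_wrt (\<lambda>F G. \<forall>k\<in>F. \<forall>l\<in>G. k < l) Fs \<Longrightarrow> \<not> F1 \<subseteq> \<Union>(set Fs)"
        by blast
      show ?case
      proof (intro exI[of _ "F0 \<union> F1"] conjI allI impI notI)
        fix Fs assume Fs: "length Fs \<le> Suc m" "set Fs \<subseteq> schreier s \<eta>"
          "sorted_wrt (\<lambda>F G. \<forall>k\<in>F. \<forall>l\<in>G. k < l) Fs" "F0 \<union> F1 \<subseteq> \<Union>(set Fs)"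
        show False
        proof (cases Fs)
          case Nil then show False using Fs(4) F1(3)[of "[]"] by simp
        next
          case (Cons G Gs)
          then obtain x where x: "x \<in> F0" "x \<notin> G" using F0(3) Fs(2) by auto
          then obtain H where H: "H \<in> set Gs" "x \<in> H" using Fs(4) Cons by auto
          have "k < x" if "k \<in> G" for k using Fs(3) Cons H that by auto
          then have "G \<inter> F1 = {}" using p[OF x(1)] F1(2) by fastforce
          then have "F1 \<subseteq> \<Union>(set Gs)" using Fs(4) Cons by auto
          then show False using F1(3)[of Gs] Fs Cons by auto
        qed
      qed (use F0 F1 in auto)
    qed
    obtain F where F: "finite F" "F \<subseteq> A" "\<And>Fs. length Fs \<le> a \<Longrightarrow> set Fs \<subseteq> schreier s \<eta> \<Longrightarrow>
        sorted_wrt (\<lambda>F G. \<forall>k\<in>F. \<forall>l\<in>G. k < l) Fs \<Longrightarrow> \<not> F \<subseteq> \<Union>(set Fs)"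
      using cov[OF less.prems, of a] by blast
    show ?thesis
    proof (intro exI[of _ "insert a F"] conjI ballI notI)
      fix G assume G: "G \<in> schreier s \<xi>" "insert a F \<subseteq> G"
      then obtain Fs where Fs: "G = \<Union>(set Fs)" "set Fs \<subseteq> schreier s \<eta>"
        "sorted_wrt (\<lambda>F G. \<forall>k\<in>F. \<forall>l\<in>G. k < l) Fs" "\<forall>F\<in>set Fs. \<forall>k\<in>F. length Fs \<le> k"
        unfolding 2 schreier_suc by blast
      have "length Fs \<le> a" using G(2) Fs(1,4) by auto
      then show False using F(3)[OF _ Fs(2,3)] G(2) Fs(1) by auto
    qed (use F a in auto)
  next
    case 3
    have "\<exists>F. finite F \<and> F \<subseteq> A \<and> (\<forall>G\<in>schreier s (s \<xi> n). \<not> F \<subseteq> G)" if "n \<ge> 1" for n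
      using fs 3 that unfolding fundamental_sequences_def by (intro less.IH less.prems) auto
    then obtain F where F: "\<And>n. n \<ge> 1 \<Longrightarrow> finite (F n) \<and> F n \<subseteq> A \<and> (\<forall>G\<in>schreier s (s \<xi> n). \<not> F n \<subseteq> G)"
      by metis
    show ?thesis
    proof (intro exI[of _ "insert a (\<Union>n\<in>{1..a}. F n)"] conjI ballI notI)
      fix G assume G: "G \<in> schreier s \<xi>" "insert a (\<Union>n\<in>{1..a}. F n) \<subseteq> G"
      then obtain n where n: "n \<ge> 1" "G \<in> schreier s (s \<xi> n)" "\<forall>k\<in>G. n \<le> k"
        unfolding schreier_limit[OF 3] by blast
      then have "n \<le> a" using G(2) by auto
      then have "F n \<subseteq> G" using G(2) n(1) UN_upper[of n "{1..a}" F] by auto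
      then show False using F[OF n(1)] n(2) by blast
    next
      show "insert a (\<Union>n\<in>{1..a}. F n) \<subseteq> A" 
      proof -
        have "F n \<subseteq> A" if "n \<in> {1..a}" for n using F[of n] that by simp
        then show ?thesis using a by blast
      qed
    qed (use F in auto)
  qed
qed

section \<open>Finitely supported sequences\<close>

lemma c00_eqI: "(\<And>n. coord x n = coord y n) \<Longrightarrow> x = y"
  by (metis coord_inject ext)

lemma coord_simps [simp]:
  "coord 0 n = 0"
  "coord (x + y) n = coord x n + coord y n"
  "coord (x - y) n = coord x n - coord y n"
  "coord (- x) n = - coord x n"
  "coord (c *\<^sub>R x) n = c * coord x n"
  "coord (restrict E x) n = (if n \<in> E then coord x n else 0)"
  "coord (unit_vec m) n = (if n = m \<and> n \<ge> 1 then 1 else 0)"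
  by (transfer; simp)+

lemma coord_zero_index [simp]: "coord x 0 = 0"
  using coord[of x] by simp

lemma coord_sum: "coord (\<Sum>i\<in>A. f i) n = (\<Sum>i\<in>A. coord (f i) n)"
  by (induction A rule: infinite_finite_induct) auto

lemma finite_supp [simp]: "finite (supp x)"
  using coord[of x] by (simp add: supp_def)

lemma zero_notin_supp: "0 \<notin> supp x"
  by (simp add: supp_def)

lemma supp_simps [simp]:
  "supp 0 = {}" "supp (- x) = supp x" "supp (restrict E x) = supp x \<inter> E"
  "supp (c *\<^sub>R x) = (if c = 0 then {} else supp x)"
  by (auto simp: supp_def)

lemma supp_sum_subset: "supp (\<Sum>i\<in>A. f i) \<subseteq> (\<Union>i\<in>A. supp (f i))"
  by (force simp: supp_def coord_sum dest: sum.not_neutral_contains_not_neutral)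

lemma supp_empty_iff [simp]: "supp x = {} \<longleftrightarrow> x = 0"
  by (auto simp: supp_def intro: c00_eqI)

lemma restrict_add: "restrict E (x + y) = restrict E x + restrict E y"
  by (rule c00_eqI) simp

lemma restrict_scaleR: "restrict E (c *\<^sub>R x) = c *\<^sub>R restrict E x"
  by (rule c00_eqI) simp

lemma restrict_zero [simp]: "restrict E 0 = 0"
  by (rule c00_eqI) simp

lemma restrict_minus: "restrict E (- x) = - restrict E x"
  by (rule c00_eqI) simp

lemma restrict_sum: "restrict E (\<Sum>i\<in>A. f i) = (\<Sum>i\<in>A. restrict E (f i))"
  by (rule c00_eqI) (simp add: coord_sum)

lemma restrict_sum_list: "restrict E (sum_list fs) = sum_list (map (restrict E) fs)"
  by (induction fs) (auto simp: restrict_add)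

lemma restrict_restrict: "restrict E (restrict F x) = restrict (E \<inter> F) x"
  by (rule c00_eqI) simp

lemma restrict_UNIV [simp]: "restrict UNIV x = x"
  by (rule c00_eqI) simp

lemma restrict_superset: "supp x \<subseteq> E \<Longrightarrow> restrict E x = x"
  by (rule c00_eqI) (auto simp: supp_def)

lemma restrict_eq_zero_iff: "restrict E x = 0 \<longleftrightarrow> supp x \<inter> E = {}"
  by (metis supp_empty_iff supp_simps(3))

lemma act_eq_sum:
  assumes "finite A" "supp f \<inter> supp x \<subseteq> A"
  shows "act f x = (\<Sum>n\<in>A. coord f n * coord x n)"
proof -
  have "act f x = (\<Sum>n\<in>supp f \<union> A. coord f n * coord x n)"
    unfolding act_def by (rule sum.mono_neutral_left) (use assms finite_supp[of f] in \<open>auto simp: supp_def\<close>)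
  also have "\<dots> = (\<Sum>n\<in>A. coord f n * coord x n)"
    by (rule sum.mono_neutral_right) (use assms finite_supp[of f] in \<open>auto simp: supp_def\<close>)
  finally show ?thesis .
qed

lemma act_commute: "act f x = act x f"
  by (simp add: act_eq_sum[of "supp f \<inter> supp x"] mult.commute)

lemma act_add_right: "act f (x + y) = act f x + act f y"
  by (simp add: act_def sum.distrib algebra_simps)

lemma act_scaleR_right: "act f (c *\<^sub>R x) = c * act f x"
  by (simp add: act_def sum_distrib_left algebra_simps)

lemma act_minus_right: "act f (- x) = - act f x"
  by (simp add: act_def sum_negf)

lemma act_diff_right: "act f (x - y) = act f x - act f y"
  by (simp add: act_def sum_subtractf algebra_simps)

lemma act_zero [simp]: "act f 0 = 0" "act 0 x = 0"
  by (simp_all add: act_def)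

lemma act_sum_right: "act f (\<Sum>i\<in>A. x i) = (\<Sum>i\<in>A. act f (x i))"
  by (induction A rule: infinite_finite_induct) (auto simp: act_add_right)

lemma act_add_left: "act (f + g) x = act f x + act g x"
  by (metis act_add_right act_commute)

lemma act_scaleR_left: "act (c *\<^sub>R f) x = c * act f x"
  by (metis act_scaleR_right act_commute)

lemma act_minus_left: "act (- f) x = - act f x"
  by (metis act_minus_right act_commute)

lemma act_sum_left: "act (\<Sum>i\<in>A. f i) x = (\<Sum>i\<in>A. act (f i) x)"
  by (metis (no_types, lifting) act_sum_right act_commute sum.cong)

lemma act_sum_list_left: "act (sum_list fs) x = (\<Sum>f\<leftarrow>fs. act f x)"
  by (induction fs) (auto simp: act_add_left)

lemma act_restrict: "act (restrict E f) x = act f (restrict E x)"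
proof -
  have "act (restrict E f) x = (\<Sum>n\<in>supp f \<inter> supp x. coord (restrict E f) n * coord x n)"
    by (rule act_eq_sum) auto
  also have "\<dots> = (\<Sum>n\<in>supp f \<inter> supp x. coord f n * coord (restrict E x) n)"
    by (rule sum.cong) auto
  also have "\<dots> = act f (restrict E x)"
    by (rule act_eq_sum[symmetric]) auto
  finally show ?thesis .
qed

lemma act_disjoint: "supp f \<inter> supp x = {} \<Longrightarrow> act f x = 0"
  by (simp add: act_eq_sum[of "{}"])

lemma act_unit_vec: "act f (unit_vec n) = coord f n"
  by (cases "n = 0") (simp_all add: act_eq_sum[of "{n}"] supp_def subset_iff)

lemma abs_act_le:
  assumes "\<And>n. n \<in> supp x \<Longrightarrow> \<bar>coord f n\<bar> \<le> c"
  shows "\<bar>act f x\<bar> \<le> c * (\<Sum>n\<in>supp x. \<bar>coord x n\<bar>)"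
proof -
  have "\<bar>act f x\<bar> \<le> (\<Sum>n\<in>supp x. \<bar>coord f n * coord x n\<bar>)"
    by (simp add: act_eq_sum[of "supp x"])
  also have "\<dots> \<le> (\<Sum>n\<in>supp x. c * \<bar>coord x n\<bar>)"
    by (intro sum_mono) (use assms in \<open>auto simp: abs_mult intro: mult_right_mono\<close>)
  finally show ?thesis by (simp add: sum_distrib_left)
qed

section \<open>Intervals, operation results and induction over the norming set\<close>

lemma nat_interval_UNIV [simp]: "nat_interval UNIV"
  by (simp add: nat_interval_def)

lemma nat_interval_greaterThanAtMost [simp]: "nat_interval {a<..b}"
  by (auto simp: nat_interval_def)

lemma nat_interval_Int [simp]: "nat_interval E \<Longrightarrow> nat_interval F \<Longrightarrow> nat_interval (E \<inter> F)"
  unfolding nat_interval_def by blast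

lemma block_less_restrict: "block_less f g \<Longrightarrow> block_less (restrict E f) (restrict E g)"
  by (simp add: block_less_def)

text \<open>Restriction acts termwise and keeps the order of the blocks. Terms that become 0 may
  stay in the list, so its length does not change.\<close>

lemma op_results_restrict:
  assumes "f \<in> op_results K j" and K: "\<And>g. g \<in> K \<Longrightarrow> restrict E g \<in> K"
  shows "restrict E f \<in> op_results K j"
proof -
  obtain fs where fs: "f = (1 / real (mseq j)) *\<^sub>R sum_list fs" "fs \<noteq> []" "length fs \<le> nseq j"
      "sorted_wrt block_less fs" "set fs \<subseteq> K"
    using assms(1) unfolding op_results_def by blast
  have "sorted_wrt block_less (map (restrict E) fs)"
    unfolding sorted_wrt_map by (rule sorted_wrt_mono_rel[OF _ fs(4)]) (rule block_less_restrict)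
  then show ?thesis
    unfolding op_results_def mem_Collect_eq
    by (intro exI[of _ "map (restrict E) fs"])
      (use fs K in \<open>auto simp: restrict_scaleR restrict_sum_list\<close>)
qed

text \<open>Minimality is applied to the set of all \<open>f\<close> whose restrictions to intervals satisfy \<open>P\<close>; the
  results of the operations are one-term instances of the \<open>\<ell>\<^sub>2\<close>-rule.\<close>

lemma K_set_induct [consumes 1, case_names minus ground l2 convex]:
  assumes "f \<in> K_set G N1 \<Lambda> \<sigma>"
    and minus: "\<And>f. P f \<Longrightarrow> P (- f)"
    and ground: "\<And>g E. g \<in> G \<Longrightarrow> nat_interval E \<Longrightarrow> P (restrict E g)"
    and l2: "\<And>A c f js. finite A \<Longrightarrow> (\<Sum>i\<in>A. (c i)^2) \<le> 1 \<Longrightarrow> inj_on js A \<Longrightarrow>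
      (\<And>i. i \<in> A \<Longrightarrow> js i \<ge> 1 \<and> f i \<in> K_set G N1 \<Lambda> \<sigma> \<and>
         f i \<in> op_results {g \<in> K_set G N1 \<Lambda> \<sigma>. P g} (js i)) \<Longrightarrow> P (\<Sum>i\<in>(A::nat set). c i *\<^sub>R f i)"
    and convex: "\<And>A c f. finite A \<Longrightarrow> (\<And>i. i \<in> A \<Longrightarrow> P (f i) \<and> 0 \<le> c i) \<Longrightarrow> (\<Sum>i\<in>A. c i) = 1 \<Longrightarrow>
      P (\<Sum>i\<in>(A::nat set). c i *\<^sub>R f i)"
  shows "P f"
proof -
  define K where "K = K_set G N1 \<Lambda> \<sigma>"
  define K' where "K' = {f \<in> K. \<forall>E. nat_interval E \<longrightarrow> P (restrict E f)}"
  have clK: "K_closed G N1 \<Lambda> \<sigma> K" unfolding K_def by (rule K_closed_K_set)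
  have KE: "restrict E f \<in> K" if "f \<in> K" "nat_interval E" for f E
    using clK that by (simp add: K_closed_def)
  have K'E: "restrict E f \<in> K'" if "f \<in> K'" "nat_interval E" for f E
    using that by (auto simp: K'_def KE restrict_restrict)
  have K'K: "K' \<subseteq> K" by (auto simp: K'_def)
  have K'P: "K' \<subseteq> {g \<in> K. P g}"
  proof
    fix g assume "g \<in> K'"
    then have "g \<in> K" "P (restrict UNIV g)" unfolding K'_def using nat_interval_UNIV by blast+
    then show "g \<in> {g \<in> K. P g}" by simp
  qed
  have opK': "restrict E f \<in> op_results {g \<in> K. P g} j"
    if "f \<in> op_results K' j" "nat_interval E" for f j E
    using op_results_restrict[OF that(1)] K'E that(2) op_results_mono[OF K'P] by blast
  have op1: "f \<in> K'" if f: "f \<in> K" "f \<in> op_results K' j" "1 \<le> j" for f j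
  proof -
    have "P (\<Sum>i\<in>{0::nat}. 1 *\<^sub>R restrict E f)" if "nat_interval E" for E
      by (rule l2[of _ _ "\<lambda>_. j"]) (use f that opK' KE in \<open>auto simp: K_def[symmetric]\<close>)
    then show ?thesis using f by (simp add: K'_def)
  qed
  have "K_closed G N1 \<Lambda> \<sigma> K'"
    unfolding K_closed_def
  proof (intro conjI ballI allI impI)
    fix f assume "f \<in> K'"
    then show "- f \<in> K'" using clK minus by (auto simp: K'_def restrict_minus K_closed_def)
  next
    fix f E assume "f \<in> K'" "nat_interval E"
    then show "restrict E f \<in> K'" by (rule K'E)
  next
    show "G \<subseteq> K'" using clK ground by (auto simp: K'_def K_closed_def)
  next
    fix j :: nat assume j: "1 \<le> j"
    have "op_results K (2 * j) \<subseteq> K" using clK j by (simp add: K_closed_def)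
    then show "op_results K' (2 * j) \<subseteq> K'"
      using op_results_mono[OF K'K, of "2 * j"] op1[of _ "2 * j"] j by auto
  next
    fix j :: nat and fs assume j: "1 \<le> j" and fs: "attractor_seq N1 \<Lambda> \<sigma> K' j fs"
    have "(1 / real (mseq (2 * j - 1))) *\<^sub>R sum_list fs \<in> K"
      using clK j attractor_seq_mono[OF K'K fs] by (simp add: K_closed_def)
    \<comment> \<open>An attractor sequence is a block sequence of admissible length, so its
      weighted sum is an operation result of odd weight index.\<close>
    moreover have "(1 / real (mseq (2 * j - 1))) *\<^sub>R sum_list fs \<in> op_results K' (2 * j - 1)"
      using fs by (auto simp: attractor_seq_def op_results_def Q_seqs_def)
    ultimately show "(1 / real (mseq (2 * j - 1))) *\<^sub>R sum_list fs \<in> K'"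
      using j by (intro op1[of _ "2 * j - 1"]) auto
  next
    fix A :: "nat set" and c :: "nat \<Rightarrow> real" and f js
    assume *: "finite A \<and> (\<forall>i\<in>A. 1 \<le> js i \<and> f i \<in> K' \<and> f i \<in> op_results K' (js i) \<and> c i \<in> \<rat>) \<and>
      (\<forall>i\<in>A. \<forall>k\<in>A. i \<noteq> k \<longrightarrow> nseq (js i) \<noteq> nseq (js k)) \<and> (\<Sum>i\<in>A. (c i)^2) \<le> 1"
    have "\<forall>i\<in>A. 1 \<le> js i \<and> f i \<in> K \<and> f i \<in> op_results K (js i) \<and> c i \<in> \<rat>"
      using * K'K op_results_mono[OF K'K] by blast
    moreover have "\<forall>(A :: nat set) c f js. finite A \<and>
        (\<forall>i\<in>A. js i \<ge> 1 \<and> f i \<in> K \<and> f i \<in> op_results K (js i) \<and> c i \<in> \<rat>) \<and>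
        (\<forall>i\<in>A. \<forall>k\<in>A. i \<noteq> k \<longrightarrow> nseq (js i) \<noteq> nseq (js k)) \<and> (\<Sum>i\<in>A. (c i)^2) \<le> 1 \<longrightarrow>
        (\<Sum>i\<in>A. c i *\<^sub>R f i) \<in> K"
      using clK unfolding K_closed_def by (elim conjE)
    ultimately have "(\<Sum>i\<in>A. c i *\<^sub>R f i) \<in> K" using * by blast
    moreover have "P (restrict E (\<Sum>i\<in>A. c i *\<^sub>R f i))" if E: "nat_interval E" for E
      unfolding restrict_sum restrict_scaleR
    proof (rule l2)
      show "inj_on js A" using * by (auto simp: inj_on_def) metis
      show "1 \<le> js i \<and> restrict E (f i) \<in> K_set G N1 \<Lambda> \<sigma> \<and>
          restrict E (f i) \<in> op_results {g \<in> K_set G N1 \<Lambda> \<sigma>. P g} (js i)" if "i \<in> A" for i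
        using * that opK' E K'E K'K by (auto simp: K_def[symmetric])
    qed (use * in auto)
    ultimately show "(\<Sum>i\<in>A. c i *\<^sub>R f i) \<in> K'" by (simp add: K'_def)
  next
    fix A :: "nat set" and c :: "nat \<Rightarrow> real" and f
    assume *: "finite A \<and> (\<forall>i\<in>A. f i \<in> K' \<and> c i \<in> \<rat> \<and> 0 \<le> c i) \<and> (\<Sum>i\<in>A. c i) = 1"
    have "\<forall>i\<in>A. f i \<in> K \<and> c i \<in> \<rat> \<and> 0 \<le> c i" using * K'K by blast
    moreover have "\<forall>(A :: nat set) c f. finite A \<and>
        (\<forall>i\<in>A. f i \<in> K \<and> c i \<in> \<rat> \<and> c i \<ge> 0) \<and> (\<Sum>i\<in>A. c i) = 1 \<longrightarrow>
        (\<Sum>i\<in>A. c i *\<^sub>R f i) \<in> K"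
      using clK unfolding K_closed_def by (elim conjE)
    ultimately have "(\<Sum>i\<in>A. c i *\<^sub>R f i) \<in> K" using * by blast
    moreover have "P (restrict E (\<Sum>i\<in>A. c i *\<^sub>R f i))" if E: "nat_interval E" for E
      unfolding restrict_sum restrict_scaleR
      by (rule convex) (use * E in \<open>auto simp: K'_def\<close>)
    ultimately show "(\<Sum>i\<in>A. c i *\<^sub>R f i) \<in> K'" by (simp add: K'_def)
  qed
  then have "K \<subseteq> K'" unfolding K_def by (rule K_set_lower)
  then show ?thesis using assms(1) K'P K_def by blast
qed

section \<open>Weights and the ground set\<close>

lemma mseq_ge: "1 \<le> j \<Longrightarrow> 16 * 2 ^ j \<le> mseq j"
proof -
  assume "1 \<le> j"
  then obtain i where j: "j = Suc i" by (cases j) auto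
  have "Suc i + 4 \<le> 5 ^ Suc i" by (induction i) auto
  then have "(2::nat) ^ (Suc i + 4) \<le> 2 ^ (5 ^ Suc i)" by (rule power_increasing) simp
  then show ?thesis unfolding j mseq_Suc by (simp add: power_add)
qed

lemma mseq_strict_mono: "1 \<le> j \<Longrightarrow> j < k \<Longrightarrow> mseq j < mseq k"
  by (cases j; cases k) (auto simp del: mseq.simps simp: mseq_Suc power_strict_increasing)

lemma mseq_pos: "1 \<le> j \<Longrightarrow> 0 < mseq j"
  by (rule less_le_trans[OF _ mseq_ge]) simp_all

lemma mseq_mono: "1 \<le> j \<Longrightarrow> j \<le> k \<Longrightarrow> mseq j \<le> mseq k"
  using mseq_strict_mono[of j k] by (cases "j = k") auto

text \<open>Since \<open>mseq j\<close> is at least 16 times a power of 2, the squares are dominated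
  by a geometric series. The value 1/256 later absorbs the factor 4 from
  \<open>(2 * real N)^2\<close>.\<close>

lemma sum_inverse_mseq_squares:
  assumes "finite S" "S \<subseteq> {1..}"
  shows "(\<Sum>j\<in>S. (1 / real (mseq j))^2) \<le> 1 / 256"
proof -
  have geo: "(\<Sum>j\<in>{1..n}. (1/4::real) ^ j) \<le> 1 - (1/4) ^ n" for n
  proof (induction n)
    case (Suc n)
    have "(0::real) \<le> (1/4) ^ n" by simp
    moreover have "(\<Sum>j\<in>{1..Suc n}. (1/4::real) ^ j) = (\<Sum>j\<in>{1..n}. (1/4::real) ^ j) + (1/4) ^ n / 4"
      by simp
    moreover have "(1/4::real) ^ Suc n = (1/4) ^ n / 4" by simp
    ultimately show ?case using Suc by linarith
  qed simp
  have le: "(1 / real (mseq j))^2 \<le> 1 / 256 * (1/4) ^ j" if "1 \<le> j" for j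
  proof -
    have "real (16 * 2 ^ j) \<le> real (mseq j)" using mseq_ge[OF that] of_nat_le_iff by blast
    then have "(1 / real (mseq j))^2 \<le> (1 / (16 * 2 ^ j))^2"
      by (intro power_mono divide_left_mono) (use mseq_pos[OF that] in auto)
    also have "\<dots> = 1 / 256 * (1/4) ^ j"
    proof -
      have "((2::real) ^ j)^2 = (2^2) ^ j" by (simp only: power_mult[symmetric] mult.commute)
      then show ?thesis by (simp add: power_divide power_mult_distrib)
    qed
    finally show ?thesis .
  qed
  obtain n where n: "S \<subseteq> {1..n}"
    using assms by (metis atLeastAtMost_iff atLeast_iff finite_nat_iff_bounded_le atMost_iff subset_iff)
  have "(\<Sum>j\<in>S. (1 / real (mseq j))^2) \<le> (\<Sum>j\<in>{1..n}. (1 / real (mseq j))^2)"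
    using n by (intro sum_mono2) auto
  also have "\<dots> \<le> (\<Sum>j\<in>{1..n}. 1 / 256 * (1/4) ^ j)"
    by (rule sum_mono) (rule le, simp)
  also have "\<dots> \<le> 1 / 256 * (1 - (1/4) ^ n)"
    unfolding sum_distrib_left[symmetric] using geo by (rule mult_left_mono) simp
  finally show ?thesis by (rule order_trans) simp
qed

text \<open>An intrinsic description: the level is visible in the modulus of any nonzero coordinate.
  Uniqueness of the level and stability under restriction follow from it.\<close>

lemma G1_level_iff:
  assumes "1 \<le> j"
  shows "f \<in> G1_level j \<longleftrightarrow> f \<noteq> 0 \<and> card (supp f) \<le> nseq (2 * j - 1) \<and>
    (\<forall>n\<in>supp f. \<bar>coord f n\<bar> = 1 / (real (mseq (2 * j - 1)))^2)"
proof -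
  define m where "m = (real (mseq (2 * j - 1)))^2"
  have m: "m > 0" using mseq_pos[of "2 * j - 1"] assms by (simp add: m_def)
  show ?thesis
  proof
    assume "f \<in> G1_level j"
    then obtain B \<epsilon> where f: "f = (1 / m) *\<^sub>R (\<Sum>i\<in>B. \<epsilon> i *\<^sub>R unit_vec i)"
      and B: "B \<subseteq> {1..}" "finite B" "1 \<le> card B" "card B \<le> nseq (2 * j - 1)" "\<forall>i\<in>B. \<epsilon> i \<in> {-1, 1}"
      unfolding G1_level_def m_def by blast
    have c: "coord f n = (if n \<in> B then \<epsilon> n / m else 0)" for n
    proof -
      have "coord f n = (1 / m) * (\<Sum>i\<in>B. if i = n then \<epsilon> i else 0)"
        unfolding f coord_simps coord_sum using B(1) by (intro arg_cong2[where f="(*)"] sum.cong) auto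
      then show ?thesis using B(2) by simp
    qed
    have "supp f = B" using B(5) m by (force simp: supp_def c)
    moreover have "\<bar>coord f n\<bar> = 1 / m" if "n \<in> B" for n
    proof -
      have "\<bar>\<epsilon> n\<bar> = 1" using B(5) that by auto
      then show ?thesis using that m by (simp add: c)
    qed
    moreover have "f \<noteq> 0" using \<open>supp f = B\<close> B(3) by auto
    ultimately show "f \<noteq> 0 \<and> card (supp f) \<le> nseq (2 * j - 1) \<and> (\<forall>n\<in>supp f. \<bar>coord f n\<bar> = 1 / (real (mseq (2 * j - 1)))^2)"
      using B(4) by (simp add: m_def)
  next
    assume f: "f \<noteq> 0 \<and> card (supp f) \<le> nseq (2 * j - 1) \<and>
      (\<forall>n\<in>supp f. \<bar>coord f n\<bar> = 1 / (real (mseq (2 * j - 1)))^2)"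
    define \<epsilon> where "\<epsilon> n = coord f n * m" for n
    have "f = (1 / m) *\<^sub>R (\<Sum>i\<in>supp f. \<epsilon> i *\<^sub>R unit_vec i)"
    proof (rule c00_eqI)
      fix n
      have "coord ((1 / m) *\<^sub>R (\<Sum>i\<in>supp f. \<epsilon> i *\<^sub>R unit_vec i)) n =
          (1 / m) * (\<Sum>i\<in>supp f. if i = n then \<epsilon> i else 0)"
        unfolding coord_simps coord_sum
        by (intro arg_cong2[where f="(*)"] sum.cong) (auto simp: supp_def \<epsilon>_def Suc_le_eq)
      also have "\<dots> = (if n \<in> supp f then \<epsilon> n / m else 0)" by simp
      also have "\<dots> = coord f n" using m by (simp add: \<epsilon>_def supp_def)
      finally show "coord f n = coord ((1 / m) *\<^sub>R (\<Sum>i\<in>supp f. \<epsilon> i *\<^sub>R unit_vec i)) n" ..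
    qed
    moreover have "supp f \<subseteq> {1..}" using zero_notin_supp by (metis atLeast_iff less_one linorder_not_le subsetI)
    moreover have "1 \<le> card (supp f)" using f by (simp add: Suc_le_eq card_gt_0_iff)
    moreover have "\<forall>i\<in>supp f. \<epsilon> i \<in> {-1, 1}"
    proof
      fix i assume "i \<in> supp f"
      then have "\<bar>coord f i\<bar> = 1 / m" using f unfolding m_def by blast
      then have "\<bar>\<epsilon> i\<bar> = 1" using m by (simp add: \<epsilon>_def abs_mult)
      then show "\<epsilon> i \<in> {-1, 1}" by auto
    qed
    ultimately show "f \<in> G1_level j"
      unfolding G1_level_def m_def[symmetric] using f finite_supp by blast
  qed
qed

lemma G1_level_unique:
  assumes "1 \<le> i" "1 \<le> j" "f \<in> G1_level i" "f \<in> G1_level j"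
  shows "i = j"
proof -
  obtain n where "n \<in> supp f" using assms by (auto simp: G1_level_iff simp flip: supp_empty_iff)
  then have "1 / (real (mseq (2 * i - 1)))^2 = 1 / (real (mseq (2 * j - 1)))^2"
    using assms by (auto simp: G1_level_iff)
  then have "mseq (2 * i - 1) = mseq (2 * j - 1)" by simp
  moreover have "mseq (2 * a - 1) < mseq (2 * b - 1)" if "1 \<le> a" "a < b" for a b
    using that by (intro mseq_strict_mono) linarith+
  ultimately show ?thesis using assms(1,2) by (metis less_irrefl linorder_neqE_nat)
qed

lemma ind_eq: "1 \<le> j \<Longrightarrow> f \<in> G1_level j \<Longrightarrow> ind f = j"
  unfolding ind_def by (rule the_equality) (auto intro: G1_level_unique)

lemma G1_level_restrict:
  assumes "1 \<le> j" "f \<in> G1_level j" "restrict E f \<noteq> 0"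
  shows "restrict E f \<in> G1_level j"
  using assms card_mono[of "supp f" "supp f \<inter> E"] by (fastforce simp: G1_level_iff)

text \<open>Each element is determined by \<open>b + 1\<close> coordinates, and each of them takes
  one of three values.\<close>

lemma finite_G1_level_bounded:
  assumes "1 \<le> j"
  shows "finite {f \<in> G1_level j. supp f \<subseteq> {..b}}" (is "finite ?A")
proof -
  define c where "c = 1 / (real (mseq (2 * j - 1)))^2"
  have "(\<lambda>f. map (coord f) [0..<Suc b]) ` ?A \<subseteq> {xs. set xs \<subseteq> {0, c, - c} \<and> length xs = Suc b}"
  proof -
    have "coord f n \<in> {0, c, - c}" if "f \<in> G1_level j" for f n
    proof (cases "n \<in> supp f")
      case True
      then have "\<bar>coord f n\<bar> = c" using that assms G1_level_iff unfolding c_def by blast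
      then show ?thesis by auto
    qed (simp add: supp_def)
    then have "set (map (coord f) [0..<Suc b]) \<subseteq> {0, c, - c}" if "f \<in> ?A" for f
      using that unfolding set_map by blast
    then show ?thesis by (intro image_subsetI) (simp del: upt_Suc set_map)
  qed
  then have "finite ((\<lambda>f. map (coord f) [0..<Suc b]) ` ?A)"
    by (rule finite_subset) (simp add: finite_lists_length_eq)
  moreover have "inj_on (\<lambda>f. map (coord f) [0..<Suc b]) ?A"
  proof (rule inj_onI)
    fix f g assume fg: "f \<in> ?A" "g \<in> ?A" "map (coord f) [0..<Suc b] = map (coord g) [0..<Suc b]"
    show "f = g"
    proof (rule c00_eqI)
      fix n
      show "coord f n = coord g n"
      proof (cases "n \<le> b")
        case True
        then have "n \<in> set [0..<Suc b]" by auto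
        then show ?thesis using fg(3) unfolding map_eq_conv by blast
      next
        case False
        then have "n \<notin> supp f" "n \<notin> supp g" using fg by auto
        then show ?thesis by (simp add: supp_def)
      qed
    qed
  qed
  ultimately show ?thesis by (rule finite_imageD)
qed

section \<open>Block sequences with increasing levels\<close>

lemma U_seqs_nth:
  assumes "fs \<in> U_seqs" "i < length fs"
  shows "1 \<le> ind (fs ! i)" "fs ! i \<in> G1_level (ind (fs ! i))"
proof -
  from assms(1) obtain js where "\<forall>i<length fs. js ! i \<ge> 1 \<and> fs ! i \<in> G1_level (js ! i)"
    unfolding U_seqs_def by blast
  then show "1 \<le> ind (fs ! i)" "fs ! i \<in> G1_level (ind (fs ! i))"
    using assms(2) ind_eq by auto
qed

lemma U_seqs_ind_less:
  assumes "fs \<in> U_seqs" "i < k" "k < length fs"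
  shows "ind (fs ! i) < ind (fs ! k)"
proof -
  from assms(1) obtain js where js: "length js = length fs" "sorted_wrt (<) js"
      "\<forall>i<length fs. js ! i \<ge> 1 \<and> fs ! i \<in> G1_level (js ! i)"
    unfolding U_seqs_def by blast
  then have "ind (fs ! i) = js ! i" "ind (fs ! k) = js ! k" using assms ind_eq by auto
  then show ?thesis using js(1,2) assms by (simp add: sorted_wrt_nth_less)
qed

lemma U_seqs_block_less:
  "fs \<in> U_seqs \<Longrightarrow> i < k \<Longrightarrow> k < length fs \<Longrightarrow> block_less (fs ! i) (fs ! k)"
  by (simp add: U_seqs_def sorted_wrt_nth_less)

lemma U_seqs_take: "fs \<in> U_seqs \<Longrightarrow> 0 < n \<Longrightarrow> take n fs \<in> U_seqs"
proof -
  assume fs: "fs \<in> U_seqs" and n: "0 < n"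
  from fs obtain js where js: "length js = length fs" "sorted_wrt (<) js"
      "\<forall>i<length fs. js ! i \<ge> 1 \<and> fs ! i \<in> G1_level (js ! i)"
    unfolding U_seqs_def by blast
  then show ?thesis
    using fs n unfolding U_seqs_def
    by (auto simp: sorted_wrt_take intro!: exI[of _ "take n js"])
qed

text \<open>The terms are nonzero and successive, and supports avoid 0, so every term moves at least
  one step to the right. This bounds the length of a sequence by its support.\<close>

lemma U_seqs_index_less_supp:
  assumes "fs \<in> U_seqs" "i < length fs" "n \<in> supp (fs ! i)"
  shows "i < n"
  using assms(2,3)
proof (induction i arbitrary: n)
  case 0
  then show ?case using zero_notin_supp by (cases n) auto
next
  case (Suc i)
  have "fs ! i \<noteq> 0" using U_seqs_nth[OF assms(1), of i] Suc.prems by (auto simp: G1_level_iff)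
  then obtain k where k: "k \<in> supp (fs ! i)" by (auto simp flip: supp_empty_iff)
  then have "i < k" using Suc by simp
  moreover have "k < n"
    using U_seqs_block_less[OF assms(1), of i "Suc i"] Suc.prems k by (auto simp: block_less_def)
  ultimately show ?case by simp
qed

section \<open>Special functionals, index sets and square sums\<close>

definition sp_fun :: "nat set \<Rightarrow> (nat \<Rightarrow> real) \<Rightarrow> c00 list \<Rightarrow> c00" where
  "sp_fun E e fs = restrict E (\<Sum>i<length fs. e i *\<^sub>R fs ! i)"

definition sp_ind :: "nat set \<Rightarrow> c00 list \<Rightarrow> nat set" where
  "sp_ind E fs = {ind (fs ! i) | i. i < length fs \<and> restrict E (fs ! i) \<noteq> 0}"

text \<open>The terms have disjoint supports, so a nonzero coordinate comes from exactly one of them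
  and reveals its level.\<close>

lemma sp_fun_coord:
  assumes fs: "fs \<in> U_seqs" and sg: "\<forall>i<length fs. e i \<in> {-1, 1}" and nz: "coord (sp_fun E e fs) n \<noteq> 0"
  obtains j where "j \<in> sp_ind E fs" "1 \<le> j" "\<bar>coord (sp_fun E e fs) n\<bar> = 1 / (real (mseq (2 * j - 1)))^2"
proof -
  have nE: "n \<in> E" using nz by (simp add: sp_fun_def split: if_splits)
  have c: "coord (sp_fun E e fs) n = (\<Sum>i<length fs. e i * coord (fs ! i) n)"
    using nE by (simp add: sp_fun_def coord_sum)
  then obtain i where i: "i < length fs" "coord (fs ! i) n \<noteq> 0"
    using nz by (metis (no_types, lifting) lessThan_iff mult_zero_right sum.neutral)
  have "coord (fs ! k) n = 0" if "k < length fs" "k \<noteq> i" for k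
    using U_seqs_block_less[OF fs, of i k] U_seqs_block_less[OF fs, of k i] that i
    by (cases k i rule: linorder_cases) (auto simp: block_less_def supp_def)
  then have "coord (sp_fun E e fs) n = e i * coord (fs ! i) n"
    unfolding c using i by (subst sum.remove[of _ i]) auto
  moreover have "\<bar>e i\<bar> = 1" using sg i(1) by auto
  moreover have "\<bar>coord (fs ! i) n\<bar> = 1 / (real (mseq (2 * ind (fs ! i) - 1)))^2"
    using U_seqs_nth[OF fs i(1)] i(2) by (auto simp: G1_level_iff supp_def)
  moreover have "ind (fs ! i) \<in> sp_ind E fs"
    using i nE unfolding sp_ind_def mem_Collect_eq restrict_eq_zero_iff by (auto simp: supp_def)
  ultimately show ?thesis using that U_seqs_nth[OF fs i(1)] by (simp add: abs_mult)
qed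

lemma sp_ind_mono: "E \<subseteq> E' \<Longrightarrow> sp_ind E fs \<subseteq> sp_ind E' fs"
  unfolding sp_ind_def restrict_eq_zero_iff by blast

lemma finite_sp_ind: "finite (sp_ind E fs)"
  unfolding sp_ind_def by simp

lemma restrict_sp_fun: "restrict D (sp_fun E e fs) = sp_fun (D \<inter> E) e fs"
  by (simp add: sp_fun_def restrict_restrict)

lemma act_sp_fun: "act (sp_fun E e fs) x = (\<Sum>i<length fs. e i * act (restrict E (fs ! i)) x)"
  by (simp add: sp_fun_def restrict_sum restrict_scaleR act_sum_left act_scaleR_left)

lemma act_sp_fun_window:
  assumes "supp x \<subseteq> W"
  shows "act (sp_fun E e fs) x = act (sp_fun (E \<inter> W) e fs) x"
  by (metis act_restrict assms inf_commute restrict_sp_fun restrict_superset)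

lemma has_ind_iff:
  "has_ind S M1 \<sigma>1 \<phi> J \<longleftrightarrow> (\<exists>j\<ge>1. \<phi> \<in> G1_level j \<and> J = {j}) \<or>
     (\<exists>E e fs. special_seq S M1 \<sigma>1 fs \<and> (\<forall>i<length fs. e i \<in> {-1, 1}) \<and> nat_interval E \<and>
        \<phi> = sp_fun E e fs \<and> J = sp_ind E fs)"
  unfolding has_ind_def sp_fun_def sp_ind_def ..

lemma has_ind_coord:
  assumes "has_ind S M1 \<sigma>1 \<phi> J" "coord \<phi> n \<noteq> 0"
  obtains j where "j \<in> J" "1 \<le> j" "\<bar>coord \<phi> n\<bar> = 1 / (real (mseq (2 * j - 1)))^2"
proof -
  consider j where "1 \<le> j" "\<phi> \<in> G1_level j" "J = {j}"
    | E e fs where "special_seq S M1 \<sigma>1 fs" "\<forall>i<length fs. e i \<in> {-1, 1}" "\<phi> = sp_fun E e fs" "J = sp_ind E fs"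
    using assms(1) unfolding has_ind_iff by blast
  then show ?thesis
  proof cases
    case 1
    then show ?thesis using that assms(2) by (auto simp: G1_level_iff supp_def)
  next
    case 2
    then show ?thesis using sp_fun_coord[of fs e E n] that assms(2) by (auto simp: special_seq_def)
  qed
qed

text \<open>Different levels have different odd weights, and the inverse squares of all weights have
  sum at most 1.\<close>

lemma G1_squares_le_of_inj:
  fixes x :: "'i \<Rightarrow> real"
  assumes "finite I" "inj_on j I" "\<And>i. i \<in> I \<Longrightarrow> 1 \<le> j i"
    and "\<And>i. i \<in> I \<Longrightarrow> \<bar>x i\<bar> \<le> c * (1 / real (mseq (2 * j i - 1)))" and "0 \<le> c"
  shows "(\<Sum>i\<in>I. (x i)^2) \<le> c^2"
proof -
  have "(\<Sum>i\<in>I. (x i)^2) \<le> (\<Sum>i\<in>I. c^2 * (1 / real (mseq (2 * j i - 1)))^2)"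
  proof (rule sum_mono)
    fix i assume "i \<in> I"
    from power_mono[OF assms(4)[OF this], of 2]
    show "(x i)^2 \<le> c^2 * (1 / real (mseq (2 * j i - 1)))^2" by (simp add: power_mult_distrib[symmetric])
  qed
  also have "\<dots> = c^2 * (\<Sum>k\<in>(\<lambda>i. 2 * j i - 1) ` I. (1 / real (mseq k))^2)"
  proof -
    have "inj_on (\<lambda>i. 2 * j i - 1) I"
    proof (rule inj_onI)
      fix i k assume "i \<in> I" "k \<in> I" "2 * j i - 1 = 2 * j k - 1"
      then show "i = k" using assms(3)[of i] assms(3)[of k] inj_onD[OF assms(2), of i k] by linarith
    qed
    then show ?thesis by (simp add: sum.reindex sum_distrib_left)
  qed
  also have "\<dots> \<le> c^2 * (1 / 256)"
  proof (rule mult_left_mono)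
    show "(\<Sum>k\<in>(\<lambda>i. 2 * j i - 1) ` I. (1 / real (mseq k))^2) \<le> 1 / 256"
    proof (rule sum_inverse_mseq_squares)
      show "(\<lambda>i. 2 * j i - 1) ` I \<subseteq> {1..}" using assms(3) by fastforce
    qed (use assms(1) in simp)
  qed simp
  also have "\<dots> \<le> c^2" by simp
  finally show ?thesis .
qed

lemma inverse_square_le_inverse: "1 \<le> j \<Longrightarrow> 1 / (real (mseq j))^2 \<le> 1 / real (mseq j)"
proof -
  assume "1 \<le> j"
  then have "1 \<le> real (mseq j)" using mseq_pos[of j] by linarith
  then show ?thesis by (simp add: field_simps power2_eq_square)
qed

text \<open>Every functional that is nonzero at \<open>n\<close> contributes a level from its own
  index set. Disjointness of the index sets makes these levels distinct.\<close>

lemma has_ind_coord_squares: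
  assumes I: "finite I" "\<And>i. i \<in> I \<Longrightarrow> has_ind S M1 \<sigma>1 (\<phi> i) (J i)" "disjoint_family_on J I"
  shows "(\<Sum>i\<in>I. (coord (\<phi> i) n)^2) \<le> 1"
proof -
  define I0 where "I0 = {i \<in> I. coord (\<phi> i) n \<noteq> 0}"
  have "\<exists>j. j \<in> J i \<and> 1 \<le> j \<and> \<bar>coord (\<phi> i) n\<bar> = 1 / (real (mseq (2 * j - 1)))^2" if "i \<in> I0" for i
    using has_ind_coord[OF I(2), of i n] that by (auto simp: I0_def)
  then obtain j where j: "\<And>i. i \<in> I0 \<Longrightarrow> j i \<in> J i \<and> 1 \<le> j i \<and>
      \<bar>coord (\<phi> i) n\<bar> = 1 / (real (mseq (2 * j i - 1)))^2"
    by metis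
  have "(\<Sum>i\<in>I. (coord (\<phi> i) n)^2) = (\<Sum>i\<in>I0. (coord (\<phi> i) n)^2)"
    by (rule sum.mono_neutral_right) (use I(1) in \<open>auto simp: I0_def\<close>)
  also have "\<dots> \<le> 1^2"
  proof (rule G1_squares_le_of_inj[where j = j])
    show "inj_on j I0"
      using I(3) j by (intro inj_onI) (fastforce simp: disjoint_family_on_def I0_def)
    show "\<bar>coord (\<phi> i) n\<bar> \<le> 1 * (1 / real (mseq (2 * j i - 1)))" if "i \<in> I0" for i
      using j[OF that] inverse_square_le_inverse[of "2 * j i - 1"] by auto
  qed (use I(1) j in \<open>auto simp: I0_def\<close>)
  finally show ?thesis by simp
qed

text \<open>Disjoint index sets are exactly what \<open>Gl2_set\<close> demands of its summands, so
  all rational l2-combinations of the \<open>\<phi> i\<close> are at most \<open>B\<close> on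
  \<open>y\<close>, and duality applies.\<close>

lemma Gl2_squares_le:
  assumes y: "\<And>g. g \<in> Gl2_set S M1 \<sigma>1 \<Longrightarrow> \<bar>act g y\<bar> \<le> B" and B: "0 \<le> B"
    and I: "finite I" "\<And>i. i \<in> I \<Longrightarrow> has_ind S M1 \<sigma>1 (\<phi> i) (J i)" "disjoint_family_on J I"
  shows "(\<Sum>i\<in>I. (act (\<phi> i) y)^2) \<le> B^2"
proof (cases "I = {}")
  case False
  \<comment> \<open>Sums in \<open>Gl2_set\<close> run over an initial segment of the integers,
    hence the renumbering.\<close>
  obtain h where h: "bij_betw h {..<card I} I"
    using I(1) by (metis bij_betw_from_nat_into_finite)
  show ?thesis
  proof (rule sum_squares_le_of_rational_dual[OF I(1) B])
    fix c :: "'a \<Rightarrow> real" assume c: "\<And>i. c i \<in> \<rat>" "(\<Sum>i\<in>I. (c i)^2) \<le> 1"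
    have re: "(\<Sum>i<card I. g (h i)) = (\<Sum>i\<in>I. g i)" for g :: "'a \<Rightarrow> 'b::comm_monoid_add"
      using h by (rule sum.reindex_bij_betw)
    have hI: "h i \<in> I" if "i < card I" for i using h that by (auto simp: bij_betw_def)
    have inG: "has_ind S M1 \<sigma>1 \<psi> D \<Longrightarrow> \<psi> \<in> Gsp_set S M1 \<sigma>1 \<union> G1_set" for \<psi> D
      unfolding has_ind_def Gsp_set_def G1_set_def by auto
    have inG': "\<phi> (h i) \<in> Gsp_set S M1 \<sigma>1 \<union> G1_set" if "i < card I" for i
      using inG[OF I(2)[OF hI[OF that]]] .
    have "disjoint_family_on (\<lambda>i. J (h i)) {..<card I}"
      using I(3) hI h unfolding disjoint_family_on_def bij_betw_def inj_on_def by (metis lessThan_iff)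
    then have "(\<Sum>i<card I. c (h i) *\<^sub>R \<phi> (h i)) \<in> Gl2_set S M1 \<sigma>1"
      unfolding Gl2_set_def mem_Collect_eq
      using False I(1) c hI I(2) inG' re[of "\<lambda>i. (c i)^2"]
      by (intro exI[of _ "card I"] exI[of _ "\<lambda>i. c (h i)"] exI[of _ "\<lambda>i. \<phi> (h i)"])
        (auto simp: Suc_le_eq card_gt_0_iff intro!: exI[of _ "\<lambda>i. J (h i)"])
    then have "\<bar>act (\<Sum>i\<in>I. c i *\<^sub>R \<phi> i) y\<bar> \<le> B"
      using y unfolding re[of "\<lambda>i. c i *\<^sub>R \<phi> i"] by blast
    then show "(\<Sum>i\<in>I. c i * act (\<phi> i) y) \<le> B"
      by (simp add: act_sum_left act_scaleR_left)
  qed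
qed simp

lemma G_set_coord_le:
  assumes "g \<in> G_set S M1 \<sigma>1"
  shows "\<bar>coord g n\<bar> \<le> 1"
proof -
  have one: "\<bar>coord g n\<bar> \<le> 1" if "has_ind S M1 \<sigma>1 g J" for g J
    using has_ind_coord_squares[of "{()}" S M1 \<sigma>1 "\<lambda>_. g" "\<lambda>_. J" n] that
    by (simp add: abs_square_le_1 disjoint_family_on_def)
  consider "g \<in> G0_set" | "g \<in> G1_set" | "g \<in> Gsp_set S M1 \<sigma>1" | "g \<in> Gl2_set S M1 \<sigma>1"
    using assms by (auto simp: G_set_def)
  then show ?thesis
  proof cases
    case 1
    then show ?thesis by (auto simp: G0_set_def)
  next
    case 2
    then show ?thesis using one[of g] by (auto simp: G1_set_def has_ind_def)
  next
    case 3
    then have "\<exists>J. has_ind S M1 \<sigma>1 g J" unfolding has_ind_def Gsp_set_def by blast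
    then show ?thesis using one by blast
  next
    case 4
    then obtain d :: nat and a \<phi> J where g: "g = (\<Sum>i<d. a i *\<^sub>R \<phi> i)" "(\<Sum>i<d. (a i)^2) \<le> 1"
      "\<forall>i<d. has_ind S M1 \<sigma>1 (\<phi> i) (J i)" "disjoint_family_on J {..<d}"
      unfolding Gl2_set_def by blast
    have "(coord g n)^2 = (\<Sum>i<d. a i * coord (\<phi> i) n)^2"
      by (simp add: g(1) coord_sum)
    also have "\<dots> \<le> (\<Sum>i<d. (a i)^2) * (\<Sum>i<d. (coord (\<phi> i) n)^2)"
      by (rule Cauchy_Schwarz_ineq_sum)
    also have "\<dots> \<le> 1 * 1"
      using g has_ind_coord_squares[of "{..<d}" S M1 \<sigma>1 \<phi> J n]
      by (intro mult_mono) (auto intro: sum_nonneg)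
    finally show ?thesis by (simp add: abs_square_le_1)
  qed
qed

section \<open>Coordinate bounds for the norming set\<close>

lemma coord_sum_list_block_le:
  assumes "sorted_wrt block_less fs" "\<And>f. f \<in> set fs \<Longrightarrow> \<bar>coord f n\<bar> \<le> c" "0 \<le> c"
  shows "\<bar>coord (sum_list fs) n\<bar> \<le> c"
  using assms(1,2)
proof (induction fs)
  case (Cons f fs)
  show ?case
  proof (cases "coord f n = 0")
    case True
    then show ?thesis using Cons by simp
  next
    case False
    then have "coord g n = 0" if "g \<in> set fs" for g
      using Cons.prems(1) that by (fastforce simp: block_less_def supp_def)
    then have "coord (sum_list fs) n = 0" by (induction fs) auto
    then show ?thesis using Cons.prems(2) by simp
  qed
qed (use assms(3) in simp)

text \<open>This makes the supremum in \<open>K_norm\<close> finite and lets an l1-small piece of a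
  vector be cut off at small cost in the gliding hump.\<close>

lemma K_set_coord_le:
  assumes "f \<in> K_set (G_set S M1 \<sigma>1) N1 \<Lambda> \<sigma>"
  shows "\<bar>coord f n\<bar> \<le> 1"
proof -
  from assms have "\<forall>n. \<bar>coord f n\<bar> \<le> 1"
  proof (induction rule: K_set_induct)
    case (ground g E)
    then show ?case using G_set_coord_le[of g] by simp
  next
    case (l2 A c f js)
    show ?case
    proof
      fix n
      have le: "\<bar>coord (f i) n\<bar> \<le> 1 / real (mseq (js i))" if iA: "i \<in> A" for i
      proof -
        obtain fs where fs: "f i = (1 / real (mseq (js i))) *\<^sub>R sum_list fs" "sorted_wrt block_less fs"
            "\<And>g. g \<in> set fs \<Longrightarrow> \<bar>coord g n\<bar> \<le> 1"
          using l2(4)[OF iA] unfolding op_results_def by blast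
        then have "\<bar>coord (sum_list fs) n\<bar> \<le> 1" by (intro coord_sum_list_block_le) auto
        then show ?thesis by (simp add: fs(1) abs_mult divide_right_mono)
      qed
      have "(coord (\<Sum>i\<in>A. c i *\<^sub>R f i) n)^2 = (\<Sum>i\<in>A. c i * coord (f i) n)^2"
        by (simp add: coord_sum)
      also have "\<dots> \<le> (\<Sum>i\<in>A. (c i)^2) * (\<Sum>i\<in>A. (coord (f i) n)^2)"
        by (rule Cauchy_Schwarz_ineq_sum)
      also have "\<dots> \<le> 1 * 1"
      proof (rule mult_mono)
        have "(\<Sum>i\<in>A. (coord (f i) n)^2) \<le> (\<Sum>i\<in>A. (1 / real (mseq (js i)))^2)"
          by (rule sum_mono) (metis le abs_ge_zero power2_abs power_mono)
        also have "\<dots> = (\<Sum>j\<in>js ` A. (1 / real (mseq j))^2)"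
          by (simp add: sum.reindex[OF l2(3)])
        also have "\<dots> \<le> 1 / 256" by (rule sum_inverse_mseq_squares) (use l2 in auto)
        finally show "(\<Sum>i\<in>A. (coord (f i) n)^2) \<le> 1" by simp
      qed (use l2 in \<open>auto intro: sum_nonneg\<close>)
      finally show "\<bar>coord (\<Sum>i\<in>A. c i *\<^sub>R f i) n\<bar> \<le> 1" by (simp add: abs_square_le_1)
    qed
  next
    case (convex A c f)
    show ?case
    proof
      fix n
      have "\<bar>coord (\<Sum>i\<in>A. c i *\<^sub>R f i) n\<bar> \<le> (\<Sum>i\<in>A. \<bar>c i * coord (f i) n\<bar>)"
        by (simp add: coord_sum)
      also have "\<dots> \<le> (\<Sum>i\<in>A. c i * 1)"
        by (rule sum_mono) (use convex in \<open>auto simp: abs_mult intro!: mult_left_le\<close>)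
      finally show "\<bar>coord (\<Sum>i\<in>A. c i *\<^sub>R f i) n\<bar> \<le> 1" using convex by simp
    qed
  qed auto
  then show ?thesis ..
qed

section \<open>The tree of special sequences\<close>

text \<open>The family \<open>S\<close> enters through compactness in combinatorial form: no
  infinite set has all its finite subsets contained in members of \<open>S\<close>.\<close>

locale special_sequences =
  fixes S :: "nat set set" and M1 M2 :: "nat set" and \<sigma>1 :: "c00 list \<Rightarrow> nat"
  assumes split: "infinite_split M1 M2" and coding: "coding1 M2 \<sigma>1"
    and compact: "\<And>A. infinite A \<Longrightarrow> \<exists>F. finite F \<and> F \<subseteq> A \<and> (\<forall>G\<in>S. \<not> F \<subseteq> G)"
begin

abbreviation special :: "c00 list \<Rightarrow> bool" where
  "special \<equiv> special_seq S M1 \<sigma>1"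

definition node :: "c00 list \<Rightarrow> bool" where
  "node t \<longleftrightarrow> (\<exists>u. special (t @ u))"

lemma special_U: "special fs \<Longrightarrow> fs \<in> U_seqs"
  by (simp add: special_seq_def)

lemma special_ind_zero:
  assumes "special fs" shows "ind (fs ! 0) \<in> M1"
proof -
  obtain j where "j \<in> M1" "fs ! 0 \<in> G1_level j" using assms unfolding special_seq_def by blast
  moreover from this have "1 \<le> j" using split by (auto simp: infinite_split_def)
  ultimately show ?thesis using ind_eq by simp
qed

lemma \<sigma>1_in: "fs \<in> U_seqs \<Longrightarrow> \<sigma>1 fs \<in> M2 \<and> 1 \<le> \<sigma>1 fs"
  using coding split unfolding coding1_def infinite_split_def by auto

lemma special_ind_Suc:
  assumes "special fs" "0 < i" "i < length fs"
  shows "ind (fs ! i) = \<sigma>1 (take i fs)" "fs ! i \<in> G1_level (\<sigma>1 (take i fs))"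
proof -
  show 1: "fs ! i \<in> G1_level (\<sigma>1 (take i fs))" using assms by (auto simp: special_seq_def)
  have "take i fs \<in> U_seqs" using U_seqs_take[OF special_U[OF assms(1)] assms(2)] .
  then show "ind (fs ! i) = \<sigma>1 (take i fs)" using 1 \<sigma>1_in ind_eq by blast
qed

text \<open>The tree property. An index in \<open>M1\<close> belongs to a first term; an index in
  \<open>M2\<close> is the code of all preceding terms, which injectivity recovers. The terms
  carrying the common index may themselves differ.\<close>

lemma special_ind_eq_imp:
  assumes "special fs" "special gs" "m < length fs" "n < length gs" "ind (fs ! m) = ind (gs ! n)"
  shows "m = n \<and> take m fs = take n gs"
proof -
  have disj: "M1 \<inter> M2 = {}" using split by (simp add: infinite_split_def)
  have M2: "ind (hs ! i) \<in> M2" if "special hs" "0 < i" "i < length hs" for hs i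
    using special_ind_Suc(1)[OF that] \<sigma>1_in U_seqs_take[OF special_U[OF that(1)] that(2)] by simp
  consider "m = 0" "n = 0" | "m > 0" "n > 0"
    using M2[OF assms(1) _ assms(3)] M2[OF assms(2) _ assms(4)] special_ind_zero[OF assms(1)]
      special_ind_zero[OF assms(2)] disj assms(5) by (metis disjoint_iff gr0I)
  then show ?thesis
  proof cases
    case 2
    then have "\<sigma>1 (take m fs) = \<sigma>1 (take n gs)"
      using special_ind_Suc(1)[OF assms(1) _ assms(3)] special_ind_Suc(1)[OF assms(2) _ assms(4)] assms(5)
      by simp
    moreover have "take m fs \<in> U_seqs" "take n gs \<in> U_seqs"
      using U_seqs_take special_U assms(1,2) 2 by blast+
    ultimately have *: "take m fs = take n gs"
      using coding by (auto simp: coding1_def dest: inj_onD)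
    then have "min (length fs) m = min (length gs) n" by (metis length_take)
    then show ?thesis using * assms(3,4) by simp
  qed simp
qed

lemma node_U: "node t \<Longrightarrow> t \<noteq> [] \<Longrightarrow> t \<in> U_seqs"
  unfolding node_def using U_seqs_take[of "t @ u" "length t" for u] special_U by fastforce

lemma node_append: "node (t @ u) \<Longrightarrow> node t"
  unfolding node_def by auto

text \<open>The minima of the supports along a branch form an infinite set, and each of its finite
  subsets lies in the set of minima of some special sequence, hence in a member of \<open>S\<close>.
  Compactness forbids this.\<close>

lemma no_infinite_branch:
  assumes "\<And>n. node (map f [0..<n])"
  shows False
proof -
  have U: "map f [0..<Suc n] \<in> U_seqs" for n by (rule node_U[OF assms]) simp
  have nz: "supp (f n) \<noteq> {}" for n
    using U_seqs_nth[OF U, of n n] by (auto simp: G1_level_iff simp del: upt_Suc)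
  define \<mu> where "\<mu> n = Min (supp (f n))" for n
  have "\<mu> i < \<mu> n" if "i < n" for i n
  proof -
    have "block_less (f i) (f n)"
      using U_seqs_block_less[OF U, of i n n] that by (auto simp: nth_append simp del: upt_Suc)
    then show ?thesis unfolding \<mu>_def block_less_def using nz by (meson Min_in finite_supp)
  qed
  then have "strict_mono \<mu>" by (rule strict_monoI)
  then have "infinite (range \<mu>)" using strict_mono_imp_inj_on range_inj_infinite by blast
  then obtain F where F: "finite F" "F \<subseteq> range \<mu>" "\<And>G. G \<in> S \<Longrightarrow> \<not> F \<subseteq> G"
    using compact by meson
  then obtain I where I: "finite I" "F = \<mu> ` I" by (metis finite_subset_image)
  obtain n where n: "I \<subseteq> {..<n}" using I(1) by (meson finite_nat_iff_bounded)
  obtain u where u: "special (map f [0..<n] @ u)" using assms unfolding node_def by blast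
  have "F \<subseteq> (\<lambda>f. Min (supp f)) ` set (map f [0..<n] @ u)"
    using n unfolding I(2) \<mu>_def by force
  moreover have "(\<lambda>f. Min (supp f)) ` set (map f [0..<n] @ u) \<in> S"
    using u unfolding special_seq_def by blast
  ultimately show False using F(3) by blast
qed

text \<open>Countability permits a diagonal subsequence along which the mass through every node
  converges.\<close>

lemma countable_nodes: "countable {t. node t}"
proof -
  have "countable (G1_level j)" if "1 \<le> j" for j
  proof -
    have "G1_level j = (\<Union>b. {f \<in> G1_level j. supp f \<subseteq> {..b}})"
      using finite_supp by (auto simp: finite_nat_iff_bounded_le)
    moreover have "countable (\<Union>b. {f \<in> G1_level j. supp f \<subseteq> {..b}})"
      using countable_finite[OF finite_G1_level_bounded[OF that]] by (intro countable_UN) auto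
    ultimately show ?thesis by simp
  qed
  then have "countable G1_set" unfolding G1_set_def by (intro countable_UN) auto
  then have "countable (lists G1_set)" by (rule countable_lists)
  moreover have "{t. node t} \<subseteq> lists G1_set"
  proof
    fix t assume "t \<in> {t. node t}"
    then have "t = [] \<or> t \<in> U_seqs" using node_U by blast
    then show "t \<in> lists G1_set"
      using U_seqs_nth unfolding G1_set_def by (fastforce simp: in_set_conv_nth)
  qed
  ultimately show ?thesis by (rule countable_subset[rotated])
qed

text \<open>The first term has one of finitely many levels, every later term has the level dictated
  by the code of its predecessors, and bounded support leaves finitely many choices in each level.
  It also bounds the length.\<close>

lemma finite_nodes_bounded:
  "finite {t. node t \<and> t \<noteq> [] \<and> (\<forall>f\<in>set t. supp f \<subseteq> {..b}) \<and> ind (hd t) \<le> J}" (is "finite ?A")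
proof -
  define N where "N n = {t. node t \<and> length t = Suc n \<and> (\<forall>f\<in>set t. supp f \<subseteq> {..b}) \<and> ind (hd t) \<le> J}" for n
  have fin: "finite (N n)" for n
  proof (induction n)
    case 0
    have "N 0 \<subseteq> (\<lambda>f. [f]) ` (\<Union>j\<in>{1..J}. {f \<in> G1_level j. supp f \<subseteq> {..b}})"
    proof
      fix t assume t: "t \<in> N 0"
      then obtain f where f: "t = [f]" by (auto simp: N_def length_Suc_conv)
      then have "t \<in> U_seqs" using t node_U by (auto simp: N_def)
      then have "1 \<le> ind f" "f \<in> G1_level (ind f)" using U_seqs_nth[of t 0] f by auto
      moreover have "ind f \<le> J" "supp f \<subseteq> {..b}" using t f by (auto simp: N_def)
      ultimately have "f \<in> (\<Union>j\<in>{1..J}. {f \<in> G1_level j. supp f \<subseteq> {..b}})" by auto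
      then show "t \<in> (\<lambda>f. [f]) ` (\<Union>j\<in>{1..J}. {f \<in> G1_level j. supp f \<subseteq> {..b}})"
        unfolding f by (rule imageI)
    qed
    then show ?case
      by (rule finite_subset) (auto intro!: finite_imageI finite_UN_I finite_G1_level_bounded)
  next
    case (Suc n)
    have "N (Suc n) \<subseteq> (\<Union>t\<in>N n. (\<lambda>f. t @ [f]) ` {f \<in> G1_level (\<sigma>1 t). supp f \<subseteq> {..b}})"
    proof
      fix t' assume t': "t' \<in> N (Suc n)"
      define t f where "t = butlast t'" and "f = last t'"
      have len: "length t' = Suc (Suc n)" using t' by (simp add: N_def)
      then have "t' \<noteq> []" by auto
      then have t: "t' = t @ [f]" "length t = Suc n" using len by (simp_all add: t_def f_def)
      then have ne: "t \<noteq> []" by auto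
      have "node t" using t' t node_append by (auto simp: N_def)
      then have "t \<in> N n" using t' t ne by (auto simp: N_def)
      moreover obtain u where u: "special (t @ f # u)" using t' t by (auto simp: N_def node_def)
      have "f \<in> {f \<in> G1_level (\<sigma>1 t). supp f \<subseteq> {..b}}"
      proof -
        have "f \<in> G1_level (\<sigma>1 t)" using special_ind_Suc(2)[OF u, of "length t"] ne by simp
        then show ?thesis using t' t by (simp add: N_def)
      qed
      ultimately show "t' \<in> (\<Union>t\<in>N n. (\<lambda>f. t @ [f]) ` {f \<in> G1_level (\<sigma>1 t). supp f \<subseteq> {..b}})"
        unfolding t(1) by blast
    qed
    moreover have "1 \<le> \<sigma>1 t" if "t \<in> N n" for t
      using \<sigma>1_in node_U that unfolding N_def by fastforce
    ultimately show ?case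
      using Suc by (auto intro!: finite_imageI finite_UN_I finite_G1_level_bounded elim!: finite_subset)
  qed
  have "?A \<subseteq> (\<Union>n\<in>{..b}. N n)"
  proof
    fix t assume t: "t \<in> ?A"
    then obtain n where n: "length t = Suc n" by (cases t) auto
    have U: "t \<in> U_seqs" using t node_U by blast
    have "t ! n \<noteq> 0" using U_seqs_nth[OF U, of n] n by (auto simp: G1_level_iff)
    then obtain k where k: "k \<in> supp (t ! n)" by (auto simp flip: supp_empty_iff)
    have "n < k" using U_seqs_index_less_supp[OF U _ k] n by simp
    moreover have "k \<le> b" using t k n by (auto simp: subset_iff)
    ultimately show "t \<in> (\<Union>n\<in>{..b}. N n)" using t n by (auto simp: N_def)
  qed
  then show ?thesis by (rule finite_subset) (use fin in auto)
qed

section \<open>Masses of functionals passing through nodes\<close>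

text \<open>The index set is carried along with the functional because it is attached to a
  representation. Empty index sets are excluded, so that elements with disjoint index sets are
  automatically distinct.\<close>

definition tails :: "c00 list set \<Rightarrow> nat set \<Rightarrow> (c00 \<times> nat set) set" where
  "tails A W = {(sp_fun E e fs, sp_ind E fs) | E e fs. special fs \<and> (\<exists>t\<in>A. \<exists>u. fs = t @ u) \<and>
     E \<subseteq> W \<and> nat_interval E \<and> (\<forall>i<length fs. e i \<in> {-1, 1}) \<and> sp_ind E fs \<noteq> {}}"

definition families :: "c00 list set \<Rightarrow> nat set \<Rightarrow> (c00 \<times> nat set) set set" where
  "families A W = {X. finite X \<and> X \<subseteq> tails A W \<and> disjoint_family_on snd X}"

definition mass :: "(c00 \<times> nat set) set \<Rightarrow> c00 \<Rightarrow> real" where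
  "mass X y = (\<Sum>p\<in>X. (act (fst p) y)^2)"

definition small :: "c00 list set \<Rightarrow> nat set \<Rightarrow> c00 \<Rightarrow> real \<Rightarrow> bool" where
  "small A W y \<eta> \<longleftrightarrow> (\<forall>X\<in>families A W. mass X y \<le> \<eta>)"

text \<open>The squared l2-norm that functionals through the single node \<open>t\<close>, cut to
  the window \<open>W\<close>, can produce on \<open>y\<close>.\<close>

definition \<nu> :: "c00 list \<Rightarrow> nat set \<Rightarrow> c00 \<Rightarrow> real" where
  "\<nu> t W y = (SUP X\<in>families {t} W. mass X y)"

lemma empty_family: "{} \<in> families A W"
  by (simp add: families_def disjoint_family_on_def)

lemma small_nonneg: "small A W y \<eta> \<Longrightarrow> 0 \<le> \<eta>"
  using empty_family[of A W] by (force simp: small_def mass_def)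

lemma has_ind_sp_fun:
  assumes "special fs" "nat_interval E" "\<forall>i<length fs. e i \<in> {-1, 1}"
  shows "has_ind S M1 \<sigma>1 (sp_fun E e fs) (sp_ind E fs)"
  unfolding has_ind_iff
  by (rule disjI2, rule exI[of _ E], rule exI[of _ e], rule exI[of _ fs]) (use assms in simp)

lemma tails_has_ind: "p \<in> tails A W \<Longrightarrow> has_ind S M1 \<sigma>1 (fst p) (snd p)"
proof -
  assume "p \<in> tails A W"
  then obtain E e fs where "p = (sp_fun E e fs, sp_ind E fs)" "special fs" "nat_interval E"
      "\<forall>i<length fs. e i \<in> {-1, 1}"
    unfolding tails_def by blast
  then show ?thesis using has_ind_sp_fun by simp
qed

lemma small_mono: "small A W y \<eta> \<Longrightarrow> \<eta> \<le> \<eta>' \<Longrightarrow> small A W y \<eta>'"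
  unfolding small_def by force

lemma small_subset:
  assumes "small B W y \<eta>" "tails A W \<subseteq> tails B W" shows "small A W y \<eta>"
  using assms unfolding small_def families_def by blast

lemma small_Un:
  assumes "small A W y \<eta>" "small B W y \<eta>'" shows "small (A \<union> B) W y (\<eta> + \<eta>')"
  unfolding small_def
proof
  fix X assume X: "X \<in> families (A \<union> B) W"
  have un: "tails (A \<union> B) W \<subseteq> tails A W \<union> tails B W" unfolding tails_def by blast
  have "X \<inter> tails A W \<in> families A W" "X - tails A W \<in> families B W"
    using X un by (auto simp: families_def disjoint_family_on_def)
  then have "mass (X \<inter> tails A W) y \<le> \<eta>" "mass (X - tails A W) y \<le> \<eta>'"
    using assms by (auto simp: small_def)
  moreover have "mass X y = mass (X \<inter> tails A W) y + mass (X - tails A W) y"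
    using X unfolding mass_def families_def by (auto simp: sum.Int_Diff)
  ultimately show "mass X y \<le> \<eta> + \<eta>'" by linarith
qed

lemma small_empty: "small {} W y 0"
  by (auto simp: small_def families_def tails_def mass_def)

lemma small_UN:
  assumes "finite C" "\<And>c. c \<in> C \<Longrightarrow> small (A c) W y (\<eta> c)"
  shows "small (\<Union>c\<in>C. A c) W y (\<Sum>c\<in>C. \<eta> c)"
  using assms by (induction C) (auto simp: small_empty intro: small_Un)

end

context special_sequences
begin

lemma tails_mono: "A \<subseteq> B \<Longrightarrow> tails A W \<subseteq> tails B W"
  unfolding tails_def by blast

text \<open>A common index would sit at a position beyond both nodes, since their terms miss the
  window. By the tree property the two sequences agree before that position, so the nodes would
  coincide.\<close>

lemma tails_disjoint:
  assumes p: "p \<in> tails {c} W" and p': "p' \<in> tails {c'} W" and len: "length c = length c'" and ne: "c \<noteq> c'"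
    and out: "\<And>f. f \<in> set c \<union> set c' \<Longrightarrow> supp f \<inter> W = {}"
  shows "snd p \<inter> snd p' = {}"
proof (rule ccontr)
  assume "snd p \<inter> snd p' \<noteq> {}"
  then obtain j where j: "j \<in> snd p" "j \<in> snd p'" by blast
  obtain E e u where P: "snd p = sp_ind E (c @ u)" "special (c @ u)" "E \<subseteq> W"
    using p unfolding tails_def by force
  obtain E' e' u' where P': "snd p' = sp_ind E' (c' @ u')" "special (c' @ u')" "E' \<subseteq> W"
    using p' unfolding tails_def by force
  obtain m where m: "m < length (c @ u)" "restrict E ((c @ u) ! m) \<noteq> 0" "ind ((c @ u) ! m) = j"
    using j(1) unfolding P(1) sp_ind_def by blast
  obtain n where n: "n < length (c' @ u')" "restrict E' ((c' @ u') ! n) \<noteq> 0" "ind ((c' @ u') ! n) = j"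
    using j(2) unfolding P'(1) sp_ind_def by blast
  have mn: "m = n \<and> take m (c @ u) = take n (c' @ u')"
    by (rule special_ind_eq_imp[OF P(2) P'(2) m(1) n(1)]) (simp add: m n)
  have "length c \<le> m"
  proof (rule ccontr)
    assume "\<not> length c \<le> m"
    then have "(c @ u) ! m \<in> set c" by (simp add: nth_append)
    then have "supp ((c @ u) ! m) \<inter> E = {}" using out P(3) by blast
    then show False using m(2) by (simp add: restrict_eq_zero_iff)
  qed
  then have "take (length c) (take m (c @ u)) = c" "take (length c) (take m (c' @ u')) = c'"
    using len mn by (simp_all add: min_def)
  then show False using mn ne by metis
qed

lemma sp_fun_eq_zero: "sp_ind E fs = {} \<Longrightarrow> sp_fun E e fs = 0"
  unfolding sp_fun_def sp_ind_def restrict_sum restrict_scaleR by (intro sum.neutral) auto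

text \<open>Passage from indexed families to sets of pairs: cut every functional to the window and
  drop those with empty index set, which act as 0. The remaining pairs are distinct by
  disjointness.\<close>

lemma sum_squares_family_le:
  assumes I: "finite I" and sp: "\<And>i. i \<in> I \<Longrightarrow> special (fs i)" "\<And>i. i \<in> I \<Longrightarrow> nat_interval (E i)"
    "\<And>i. i \<in> I \<Longrightarrow> \<forall>m<length (fs i). e i m \<in> {-1, 1}"
    and A: "\<And>i. i \<in> I \<Longrightarrow> \<exists>t\<in>A. \<exists>u. fs i = t @ u"
    and dis: "disjoint_family_on (\<lambda>i. sp_ind (E i) (fs i)) I"
    and small: "small A W x \<eta>" and x: "supp x \<subseteq> W" and W: "nat_interval W"
  shows "(\<Sum>i\<in>I. (act (sp_fun (E i) (e i) (fs i)) x)^2) \<le> \<eta>"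
proof -
  define I' where "I' = {i \<in> I. sp_ind (E i \<inter> W) (fs i) \<noteq> {}}"
  define P where "P i = (sp_fun (E i \<inter> W) (e i) (fs i), sp_ind (E i \<inter> W) (fs i))" for i
  have sub: "sp_ind (E i \<inter> W) (fs i) \<subseteq> sp_ind (E i) (fs i)" for i by (rule sp_ind_mono) simp
  have dis': "sp_ind (E i \<inter> W) (fs i) \<inter> sp_ind (E k \<inter> W) (fs k) = {}" if "i \<in> I" "k \<in> I" "i \<noteq> k" for i k
    using disjoint_family_onD[OF dis that] sub[of i] sub[of k] by blast
  have inj: "inj_on P I'"
  proof (rule inj_onI)
    fix i k assume ik: "i \<in> I'" "k \<in> I'" "P i = P k"
    show "i = k"
    proof (rule ccontr)
      assume "i \<noteq> k"
      then show False using dis'[of i k] ik by (auto simp: I'_def P_def)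
    qed
  qed
  have "P ` I' \<subseteq> tails A W"
  proof
    fix p assume "p \<in> P ` I'"
    then obtain i where i: "i \<in> I'" "p = P i" by blast
    have "special (fs i) \<and> (\<exists>t\<in>A. \<exists>u. fs i = t @ u) \<and> E i \<inter> W \<subseteq> W \<and> nat_interval (E i \<inter> W) \<and>
        (\<forall>m<length (fs i). e i m \<in> {-1, 1}) \<and> sp_ind (E i \<inter> W) (fs i) \<noteq> {}"
      using i(1) sp A W by (simp add: I'_def)
    then show "p \<in> tails A W"
      unfolding i(2) P_def tails_def mem_Collect_eq
      by (intro exI[of _ "E i \<inter> W"] exI[of _ "e i"] exI[of _ "fs i"]) simp
  qed
  moreover have "disjoint_family_on snd (P ` I')"
    unfolding disjoint_family_on_def using dis' by (auto simp: P_def I'_def)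
  ultimately have "P ` I' \<in> families A W" using I by (simp add: families_def I'_def)
  then have "mass (P ` I') x \<le> \<eta>" using small by (simp add: small_def)
  moreover have "mass (P ` I') x = (\<Sum>i\<in>I'. (act (sp_fun (E i) (e i) (fs i)) x)^2)"
    unfolding mass_def sum.reindex[OF inj] using act_sp_fun_window[OF x] by (simp add: P_def)
  moreover have "\<dots> = (\<Sum>i\<in>I. (act (sp_fun (E i) (e i) (fs i)) x)^2)"
    by (rule sum.mono_neutral_left)
      (use I in \<open>auto simp: I'_def act_sp_fun_window[OF x] sp_fun_eq_zero\<close>)
  ultimately show ?thesis by simp
qed

text \<open>Once a term reaches beyond \<open>B\<close>, all later terms lie entirely beyond
  \<open>B\<close>. So at most one acting term is not contained in \<open>{..B}\<close>, and its
  position \<open>n\<close> is the same for all \<open>E\<close> and \<open>e\<close>.\<close>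

lemma act_sp_fun_split:
  assumes fs: "fs \<in> U_seqs" and x: "supp x \<subseteq> {..B}"
  shows "\<exists>n\<le>length fs. (\<forall>m<n. supp (fs ! m) \<subseteq> {..B}) \<and>
    (\<forall>E e. act (sp_fun E e fs) x = (\<Sum>m<n. e m * act (restrict E (fs ! m)) x) +
       (if n < length fs then e n * act (restrict E (fs ! n)) x else 0))"
proof -
  define n where "n = (LEAST n. n = length fs \<or> \<not> supp (fs ! n) \<subseteq> {..B})"
  have n: "n = length fs \<or> \<not> supp (fs ! n) \<subseteq> {..B}" unfolding n_def by (rule LeastI) blast
  have nl: "n \<le> length fs" unfolding n_def by (rule Least_le) simp
  have sm: "supp (fs ! m) \<subseteq> {..B}" if "m < n" for m
    using not_less_Least[of m "\<lambda>n. n = length fs \<or> \<not> supp (fs ! n) \<subseteq> {..B}"] that n_def by blast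
  have z: "act (restrict E (fs ! m)) x = 0" if m: "n < m" "m < length fs" for m E
  proof (rule act_disjoint)
    have "\<not> supp (fs ! n) \<subseteq> {..B}" using n m by auto
    then obtain k where k: "k \<in> supp (fs ! n)" "B < k" by (auto simp: subset_iff not_le)
    then have "B < l" if "l \<in> supp (fs ! m)" for l
      using U_seqs_block_less[OF fs m] that k by (meson block_less_def less_trans)
    then show "supp (restrict E (fs ! m)) \<inter> supp x = {}" using x by fastforce
  qed
  have "act (sp_fun E e fs) x = (\<Sum>m<n. e m * act (restrict E (fs ! m)) x) +
       (if n < length fs then e n * act (restrict E (fs ! n)) x else 0)" for E e
  proof (cases "n = length fs")
    case False
    then have "n < length fs" using nl by simp
    then have "{..<length fs} = {..<n} \<union> ({n} \<union> {n<..<length fs})" by auto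
    then have "act (sp_fun E e fs) x =
        (\<Sum>m\<in>{..<n} \<union> ({n} \<union> {n<..<length fs}). e m * act (restrict E (fs ! m)) x)"
      by (simp add: act_sp_fun)
    also have "\<dots> = (\<Sum>m<n. e m * act (restrict E (fs ! m)) x) +
        ((\<Sum>m\<in>{n}. e m * act (restrict E (fs ! m)) x) + (\<Sum>m\<in>{n<..<length fs}. e m * act (restrict E (fs ! m)) x))"
      by (subst sum.union_disjoint; (subst sum.union_disjoint)?) auto
    also have "(\<Sum>m\<in>{n<..<length fs}. e m * act (restrict E (fs ! m)) x) = 0"
      by (rule sum.neutral) (use z in auto)
    finally show ?thesis using \<open>n < length fs\<close> by simp
  qed (simp add: act_sp_fun)
  then show ?thesis using nl sm by blast
qed

end

text \<open>The bound \<open>\<tau>\<close> on square sums over different levels is what preliminary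
  averaging provides; it serves to control straddling terms.\<close>

locale special_blocks = special_sequences +
  fixes y :: "nat \<Rightarrow> c00" and a b :: "nat \<Rightarrow> nat" and \<tau> :: real
  assumes ab: "\<And>k. a k < b k" "\<And>k. b k \<le> a (Suc k)" and supp_y: "\<And>k. supp (y k) \<subseteq> {a k<..b k}"
    and Gl2_le: "\<And>k g. g \<in> Gl2_set S M1 \<sigma>1 \<Longrightarrow> \<bar>act g (y k)\<bar> \<le> 1"
    and G1_le: "\<And>k T g. finite T \<Longrightarrow> T \<subseteq> {1..} \<Longrightarrow> (\<And>j. j \<in> T \<Longrightarrow> g j \<in> G1_level j) \<Longrightarrow>
      (\<Sum>j\<in>T. (act (g j) (y k))^2) \<le> \<tau>^2"
    and e0: "0 < \<tau>" "\<tau> \<le> 1"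
begin

abbreviation W :: "nat \<Rightarrow> nat set" where "W l \<equiv> {a l<..b l}"

abbreviation small_at :: "nat \<Rightarrow> c00 list set \<Rightarrow> real \<Rightarrow> bool" where
  "small_at l A \<eta> \<equiv> small A (W l) (y l) \<eta>"

abbreviation eventually_small :: "c00 list set \<Rightarrow> real \<Rightarrow> bool" where
  "eventually_small A \<eta> \<equiv> \<forall>\<^sub>F l in sequentially. small_at l A \<eta>"

lemma strict_mono_a: "strict_mono a"
  by (rule strict_monoI_Suc) (use ab in \<open>meson less_le_trans\<close>)

lemma eventually_a_ge: "\<forall>\<^sub>F l in sequentially. p \<le> a l"
  using filterlim_subseq[OF strict_mono_a] by (simp add: filterlim_at_top)

lemma mass_le_one:
  assumes "X \<in> families A V" shows "mass X (y l) \<le> 1"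
proof -
  have "(\<Sum>p\<in>X. (act (fst p) (y l))^2) \<le> 1^2"
  proof (rule Gl2_squares_le[OF Gl2_le])
    show "has_ind S M1 \<sigma>1 (fst p) (snd p)" if "p \<in> X" for p
      by (rule tails_has_ind[of _ A V]) (use that assms in \<open>unfold families_def, blast\<close>)
  qed (use assms in \<open>auto simp: families_def\<close>)
  then show ?thesis by (simp add: mass_def)
qed

lemma bdd_mass: "bdd_above ((\<lambda>X. mass X (y l)) ` families A V)"
  using mass_le_one by (intro bdd_aboveI2)

lemma small_\<nu>: "small {t} V (y l) (\<nu> t V (y l))"
  unfolding small_def \<nu>_def by (intro ballI cSUP_upper bdd_mass)

lemma \<nu>_nonneg: "0 \<le> \<nu> t V (y l)"
  by (rule small_nonneg[OF small_\<nu>])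

lemma \<nu>_le_one: "\<nu> t V (y l) \<le> 1"
proof -
  have "families {t} V \<noteq> {}" using empty_family by blast
  then show ?thesis unfolding \<nu>_def by (rule cSUP_least) (rule mass_le_one)
qed

text \<open>Families through different nodes of equal length that end before the window have
  disjoint index sets, so their union is again a family and has mass at most 1.\<close>

lemma sum_\<nu>_le_one:
  assumes C: "finite C" "\<And>c. c \<in> C \<Longrightarrow> length c = n" "\<And>c f. c \<in> C \<Longrightarrow> f \<in> set c \<Longrightarrow> supp f \<subseteq> {..a l}"
  shows "(\<Sum>c\<in>C. \<nu> c (W l) (y l)) \<le> 1"
  unfolding \<nu>_def
proof (rule sum_Sup_le[OF C(1)])
  fix x assume "\<And>c. c \<in> C \<Longrightarrow> x c \<in> (\<lambda>X. mass X (y l)) ` families {c} (W l)"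
  then have "\<forall>c\<in>C. \<exists>X. X \<in> families {c} (W l) \<and> x c = mass X (y l)" by blast
  then obtain X where X: "\<And>c. c \<in> C \<Longrightarrow> X c \<in> families {c} (W l) \<and> x c = mass (X c) (y l)" by metis
  have out: "supp f \<inter> W l = {}" if "c \<in> C" "f \<in> set c" for c f
    using C(3)[OF that] by fastforce
  have cross: "snd p \<inter> snd p' = {}" if "c \<in> C" "c' \<in> C" "c \<noteq> c'" "p \<in> X c" "p' \<in> X c'" for c c' p p'
  proof (rule tails_disjoint)
    show "p \<in> tails {c} (W l)" "p' \<in> tails {c'} (W l)" using X that by (auto simp: families_def)
  qed (use C(2) out that in auto)
  have nonempty: "snd p \<noteq> {}" if "c \<in> C" "p \<in> X c" for c p
    using X that by (force simp: families_def tails_def)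
  have disj: "X c \<inter> X c' = {}" if "c \<in> C" "c' \<in> C" "c \<noteq> c'" for c c'
    using cross[OF that] nonempty[OF that(1)] by blast
  have "(\<Sum>c\<in>C. x c) = mass (\<Union>c\<in>C. X c) (y l)"
    unfolding mass_def
    by (subst sum.UNION_disjoint) (use C(1) X disj in \<open>auto simp: families_def mass_def\<close>)
  also have "(\<Union>c\<in>C. X c) \<in> families C (W l)"
    unfolding families_def mem_Collect_eq
  proof (intro conjI)
    show "finite (\<Union>c\<in>C. X c)" using C(1) X by (auto simp: families_def)
    show "(\<Union>c\<in>C. X c) \<subseteq> tails C (W l)"
    proof
      fix p assume "p \<in> (\<Union>c\<in>C. X c)"
      then obtain c where c: "c \<in> C" "p \<in> X c" by blast
      then have "p \<in> tails {c} (W l)" using X[OF c(1)] unfolding families_def by blast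
      then show "p \<in> tails C (W l)" using tails_mono[of "{c}" C] c(1) by blast
    qed
    show "disjoint_family_on snd (\<Union>c\<in>C. X c)"
      unfolding disjoint_family_on_def
    proof (intro ballI impI)
      fix p p' assume p: "p \<in> (\<Union>c\<in>C. X c)" "p' \<in> (\<Union>c\<in>C. X c)" "p \<noteq> p'"
      then obtain c c' where c: "c \<in> C" "c' \<in> C" "p \<in> X c" "p' \<in> X c'" by blast
      show "snd p \<inter> snd p' = {}"
      proof (cases "c = c'")
        case True
        then show ?thesis using X[OF c(1)] c p(3) by (auto simp: families_def disjoint_family_on_def)
      qed (use cross c in blast)
    qed
  qed
  then have "mass (\<Union>c\<in>C. X c) (y l) \<le> 1" by (rule mass_le_one)
  finally show "(\<Sum>c\<in>C. x c) \<le> 1" .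
next
  fix c
  show "(\<lambda>X. mass X (y l)) ` families {c} (W l) \<noteq> {}" using empty_family by blast
qed (rule bdd_mass)

section \<open>Persistent mass and bad nodes\<close>

definition past :: "nat \<Rightarrow> c00 list \<Rightarrow> bool" where
  "past p t \<longleftrightarrow> (\<exists>f\<in>set t. \<not> supp f \<subseteq> {..p})"

lemma past_antimono: "past p t \<Longrightarrow> q \<le> p \<Longrightarrow> past q t"
  unfolding past_def by fastforce

lemma not_past: "finite T \<Longrightarrow> \<exists>p. \<forall>t\<in>T. \<not> past p t"
proof -
  assume T: "finite T"
  have "finite (\<Union>t\<in>T. \<Union>f\<in>set t. supp f)" using T by auto
  then obtain p where "(\<Union>t\<in>T. \<Union>f\<in>set t. supp f) \<subseteq> {..p}" by (meson finite_nat_iff_bounded_le)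
  then show ?thesis unfolding past_def by blast
qed

definition late :: "c00 list \<Rightarrow> nat \<Rightarrow> c00 list set \<Rightarrow> bool" where
  "late t p A \<longleftrightarrow> finite A \<and> (\<forall>t'\<in>A. node t' \<and> (\<exists>u. t' = t @ u) \<and> past p t')"

text \<open>The finite set of nodes is fixed before the block varies: infinitely many blocks must
  receive mass above \<open>\<eta>\<close> through one finite set, and such sets must exist
  arbitrarily far out below \<open>t\<close>.\<close>

definition bad :: "c00 list \<Rightarrow> bool" where
  "bad t \<longleftrightarrow> (\<exists>\<eta>>0. \<forall>p. \<exists>A. late t p A \<and> \<not> eventually_small A \<eta>)"

text \<open>The masses of the children of a node add up to at most 1, so all but finitely many children are
  negligible together; were none of the finitely many others bad, the node would not be bad.\<close>

lemma bad_child: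
  assumes conv: "\<And>t. node t \<Longrightarrow> (\<lambda>l. \<nu> t (W l) (y l)) \<longlonglongrightarrow> L t" and "bad t"
  shows "\<exists>f. bad (t @ [f])"
proof (rule ccontr)
  assume nb: "\<nexists>f. bad (t @ [f])"
  obtain \<eta> where \<eta>: "0 < \<eta>"
    "\<And>p. \<exists>A. late t p A \<and> \<not> eventually_small A \<eta>"
    using \<open>bad t\<close> unfolding bad_def by blast
  define Ch where "Ch = {c. node c \<and> (\<exists>f. c = t @ [f])}"
  have sumL: "(\<Sum>c\<in>C. L c) \<le> 1" if C: "finite C" "C \<subseteq> Ch" for C
  proof (rule tendsto_upperbound)
    show "(\<lambda>l. \<Sum>c\<in>C. \<nu> c (W l) (y l)) \<longlonglongrightarrow> (\<Sum>c\<in>C. L c)"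
      by (intro tendsto_sum conv) (use C in \<open>auto simp: Ch_def\<close>)
    obtain p where p: "\<forall>c\<in>C. \<not> past p c" using not_past[OF C(1)] by blast
    show "\<forall>\<^sub>F l in sequentially. (\<Sum>c\<in>C. \<nu> c (W l) (y l)) \<le> 1"
      using eventually_a_ge[of p]
    proof eventually_elim
      case (elim l)
      show ?case
        by (rule sum_\<nu>_le_one[OF C(1), of "Suc (length t)"])
          (use C p elim in \<open>fastforce simp: Ch_def past_def\<close>)+
    qed
  qed simp
  \<comment> \<open>The limit masses of the children form a summable family. The finite set
    \<open>C0\<close> nearly attains the total, so any finite set of other children has limit mass
    at most \<open>\<eta> / 4\<close>.\<close>
  define X where "X = (\<lambda>C. \<Sum>c\<in>C. L c) ` {C. finite C \<and> C \<subseteq> Ch}"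
  have X: "X \<noteq> {}" "bdd_above X" unfolding X_def using sumL by (auto intro!: bdd_aboveI2)
  obtain C0 where C0: "finite C0" "C0 \<subseteq> Ch" "Sup X - \<eta> / 4 < (\<Sum>c\<in>C0. L c)"
    using less_cSupD[OF X(1), of "Sup X - \<eta> / 4"] \<eta>(1) by (auto simp: X_def)
  have rest: "(\<Sum>c\<in>C. L c) \<le> \<eta> / 4" if C: "finite C" "C \<subseteq> Ch - C0" for C
  proof -
    have "(\<Sum>c\<in>C0 \<union> C. L c) \<le> Sup X"
      by (rule cSup_upper[OF _ X(2)]) (use C C0 in \<open>auto simp: X_def\<close>)
    moreover have "(\<Sum>c\<in>C0 \<union> C. L c) = (\<Sum>c\<in>C0. L c) + (\<Sum>c\<in>C. L c)"
      by (rule sum.union_disjoint) (use C C0 in auto)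
    ultimately show ?thesis using C0(3) by linarith
  qed
  \<comment> \<open>Equal shares for the children in \<open>C0\<close>, with total at most
    \<open>\<eta> / 2\<close>; the added 1 covers an empty \<open>C0\<close>.\<close>
  define \<eta>' where "\<eta>' = \<eta> / (2 * (real (card C0) + 1))"
  have \<eta>': "0 < \<eta>'" using \<eta>(1) by (simp add: \<eta>'_def)
  have "\<exists>p. \<forall>A. late c p A \<longrightarrow> eventually_small A \<eta>'" if "c \<in> C0" for c
  proof -
    have "\<not> bad c" using nb that C0(2) by (auto simp: Ch_def)
    then show ?thesis using \<eta>' unfolding bad_def by meson
  qed
  then obtain P where P: "\<And>c A. c \<in> C0 \<Longrightarrow> late c (P c) A \<Longrightarrow>
      eventually_small A \<eta>'"
    by metis
  \<comment> \<open>With \<open>p\<close> at least \<open>p0\<close> the node \<open>t\<close>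
    itself is not past \<open>p\<close>, so every node in a late set properly extends
    \<open>t\<close> and passes through one of its children.\<close>
  obtain p0 where p0: "\<not> past p0 t" using not_past[of "{t}"] by auto
  define p where "p = Max (insert p0 (P ` C0))"
  have p: "p0 \<le> p" "\<And>c. c \<in> C0 \<Longrightarrow> P c \<le> p" using C0(1) by (auto simp: p_def)
  obtain A where A: "finite A" "\<And>t'. t' \<in> A \<Longrightarrow> node t' \<and> (\<exists>u. t' = t @ u) \<and> past p t'"
      "\<not> eventually_small A \<eta>"
    using \<eta>(2)[of p] unfolding late_def by blast
  define A0 where "A0 c = {t' \<in> A. \<exists>u. t' = c @ u}" for c
  define h where "h t' = take (Suc (length t)) t'" for t' :: "c00 list"
  have h: "h t' \<in> Ch \<and> (\<exists>u. t' = h t' @ u)" if "t' \<in> A" for t'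
  proof -
    obtain u where u: "t' = t @ u" "past p t'" "node t'" using A(2) \<open>t' \<in> A\<close> by blast
    then have "u \<noteq> []" using p0 p(1) past_antimono by auto
    then obtain f v where "u = f # v" by (cases u) auto
    then have "t' = (t @ [f]) @ v" "h t' = t @ [f]" using u by (simp_all add: h_def)
    then show ?thesis using u(3) node_append unfolding Ch_def by auto
  qed
  \<comment> \<open>Nodes of \<open>A\<close> below the remaining children are replaced by those
    children. This only enlarges the set of functionals and reduces the bound to a finite sum of
    \<open>\<nu>\<close>.\<close>
  define C' where "C' = h ` {t' \<in> A. h t' \<notin> C0}"
  have C': "finite C'" "C' \<subseteq> Ch - C0" using A(1) h by (auto simp: C'_def)
  have cov: "tails A V \<subseteq> tails ((\<Union>c\<in>C0. A0 c) \<union> (\<Union>c\<in>C'. {c})) V" for V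
  proof
    fix q assume "q \<in> tails A V"
    then obtain E e fs t' u where q: "q = (sp_fun E e fs, sp_ind E fs)" "special fs" "t' \<in> A" "fs = t' @ u"
      "E \<subseteq> V" "nat_interval E" "\<forall>i<length fs. e i \<in> {-1, 1}" "sp_ind E fs \<noteq> {}"
      unfolding tails_def by blast
    obtain v where v: "t' = h t' @ v" using h q(3) by blast
    have "\<exists>t\<in>(\<Union>c\<in>C0. A0 c) \<union> (\<Union>c\<in>C'. {c}). \<exists>u. fs = t @ u"
    proof (cases "h t' \<in> C0")
      case True
      then have "t' \<in> A0 (h t')" using q(3) v unfolding A0_def by blast
      then show ?thesis using True q(4) by blast
    next
      case False
      then have "h t' \<in> C'" using q(3) by (auto simp: C'_def)
      moreover have "fs = h t' @ (v @ u)" using v q(4) by (metis append_assoc)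
      ultimately show ?thesis by blast
    qed
    then show "q \<in> tails ((\<Union>c\<in>C0. A0 c) \<union> (\<Union>c\<in>C'. {c})) V"
      using q unfolding tails_def by blast
  qed
  have ev0: "\<forall>\<^sub>F l in sequentially. \<forall>c\<in>C0. small_at l (A0 c) \<eta>'"
  proof (rule eventually_ball_finite[OF C0(1)], rule ballI)
    fix c assume c: "c \<in> C0"
    show "\<forall>\<^sub>F l in sequentially. small_at l (A0 c) \<eta>'"
      by (rule P[OF c]) (use A p(2)[OF c] past_antimono in \<open>auto simp: A0_def late_def\<close>)
  qed
  have "(\<lambda>l. \<Sum>c\<in>C'. \<nu> c (W l) (y l)) \<longlonglongrightarrow> (\<Sum>c\<in>C'. L c)"
    by (intro tendsto_sum conv) (use C' in \<open>auto simp: Ch_def\<close>)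
  moreover have "(\<Sum>c\<in>C'. L c) < \<eta> / 2" using rest[OF C'] \<eta>(1) by linarith
  ultimately have ev1: "\<forall>\<^sub>F l in sequentially. (\<Sum>c\<in>C'. \<nu> c (W l) (y l)) < \<eta> / 2"
    by (rule order_tendstoD(2))
  have "eventually_small A \<eta>"
    using ev0 ev1
  proof eventually_elim
    case (elim l)
    have "small_at l ((\<Union>c\<in>C0. A0 c) \<union> (\<Union>c\<in>C'. {c})) ((\<Sum>c\<in>C0. \<eta>') + (\<Sum>c\<in>C'. \<nu> c (W l) (y l)))"
      by (intro small_Un small_UN C0(1) C'(1) small_\<nu>) (use elim in auto)
    moreover have "(\<Sum>c\<in>C0. \<eta>') + (\<Sum>c\<in>C'. \<nu> c (W l) (y l)) \<le> \<eta>"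
    proof -
      have "(\<Sum>c\<in>C0. \<eta>') \<le> \<eta> / 2" using \<eta>(1) by (simp add: \<eta>'_def field_simps)
      then show ?thesis using elim(2) by linarith
    qed
    ultimately show ?case by (rule small_subset[OF small_mono cov])
  qed
  then show False using A(3) by contradiction
qed

text \<open>Failure of the claim says that the root is bad. Bad children then produce an infinite
  branch by dependent choice, which does not exist.\<close>

lemma small_past:
  assumes conv: "\<And>t. node t \<Longrightarrow> (\<lambda>l. \<nu> t (W l) (y l)) \<longlonglongrightarrow> L t" and \<eta>: "0 < \<eta>"
  shows "\<exists>p. \<forall>A. finite A \<longrightarrow> (\<forall>t\<in>A. node t \<and> past p t) \<longrightarrow> eventually_small A \<eta>"
proof (rule ccontr)
  assume "\<not> ?thesis"
  then have "\<And>p. \<exists>A. late [] p A \<and> \<not> eventually_small A \<eta>"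
    unfolding late_def by simp
  then have "bad []" using \<eta> unfolding bad_def by blast
  have "\<exists>T. \<forall>n. (bad (T n) \<and> length (T n) = n) \<and> (\<exists>f. T (Suc n) = T n @ [f])"
    by (rule dependent_nat_choice) (use \<open>bad []\<close> bad_child[OF conv] in force)+
  then obtain T where T: "\<And>n. bad (T n)" "\<And>n. length (T n) = n" "\<And>n. \<exists>f. T (Suc n) = T n @ [f]"
    by blast
  define f where "f n = last (T (Suc n))" for n
  have "T n = map f [0..<n]" for n
  proof (induction n)
    case (Suc n)
    then show ?case using T(3)[of n] by (auto simp: f_def)
  qed (use T(2)[of 0] in simp)
  moreover have "node (T n)" for n
  proof -
    obtain \<eta> A where A: "\<eta> > 0" "late (T n) 0 A" "\<not> eventually_small A \<eta>"
      using T(1)[of n] unfolding bad_def by blast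
    \<comment> \<open>No mass passes through an empty set of nodes; hence some node extends
      \<open>T n\<close>, which makes \<open>T n\<close> a node itself.\<close>
    have "A \<noteq> {}"
    proof
      assume "A = {}"
      then have "small_at l A \<eta>" for l using small_mono[OF small_empty] A(1) by simp
      then show False using A(3) by simp
    qed
    then obtain t' where "t' \<in> A" by blast
    then obtain u where "node t'" "t' = T n @ u" using A(2) unfolding late_def by blast
    then have "node (T n @ u)" by simp
    then show ?thesis by (rule node_append)
  qed
  ultimately show False using no_infinite_branch[of f] by simp
qed

end

section \<open>Almost orthogonality of special functionals on blocks\<close>

context special_sequences
begin

definition special_family :: "'i set \<Rightarrow> ('i \<Rightarrow> nat set) \<Rightarrow> ('i \<Rightarrow> nat \<Rightarrow> real) \<Rightarrow> ('i \<Rightarrow> c00 list) \<Rightarrow> bool" where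
  "special_family I E e fs \<longleftrightarrow> finite I \<and> disjoint_family_on (\<lambda>i. sp_ind (E i) (fs i)) I \<and>
     (\<forall>i\<in>I. special (fs i) \<and> nat_interval (E i) \<and> (\<forall>m<length (fs i). e i m \<in> {-1, 1}))"

end

context special_blocks
begin

lemma special_family_squares_le_one:
  assumes "special_family I E e fs"
  shows "(\<Sum>i\<in>I. (act (sp_fun (E i) (e i) (fs i)) (y k))^2) \<le> 1"
proof -
  have "(\<Sum>i\<in>I. (act (sp_fun (E i) (e i) (fs i)) (y k))^2) \<le> 1^2"
  proof (rule Gl2_squares_le[OF Gl2_le])
    show "has_ind S M1 \<sigma>1 (sp_fun (E i) (e i) (fs i)) (sp_ind (E i) (fs i))" if "i \<in> I" for i
      using assms that by (intro has_ind_sp_fun) (auto simp: special_family_def)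
  qed (use assms in \<open>auto simp: special_family_def\<close>)
  then show ?thesis by simp
qed

text \<open>The vector \<open>y k\<close> is fixed with finite l1-norm \<open>s\<close>, while a
  functional whose indices in the window are large has tiny coordinates there. The surplus factor in
  \<open>1 / m^2\<close> against \<open>1 / m\<close> beats \<open>s\<close>, and the remaining
  \<open>1 / m\<close> is square summable.\<close>

lemma large_indices_negligible:
  "\<exists>J. \<forall>I E e fs. special_family (I :: nat set) E e fs \<longrightarrow>
    (\<forall>i\<in>I. sp_ind (E i \<inter> W k) (fs i) \<subseteq> {J<..}) \<longrightarrow>
    (\<Sum>i\<in>I. (act (sp_fun (E i) (e i) (fs i)) (y k))^2) \<le> \<tau>^2"
proof -
  define s where "s = (\<Sum>n\<in>supp (y k). \<bar>coord (y k) n\<bar>)"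
  have s0: "0 \<le> s" by (simp add: s_def sum_nonneg)
  obtain J :: nat where J: "s / \<tau> < 2 ^ J" using real_arch_pow[of 2 "s / \<tau>"] by auto
  have "(\<Sum>i\<in>I. (act (sp_fun (E i) (e i) (fs i)) (y k))^2) \<le> \<tau>^2"
    if fam: "special_family (I :: nat set) E e fs" and large: "\<And>i. i \<in> I \<Longrightarrow> sp_ind (E i \<inter> W k) (fs i) \<subseteq> {J<..}"
    for I E e fs
  proof -
    have I: "finite I" "\<And>i. i \<in> I \<Longrightarrow> special (fs i)" "\<And>i. i \<in> I \<Longrightarrow> \<forall>m<length (fs i). e i m \<in> {-1, 1}"
      and dis: "disjoint_family_on (\<lambda>i. sp_ind (E i) (fs i)) I"
      using fam by (auto simp: special_family_def)
    define I' where "I' = {i \<in> I. sp_ind (E i \<inter> W k) (fs i) \<noteq> {}}"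
    \<comment> \<open>The smallest index gives the largest coordinates, and disjointness of the
      index sets makes the choice injective.\<close>
    define j where "j i = Min (sp_ind (E i \<inter> W k) (fs i))" for i
    have j: "j i \<in> sp_ind (E i \<inter> W k) (fs i)" if "i \<in> I'" for i
      unfolding j_def by (rule Min_in[OF finite_sp_ind]) (use that in \<open>simp add: I'_def\<close>)
    have jJ: "J < j i" if "i \<in> I'" for i
      using j[OF that] large[of i] that by (auto simp: I'_def)
    have sub: "sp_ind (E i \<inter> W k) (fs i) \<subseteq> sp_ind (E i) (fs i)" for i by (rule sp_ind_mono) simp
    have "(\<Sum>i\<in>I. (act (sp_fun (E i) (e i) (fs i)) (y k))^2) =
        (\<Sum>i\<in>I'. (act (sp_fun (E i) (e i) (fs i)) (y k))^2)"
      by (rule sum.mono_neutral_right)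
        (use I in \<open>auto simp: I'_def act_sp_fun_window[OF supp_y] sp_fun_eq_zero\<close>)
    also have "\<dots> \<le> \<tau>^2"
    proof (rule G1_squares_le_of_inj[where j = j])
      show "inj_on j I'"
      proof (rule inj_onI, rule ccontr)
        fix i i' assume i: "i \<in> I'" "i' \<in> I'" "j i = j i'" "i \<noteq> i'"
        have "sp_ind (E i) (fs i) \<inter> sp_ind (E i') (fs i') = {}"
          by (rule disjoint_family_onD[OF dis]) (use i in \<open>auto simp: I'_def\<close>)
        then show False using j[OF i(1)] j[OF i(2)] sub[of i] sub[of i'] i(3) by auto
      qed
      fix i assume i: "i \<in> I'"
      show "1 \<le> j i" using jJ[OF i] by simp
      define m where "m = real (mseq (2 * j i - 1))"
      have mJ: "2 ^ J \<le> m"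
      proof -
        have "1 \<le> 2 * j i - 1" using jJ[OF i] by linarith
        note ge = mseq_ge[OF this]
        have "2 ^ J \<le> (2::nat) ^ (2 * j i - 1)" by (rule power_increasing) (use jJ[OF i] in auto)
        also have "\<dots> \<le> mseq (2 * j i - 1)" using ge by linarith
        finally have "real (2 ^ J) \<le> real (mseq (2 * j i - 1))" by (simp only: of_nat_le_iff)
        then show ?thesis by (simp add: m_def)
      qed
      have m0: "0 < m" using mJ by (rule less_le_trans[rotated]) simp
      have c: "\<bar>coord (sp_fun (E i \<inter> W k) (e i) (fs i)) n\<bar> \<le> 1 / m^2" for n
      proof (cases "coord (sp_fun (E i \<inter> W k) (e i) (fs i)) n = 0")
        case False
        have "i \<in> I" using i by (simp add: I'_def)
        then obtain j' where j': "j' \<in> sp_ind (E i \<inter> W k) (fs i)" "1 \<le> j'"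
            "\<bar>coord (sp_fun (E i \<inter> W k) (e i) (fs i)) n\<bar> = 1 / (real (mseq (2 * j' - 1)))^2"
          using sp_fun_coord[OF special_U[OF I(2)] I(3) False] by blast
        have "j i \<le> j'" unfolding j_def by (rule Min_le[OF finite_sp_ind j'(1)])
        then have "mseq (2 * j i - 1) \<le> mseq (2 * j' - 1)"
          by (intro mseq_mono) (use jJ[OF i] in auto)
        then have "m \<le> real (mseq (2 * j' - 1))" by (simp add: m_def)
        then have "m^2 \<le> (real (mseq (2 * j' - 1)))^2" using m0 by (intro power_mono) auto
        then show ?thesis unfolding j'(3) using m0 by (intro divide_left_mono) (auto intro!: mult_pos_pos)
      qed simp
      have "\<bar>act (sp_fun (E i) (e i) (fs i)) (y k)\<bar> \<le> 1 / m^2 * s"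
        unfolding s_def by (subst act_sp_fun_window[OF supp_y]) (rule abs_act_le[OF c])
      also have "\<dots> \<le> \<tau> * (1 / m)"
      proof -
        have "s < \<tau> * 2 ^ J" using J e0 by (simp add: field_simps)
        also have "\<dots> \<le> \<tau> * m" using mJ e0 by (intro mult_left_mono) auto
        finally show ?thesis using m0 by (simp add: field_simps power2_eq_square)
      qed
      finally show "\<bar>act (sp_fun (E i) (e i) (fs i)) (y k)\<bar> \<le> \<tau> * (1 / real (mseq (2 * j i - 1)))"
        by (simp add: m_def)
    qed (use I e0 in \<open>auto simp: I'_def\<close>)
    finally show ?thesis .
  qed
  then show ?thesis by blast
qed

text \<open>One term from each sequence gives one functional per level, because the index sets are
  disjoint. Thus \<open>G1_le\<close> applies.\<close>

lemma straddling_squares_le: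
  assumes fam: "special_family I E e fs" and "I' \<subseteq> I" and n: "\<And>i. i \<in> I' \<Longrightarrow> n i < length (fs i)"
  shows "(\<Sum>i\<in>I'. (e i (n i) * act (restrict (E i) (fs i ! n i)) (y k))^2) \<le> \<tau>^2"
proof -
  define I0 where "I0 = {i \<in> I'. restrict (E i) (fs i ! n i) \<noteq> 0}"
  define j where "j i = ind (fs i ! n i)" for i
  have fin: "finite I'" and dis: "disjoint_family_on (\<lambda>i. sp_ind (E i) (fs i)) I"
    using fam \<open>I' \<subseteq> I\<close> by (auto simp: special_family_def intro: finite_subset)
  have U: "fs i \<in> U_seqs" if "i \<in> I'" for i
    using fam that \<open>I' \<subseteq> I\<close> special_U by (auto simp: special_family_def)
  have j: "1 \<le> j i" "fs i ! n i \<in> G1_level (j i)" if "i \<in> I'" for i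
    using U_seqs_nth[OF U[OF that] n[OF that]] by (simp_all add: j_def)
  have jind: "j i \<in> sp_ind (E i) (fs i)" if "i \<in> I0" for i
    using that n unfolding sp_ind_def I0_def j_def by blast
  have inj: "inj_on j I0"
  proof (rule inj_onI, rule ccontr)
    fix i i' assume i: "i \<in> I0" "i' \<in> I0" "j i = j i'" "i \<noteq> i'"
    have "sp_ind (E i) (fs i) \<inter> sp_ind (E i') (fs i') = {}"
      by (rule disjoint_family_onD[OF dis]) (use i \<open>I' \<subseteq> I\<close> in \<open>auto simp: I0_def\<close>)
    then show False using jind[OF i(1)] jind[OF i(2)] i(3) by auto
  qed
  define g where "g t = restrict (E (the_inv_into I0 j t)) (fs (the_inv_into I0 j t) ! n (the_inv_into I0 j t))" for t
  have gj: "g (j i) = restrict (E i) (fs i ! n i)" if "i \<in> I0" for i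
    using the_inv_into_f_f[OF inj that] by (simp add: g_def)
  have "(\<Sum>i\<in>I'. (e i (n i) * act (restrict (E i) (fs i ! n i)) (y k))^2) =
      (\<Sum>i\<in>I0. (e i (n i) * act (restrict (E i) (fs i ! n i)) (y k))^2)"
    by (rule sum.mono_neutral_right) (use fin in \<open>auto simp: I0_def\<close>)
  also have "\<dots> = (\<Sum>i\<in>I0. (act (g (j i)) (y k))^2)"
  proof (rule sum.cong[OF refl])
    fix i assume i: "i \<in> I0"
    have "e i (n i) \<in> {-1, 1}"
      using fam n[of i] i \<open>I' \<subseteq> I\<close> unfolding special_family_def I0_def by blast
    then have "(e i (n i))^2 = 1" by auto
    then show "(e i (n i) * act (restrict (E i) (fs i ! n i)) (y k))^2 = (act (g (j i)) (y k))^2"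
      by (simp add: gj[OF i] power_mult_distrib)
  qed
  also have "\<dots> = (\<Sum>t\<in>j ` I0. (act (g t) (y k))^2)"
    by (simp add: sum.reindex[OF inj])
  also have "\<dots> \<le> \<tau>^2"
  proof (rule G1_le)
    show "g t \<in> G1_level t" if t: "t \<in> j ` I0" for t
    proof -
      obtain i where i: "i \<in> I0" "t = j i" using t by blast
      then show ?thesis
        using gj[OF i(1)] j[of i] G1_level_restrict[of "j i" "fs i ! n i" "E i"] by (simp add: I0_def)
    qed
  qed (use fin j in \<open>auto simp: I0_def\<close>)
  finally show ?thesis .
qed

text \<open>The bound \<open>4 * \<tau>\<close> is the sum of \<open>\<tau>\<close> for large
  indices, \<open>\<tau>\<close> for straddling terms and \<open>2 * \<tau>\<close> for terms
  contained in the initial segment up to the end of the earlier block.\<close>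

definition almost_orthogonal :: "nat \<Rightarrow> nat \<Rightarrow> bool" where
  "almost_orthogonal k l \<longleftrightarrow> (\<forall>(I :: nat set) E e fs. special_family I E e fs \<longrightarrow>
    (\<Sum>i\<in>I. act (sp_fun (E i) (e i) (fs i)) (y k) * act (sp_fun (E i) (e i) (fs i)) (y l)) \<le> 4 * \<tau>)"

text \<open>For a fixed block \<open>y k\<close>, sequences with only large indices are negligible
  on \<open>y k\<close>, and so are straddling terms. Any other contribution to \<open>y k\<close>
  comes through one of finitely many nodes past \<open>a k\<close>, whose mass on a late
  \<open>y l\<close> is small. Cauchy-Schwarz combines the three parts.\<close>

lemma special_gram_eventually:
  assumes p: "\<And>A. finite A \<Longrightarrow> (\<And>t. t \<in> A \<Longrightarrow> node t \<and> past p t) \<Longrightarrow>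
      eventually_small A (\<tau>^2)"
    and k: "p \<le> a k"
  shows "\<forall>\<^sub>F l in sequentially. almost_orthogonal k l"
proof -
  obtain J where J: "\<And>(I :: nat set) E e fs. special_family I E e fs \<Longrightarrow>
      (\<And>i. i \<in> I \<Longrightarrow> sp_ind (E i \<inter> W k) (fs i) \<subseteq> {J<..}) \<Longrightarrow>
      (\<Sum>i\<in>I. (act (sp_fun (E i) (e i) (fs i)) (y k))^2) \<le> \<tau>^2"
    using large_indices_negligible[of k] by blast
  \<comment> \<open>This set depends on \<open>k\<close> and \<open>J\<close> only; its finiteness
    lets one \<open>l\<close>-threshold serve all families at once.\<close>
  define A where "A = {t. node t \<and> t \<noteq> [] \<and> (\<forall>f\<in>set t. supp f \<subseteq> {..b k}) \<and> ind (hd t) \<le> J} \<inter> {t. past (a k) t}"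
  have "eventually_small A (\<tau>^2)"
    by (rule p) (use finite_nodes_bounded past_antimono[OF _ k] in \<open>auto simp: A_def\<close>)
  then show ?thesis
  proof eventually_elim
    case (elim l)
    show ?case
      unfolding almost_orthogonal_def
    proof (intro allI impI)
      fix I :: "nat set" and E e fs
      assume fam: "special_family I E e fs"
      define c where "c i h = act (sp_fun (E i) (e i) (fs i)) (y h)" for i h
      have fin: "finite I" and sp: "\<And>i. i \<in> I \<Longrightarrow> special (fs i)"
        using fam by (auto simp: special_family_def)
      have c1: "(\<Sum>i\<in>I'. (c i h)^2) \<le> 1^2" if "I' \<subseteq> I" for I' h
        using sum_squares_subset_le[OF fin that] special_family_squares_le_one[OF fam] by (simp add: c_def)
      have supb: "supp (y k) \<subseteq> {..b k}" using supp_y[of k] by auto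
      define Q where "Q i n \<longleftrightarrow> n \<le> length (fs i) \<and> (\<forall>m<n. supp (fs i ! m) \<subseteq> {..b k}) \<and>
        (\<forall>E e. act (sp_fun E e (fs i)) (y k) = (\<Sum>m<n. e m * act (restrict E (fs i ! m)) (y k)) +
         (if n < length (fs i) then e n * act (restrict E (fs i ! n)) (y k) else 0))" for i n
      have "\<exists>n. Q i n" if "i \<in> I" for i
        using act_sp_fun_split[OF special_U[OF sp[OF that]] supb] unfolding Q_def by blast
      then obtain n where "\<And>i. i \<in> I \<Longrightarrow> Q i (n i)" by metis
      then have n: "\<And>i. i \<in> I \<Longrightarrow> n i \<le> length (fs i)"
        "\<And>i m. i \<in> I \<Longrightarrow> m < n i \<Longrightarrow> supp (fs i ! m) \<subseteq> {..b k}"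
        "\<And>i E e. i \<in> I \<Longrightarrow> act (sp_fun E e (fs i)) (y k) =
          (\<Sum>m<n i. e m * act (restrict E (fs i ! m)) (y k)) +
          (if n i < length (fs i) then e (n i) * act (restrict E (fs i ! n i)) (y k) else 0)"
        unfolding Q_def by blast+
      \<comment> \<open>\<open>c'\<close> collects the terms of the special sequence that end within the \<open>k\<close>-th block, hence
        form a node; \<open>c''\<close> is the single term straddling the end of the block.\<close>
      define c' where "c' i = (\<Sum>m<n i. e i m * act (restrict (E i) (fs i ! m)) (y k))" for i
      define c'' where "c'' i = (if n i < length (fs i) then e i (n i) * act (restrict (E i) (fs i ! n i)) (y k) else 0)" for i
      have cc: "c i k = c' i + c'' i" if "i \<in> I" for i
        using n(3)[OF that] by (simp add: c_def c'_def c''_def)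
      have c''2: "(\<Sum>i\<in>I'. (c'' i)^2) \<le> \<tau>^2" if "I' \<subseteq> I" for I'
      proof -
        have "(\<Sum>i\<in>I'. (c'' i)^2) = (\<Sum>i\<in>{i\<in>I'. n i < length (fs i)}. (c'' i)^2)"
          by (rule sum.mono_neutral_right) (use finite_subset[OF that fin] in \<open>auto simp: c''_def\<close>)
        also have "\<dots> = (\<Sum>i\<in>{i\<in>I'. n i < length (fs i)}. (e i (n i) * act (restrict (E i) (fs i ! n i)) (y k))^2)"
          by (rule sum.cong) (auto simp: c''_def)
        also have "\<dots> \<le> \<tau>^2" by (rule straddling_squares_le[OF fam]) (use that in auto)
        finally show ?thesis .
      qed
      \<comment> \<open>From \<open>c' = c - c''\<close> and
        \<open>(u - v)^2 \<le> 2 * u^2 + 2 * v^2\<close>, with both square sums at most 1.\<close>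
      have c'2: "(\<Sum>i\<in>I'. (c' i)^2) \<le> 2^2" if "I' \<subseteq> I" for I'
      proof -
        have "(\<Sum>i\<in>I'. (c' i)^2) \<le> (\<Sum>i\<in>I'. 2 * (c i k)^2 + 2 * (c'' i)^2)"
        proof (rule sum_mono)
          fix i assume "i \<in> I'"
          then have "c' i = c i k - c'' i" using cc that by auto
          moreover have "(u - v)^2 \<le> 2 * u^2 + 2 * v^2" for u v :: real
            using zero_le_power2[of "u + v"] by (simp add: power2_eq_square algebra_simps)
          ultimately show "(c' i)^2 \<le> 2 * (c i k)^2 + 2 * (c'' i)^2" by metis
        qed
        also have "\<dots> = 2 * (\<Sum>i\<in>I'. (c i k)^2) + 2 * (\<Sum>i\<in>I'. (c'' i)^2)"
          by (simp add: sum.distrib sum_distrib_left)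
        also have "\<dots> \<le> 2 * 1 + 2 * 1"
          using c1[OF that, of k] c''2[OF that] e0 power_le_one[of \<tau> 2] by (intro add_mono mult_left_mono) auto
        finally show ?thesis by simp
      qed
      define I2 where "I2 = {i \<in> I. sp_ind (E i \<inter> W k) (fs i) \<subseteq> {J<..}}"
      define I3 where "I3 = {i \<in> I - I2. c' i \<noteq> 0}"
      have sub: "I2 \<subseteq> I" "I - I2 \<subseteq> I" "I3 \<subseteq> I" by (auto simp: I2_def I3_def)
      have famsub: "special_family I' E e fs" if "I' \<subseteq> I" for I'
        using fam that finite_subset[OF that fin] disjoint_family_on_mono[OF that]
        by (auto simp: special_family_def)
      \<comment> \<open>A nonzero \<open>c' i\<close> yields a term that meets the k-th block, so
        the segment is past \<open>a k\<close>. Being outside \<open>I2\<close> yields an index at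
        most \<open>J\<close>, and the first index of a special sequence is its smallest.\<close>
      have pastA: "take (n i) (fs i) \<in> A" if i: "i \<in> I3" for i
      proof -
        have iI: "i \<in> I" and "c' i \<noteq> 0" using i by (auto simp: I3_def)
        then obtain m where m: "m < n i" "act (restrict (E i) (fs i ! m)) (y k) \<noteq> 0"
          unfolding c'_def by (metis (no_types, lifting) lessThan_iff mult_zero_right sum.neutral)
        then have "supp (fs i ! m) \<inter> supp (y k) \<noteq> {}"
          using act_disjoint[of "restrict (E i) (fs i ! m)" "y k"] by auto
        then have nl: "\<not> supp (fs i ! m) \<subseteq> {..a k}" using supp_y[of k] by fastforce
        have ml: "m < length (fs i)" using m(1) n(1)[OF iI] by simp
        have "fs i ! m \<in> set (take (n i) (fs i))"
          using m(1) ml by (auto simp: in_set_conv_nth intro!: exI[of _ m])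
        then have "past (a k) (take (n i) (fs i))" using nl unfolding past_def by blast
        moreover have "node (take (n i) (fs i))"
          unfolding node_def using sp[OF iI] by (intro exI[of _ "drop (n i) (fs i)"]) simp
        moreover have ne: "take (n i) (fs i) \<noteq> []" using m(1) ml by auto
        moreover have "\<forall>f\<in>set (take (n i) (fs i)). supp f \<subseteq> {..b k}"
        proof
          fix f assume "f \<in> set (take (n i) (fs i))"
          then obtain m where "m < n i" "f = fs i ! m" by (auto simp: in_set_conv_nth)
          then show "supp f \<subseteq> {..b k}" using n(2)[OF iI] by simp
        qed
        moreover have "ind (hd (take (n i) (fs i))) \<le> J"
        proof -
          have "\<not> sp_ind (E i \<inter> W k) (fs i) \<subseteq> {J<..}" using i by (simp add: I3_def I2_def)
          then obtain j where j: "j \<in> sp_ind (E i \<inter> W k) (fs i)" "j \<le> J"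
            by (auto simp: subset_iff not_less)
          then obtain h where h: "h < length (fs i)" "j = ind (fs i ! h)" unfolding sp_ind_def by blast
          have "ind (fs i ! 0) \<le> ind (fs i ! h)"
            using U_seqs_ind_less[OF special_U[OF sp[OF iI]], of 0 h] h(1) by (cases "h = 0") auto
          then show ?thesis using j(2) h ne by (simp add: hd_conv_nth)
        qed
        ultimately show ?thesis by (simp add: A_def)
      qed
      have I3l: "(\<Sum>i\<in>I3. (c i l)^2) \<le> \<tau>^2"
        unfolding c_def
      proof (rule sum_squares_family_le[where A = A and W = "W l"])
        show "\<exists>t\<in>A. \<exists>u. fs i = t @ u" if "i \<in> I3" for i
          using pastA[OF that] by (metis append_take_drop_id)
      qed (use famsub[OF sub(3)] elim supp_y in \<open>auto simp: special_family_def\<close>)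
      have "(\<Sum>i\<in>I. c i k * c i l) = (\<Sum>i\<in>I2. c i k * c i l) + (\<Sum>i\<in>I - I2. c i k * c i l)"
        using sum.subset_diff[OF sub(1) fin] by (metis add.commute)
      also have "(\<Sum>i\<in>I - I2. c i k * c i l) = (\<Sum>i\<in>I - I2. c'' i * c i l) + (\<Sum>i\<in>I - I2. c' i * c i l)"
        unfolding sum.distrib[symmetric] by (rule sum.cong) (auto simp: cc algebra_simps)
      also have "(\<Sum>i\<in>I - I2. c' i * c i l) = (\<Sum>i\<in>I3. c' i * c i l)"
        by (rule sum.mono_neutral_right) (use fin in \<open>auto simp: I3_def\<close>)
      also have "(\<Sum>i\<in>I2. c i k * c i l) \<le> \<tau> * 1"
      proof (rule sum_mult_le_of_squares[OF _ c1[OF sub(1)]])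
        show "(\<Sum>i\<in>I2. (c i k)^2) \<le> \<tau>^2"
          unfolding c_def by (rule J[OF famsub[OF sub(1)]]) (simp add: I2_def)
      qed (use e0 in auto)
      also have "(\<Sum>i\<in>I - I2. c'' i * c i l) \<le> \<tau> * 1"
        by (rule sum_mult_le_of_squares[OF c''2[OF sub(2)] c1[OF sub(2)]]) (use e0 in auto)
      also have "(\<Sum>i\<in>I3. c' i * c i l) \<le> 2 * \<tau>"
        by (rule sum_mult_le_of_squares[OF c'2[OF sub(3)] I3l]) (use e0 in auto)
      finally show "(\<Sum>i\<in>I. act (sp_fun (E i) (e i) (fs i)) (y k) * act (sp_fun (E i) (e i) (fs i)) (y l)) \<le> 4 * \<tau>"
        by (simp add: c_def)
    qed
  qed
qed

lemma subseq_special_blocks: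
  assumes "strict_mono r"
  shows "special_blocks S M1 M2 \<sigma>1 (y \<circ> r) (a \<circ> r) (b \<circ> r) \<tau>"
proof unfold_locales
  fix k
  have "a (Suc (r k)) \<le> a (r (Suc k))"
    using strict_mono_a assms by (simp add: strict_mono_less_eq Suc_le_eq strict_monoD)
  then show "(b \<circ> r) k \<le> (a \<circ> r) (Suc k)" using ab(2)[of "r k"] by simp
qed (use ab supp_y Gl2_le G1_le e0 in auto)

text \<open>Two extractions: a diagonal one makes the masses through all nodes converge, a second
  one turns eventual into pairwise almost orthogonality. In between, the locale is instantiated for
  the subsequence, so that windows and blocks stay aligned.\<close>

lemma special_sums_subseq:
  obtains r :: "nat \<Rightarrow> nat" where "strict_mono r"
    "\<And>F (I :: nat set) E e fs. finite F \<Longrightarrow> special_family I E e fs \<Longrightarrow>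
      (\<Sum>i\<in>I. (\<Sum>k\<in>F. act (sp_fun (E i) (e i) (fs i)) (y (r k)))^2) \<le> card F + 4 * \<tau> * (card F)^2"
proof -
  obtain r0 where r0: "strict_mono (r0 :: nat \<Rightarrow> nat)"
      "\<And>t. t \<in> {t. node t} \<Longrightarrow> \<exists>L. (\<lambda>l. \<nu> t (W (r0 l)) (y (r0 l))) \<longlonglongrightarrow> L"
    using function_convergent_subsequence[OF countable_nodes, of "\<lambda>l t. \<nu> t (W l) (y l)" 1]
      \<nu>_nonneg \<nu>_le_one by auto
  interpret sub: special_blocks S M1 M2 \<sigma>1 "y \<circ> r0" "a \<circ> r0" "b \<circ> r0" \<tau>
    by (rule subseq_special_blocks[OF r0(1)])
  obtain L where L: "\<And>t. node t \<Longrightarrow> (\<lambda>l. \<nu> t (W (r0 l)) (y (r0 l))) \<longlonglongrightarrow> L t"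
    using r0(2) by (metis mem_Collect_eq)
  have "\<exists>p. \<forall>A. finite A \<longrightarrow> (\<forall>t\<in>A. node t \<and> sub.past p t) \<longrightarrow>
      sub.eventually_small A (\<tau>^2)"
    by (rule sub.small_past) (use L e0 in simp_all)
  then obtain p where "\<forall>A. finite A \<longrightarrow> (\<forall>t\<in>A. node t \<and> sub.past p t) \<longrightarrow>
      sub.eventually_small A (\<tau>^2)" ..
  then have p: "sub.eventually_small A (\<tau>^2)"
    if "finite A" "\<And>t. t \<in> A \<Longrightarrow> node t \<and> sub.past p t" for A
    using that by simp
  have "\<forall>\<^sub>F k in sequentially. \<forall>\<^sub>F l in sequentially. sub.almost_orthogonal k l"
    using sub.eventually_a_ge[of p] by (rule eventually_mono) (rule sub.special_gram_eventually[OF p])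
  then obtain r1 where r1: "strict_mono (r1 :: nat \<Rightarrow> nat)"
      "\<And>k l. k < l \<Longrightarrow> sub.almost_orthogonal (r1 k) (r1 l)"
    by (rule strict_mono_subseq_pairwise) blast
  show ?thesis
  proof (rule that[of "r0 \<circ> r1"])
    show "strict_mono (r0 \<circ> r1)" using r0(1) r1(1) by (rule strict_mono_o)
    fix F :: "nat set" and I :: "nat set" and E e fs
    assume F: "finite F" and fam: "special_family I E e fs"
    show "(\<Sum>i\<in>I. (\<Sum>k\<in>F. act (sp_fun (E i) (e i) (fs i)) (y ((r0 \<circ> r1) k)))^2) \<le> card F + 4 * \<tau> * (card F)^2"
    proof (rule almost_orthogonal_sum_bound[OF F])
      show "(\<Sum>i\<in>I. act (sp_fun (E i) (e i) (fs i)) (y ((r0 \<circ> r1) k)) *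
          act (sp_fun (E i) (e i) (fs i)) (y ((r0 \<circ> r1) l))) \<le> 4 * \<tau>" if "k < l" for k l
        using r1(2)[OF that] fam by (simp add: sub.almost_orthogonal_def)
    qed (use special_family_squares_le_one[OF fam] e0 in auto)
  qed
qed

end

section \<open>Block sequences and averages\<close>

lemma nseq_pos: "1 \<le> j \<Longrightarrow> 1 \<le> nseq j"
proof -
  have "1 \<le> nseq (Suc i)" for i by (induction i) auto
  then show "1 \<le> j \<Longrightarrow> 1 \<le> nseq j" by (cases j) auto
qed

lemma nseq_strict_mono:
  assumes "1 \<le> i" "i < j" shows "nseq i < nseq j"
proof -
  have step: "nseq (Suc i) < nseq (Suc (Suc i))" for i
  proof -
    have "nseq (Suc i) < 2 * nseq (Suc i)" using nseq_pos[of "Suc i"] by simp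
    also have "\<dots> = (2 * nseq (Suc i)) ^ 1" by simp
    also have "\<dots> \<le> (2 * nseq (Suc i)) ^ sseq (Suc i)"
      by (rule power_increasing) (use nseq_pos[of "Suc i"] in \<open>auto simp: sseq_eq Suc_le_eq\<close>)
    finally show ?thesis by simp
  qed
  have "strict_mono (\<lambda>i. nseq (Suc i))" by (rule strict_monoI_Suc) (rule step)
  then have "nseq (Suc (i - 1)) < nseq (Suc (j - 1))" by (rule strict_monoD) (use assms in simp)
  then show ?thesis using assms by simp
qed

text \<open>Each block on which \<open>f\<close> acts claims a point of \<open>supp f\<close> of its
  own.\<close>

lemma abs_act_block_sum_le:
  fixes u :: "nat \<Rightarrow> c00"
  assumes u: "\<And>i i'. i < i' \<Longrightarrow> i' < N \<Longrightarrow> block_less (u i) (u i')"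
    and f: "\<And>i. i < N \<Longrightarrow> \<bar>act f (u i)\<bar> \<le> 1"
  shows "\<bar>act f (\<Sum>i<N. u i)\<bar> \<le> card (supp f)"
proof -
  define H where "H = {i. i < N \<and> supp f \<inter> supp (u i) \<noteq> {}}"
  have "\<forall>i\<in>H. \<exists>n. n \<in> supp f \<inter> supp (u i)" by (auto simp: H_def)
  then obtain h where h: "\<And>i. i \<in> H \<Longrightarrow> h i \<in> supp f \<inter> supp (u i)" by metis
  have "inj_on h H"
  proof (rule inj_onI, rule ccontr)
    fix i i' assume i: "i \<in> H" "i' \<in> H" "h i = h i'" "i \<noteq> i'"
    then show False using h[OF i(1)] h[OF i(2)] u[of i i'] u[of i' i]
      by (cases i i' rule: linorder_cases) (auto simp: block_less_def H_def)
  qed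
  moreover have "h ` H \<subseteq> supp f" using h by auto
  ultimately have card: "card H \<le> card (supp f)" by (rule card_inj_on_le) simp
  have "\<bar>act f (\<Sum>i<N. u i)\<bar> \<le> (\<Sum>i<N. \<bar>act f (u i)\<bar>)" by (simp add: act_sum_right)
  also have "\<dots> = (\<Sum>i\<in>H. \<bar>act f (u i)\<bar>)"
    by (rule sum.mono_neutral_right) (auto simp: H_def act_disjoint)
  also have "\<dots> \<le> (\<Sum>i\<in>H. 1)" by (rule sum_mono) (use f in \<open>auto simp: H_def\<close>)
  finally show ?thesis using card by simp
qed

text \<open>Pairs of a functional and a vector that meet form a monotone staircase, on which the sum of
  the two positions is injective.\<close>

lemma abs_act_op_result_le:
  fixes u :: "nat \<Rightarrow> c00"
  assumes f: "f \<in> op_results K j"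
    and u: "\<And>i i'. i < i' \<Longrightarrow> i' < N \<Longrightarrow> block_less (u i) (u i')"
    and K: "\<And>i g. i < N \<Longrightarrow> g \<in> K \<Longrightarrow> \<bar>act g (u i)\<bar> \<le> 1"
  shows "\<bar>act f (\<Sum>i<N. u i)\<bar> \<le> (real N + real (nseq j)) / real (mseq j)"
proof -
  obtain fs where fs: "f = (1 / real (mseq j)) *\<^sub>R sum_list fs" "length fs \<le> nseq j"
      "sorted_wrt block_less fs" "set fs \<subseteq> K"
    using f unfolding op_results_def by blast
  define n where "n = length fs"
  define H where "H = {(l, i). l < n \<and> i < N \<and> supp (fs ! l) \<inter> supp (u i) \<noteq> {}}"
  have finH: "finite H" by (rule finite_subset[of _ "{..<n} \<times> {..<N}"]) (auto simp: H_def)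
  have key: False if H: "(l, i) \<in> H" "(l', i') \<in> H" and "l + i = l' + i'" "l < l'" for l i l' i'
  proof -
    have "i' < i" using that by simp
    then have "block_less (u i') (u i)" using u H by (auto simp: H_def)
    moreover have "block_less (fs ! l) (fs ! l')"
      using fs(3) \<open>l < l'\<close> H by (auto simp: H_def n_def sorted_wrt_nth_less)
    moreover obtain x x' where "x \<in> supp (fs ! l) \<inter> supp (u i)" "x' \<in> supp (fs ! l') \<inter> supp (u i')"
      using H by (auto simp: H_def)
    ultimately have "x < x'" "x' < x" by (auto simp: block_less_def)
    then show False by simp
  qed
  have "inj_on (\<lambda>(l, i). l + i) H"
  proof (rule inj_onI, clarify)
    fix l i l' i' assume H: "(l, i) \<in> H" "(l', i') \<in> H" and eq: "l + i = l' + i'"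
    show "l = l' \<and> i = i'"
      using key[OF H eq] key[OF H(2,1) eq[symmetric]] eq by (cases l l' rule: linorder_cases) auto
  qed
  moreover have "(\<lambda>(l, i). l + i) ` H \<subseteq> {..<N + n}" by (auto simp: H_def)
  ultimately have "card H \<le> card {..<N + n}" by (rule card_inj_on_le) simp
  then have card: "card H \<le> N + n" by simp
  have "\<bar>act (sum_list fs) (\<Sum>i<N. u i)\<bar> = \<bar>\<Sum>l<n. \<Sum>i<N. act (fs ! l) (u i)\<bar>"
    unfolding act_sum_list_left by (simp add: sum_list_sum_nth act_sum_right n_def atLeast0LessThan)
  also have "\<dots> = \<bar>\<Sum>(l, i)\<in>{..<n} \<times> {..<N}. act (fs ! l) (u i)\<bar>"
    by (simp add: sum.cartesian_product)
  also have "(\<Sum>(l, i)\<in>{..<n} \<times> {..<N}. act (fs ! l) (u i)) = (\<Sum>(l, i)\<in>H. act (fs ! l) (u i))"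
    by (rule sum.mono_neutral_right) (auto simp: H_def act_disjoint)
  also have "\<bar>\<dots>\<bar> \<le> (\<Sum>p\<in>H. \<bar>case p of (l, i) \<Rightarrow> act (fs ! l) (u i)\<bar>)" by (rule sum_abs)
  also have "\<dots> \<le> (\<Sum>p\<in>H. 1)"
  proof (rule sum_mono)
    fix p assume "p \<in> H"
    then obtain l i where p: "p = (l, i)" "l < n" "i < N" by (auto simp: H_def)
    then have "fs ! l \<in> K" using fs(4) by (auto simp: n_def)
    then show "\<bar>case p of (l, i) \<Rightarrow> act (fs ! l) (u i)\<bar> \<le> 1" using K p by simp
  qed
  also have "\<dots> \<le> real N + real (nseq j)" using card fs(2) by (simp add: n_def)
  finally show ?thesis by (simp add: fs(1) act_scaleR_left abs_mult divide_right_mono)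
qed

definition tail_sums_le :: "(nat \<Rightarrow> c00 set) \<Rightarrow> (nat \<Rightarrow> c00) \<Rightarrow> nat \<Rightarrow> real \<Rightarrow> bool" where
  "tail_sums_le \<Phi> y J \<epsilon> \<longleftrightarrow> (\<forall>F T g. finite F \<longrightarrow> finite T \<longrightarrow> T \<subseteq> {1..} \<longrightarrow> T \<subseteq> {J..} \<longrightarrow>
     (\<forall>j\<in>T. g j \<in> \<Phi> j) \<longrightarrow> (\<Sum>j\<in>T. (act (g j) (\<Sum>k\<in>F. y k))^2) \<le> real (card F) + \<epsilon> * real ((card F)^2))"

text \<open>The largest values \<open>V k j\<close> of the functionals of level \<open>j\<close> on
  \<open>y k\<close> lie in the unit ball of l2, because near-maximizers can be combined over the
  levels. Being nonnegative, they dominate all values and reduce the claim to real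
  sequences.\<close>

lemma level_sums_subseq:
  fixes \<Phi> :: "nat \<Rightarrow> c00 set" and y :: "nat \<Rightarrow> c00" and \<epsilon> :: real
  assumes le: "\<And>k T g. finite T \<Longrightarrow> T \<subseteq> {1..} \<Longrightarrow> (\<And>j. j \<in> T \<Longrightarrow> g j \<in> \<Phi> j) \<Longrightarrow>
      (\<Sum>j\<in>T. (act (g j) (y k))^2) \<le> 1" and e: "0 < \<epsilon>"
  obtains r :: "nat \<Rightarrow> nat" and J where "strict_mono r" "tail_sums_le \<Phi> (y \<circ> r) J \<epsilon>"
proof -
  \<comment> \<open>The inserted 0 covers levels without functionals and lets a selection skip a
    level.\<close>
  define X where "X k j = insert 0 ((\<lambda>f. (act f (y k))^2) ` \<Phi> j)" for k j
  define V where "V k j = (if j = 0 then 0 else sqrt (Sup (X k j)))" for k j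
  have X1: "x \<le> 1" if "x \<in> X k j" "1 \<le> j" for x k j
    using that le[of "{j}" "\<lambda>_. f" k for f] by (fastforce simp: X_def)
  have bdd: "bdd_above (X k j)" if "1 \<le> j" for k j using X1 that by (intro bdd_aboveI)
  have up: "\<bar>act f (y k)\<bar> \<le> V k j" if "f \<in> \<Phi> j" "1 \<le> j" for f k j
  proof -
    have "(act f (y k))^2 \<le> Sup (X k j)"
      by (rule cSup_upper[OF _ bdd]) (use that in \<open>auto simp: X_def\<close>)
    then show ?thesis using that real_sqrt_le_mono by (fastforce simp: V_def)
  qed
  have S0: "0 \<le> Sup (X k j)" if "1 \<le> j" for k j
    by (rule cSup_upper[OF _ bdd[OF that]]) (simp add: X_def)
  have V0: "0 \<le> V k j" for k j using S0[of j k] by (simp add: V_def)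
  have V1: "(\<Sum>j<n. (V k j)^2) \<le> 1" for k n
  proof -
    have "(\<Sum>j<n. (V k j)^2) = (\<Sum>j\<in>{1..<n}. (V k j)^2)"
      by (rule sum.mono_neutral_right) (auto simp: V_def)
    also have "\<dots> = (\<Sum>j\<in>{1..<n}. Sup (X k j))"
      by (rule sum.cong) (use S0 in \<open>auto simp: V_def\<close>)
    also have "\<dots> \<le> 1"
    proof (rule sum_Sup_le)
      fix x assume x: "\<And>j. j \<in> {1..<n} \<Longrightarrow> x j \<in> X k j"
      define T where "T = {j \<in> {1..<n}. x j \<noteq> 0}"
      have "\<forall>j\<in>T. \<exists>f. f \<in> \<Phi> j \<and> x j = (act f (y k))^2" using x by (fastforce simp: T_def X_def)
      then obtain g where g: "\<And>j. j \<in> T \<Longrightarrow> g j \<in> \<Phi> j \<and> x j = (act (g j) (y k))^2" by metis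
      have "(\<Sum>j\<in>{1..<n}. x j) = (\<Sum>j\<in>T. x j)"
        by (rule sum.mono_neutral_right) (auto simp: T_def)
      also have "\<dots> = (\<Sum>j\<in>T. (act (g j) (y k))^2)" by (rule sum.cong) (use g in auto)
      also have "\<dots> \<le> 1"
      proof (rule le)
        show "g j \<in> \<Phi> j" if "j \<in> T" for j using g[OF that] by blast
      qed (auto simp: T_def)
      finally show "(\<Sum>j\<in>{1..<n}. x j) \<le> 1" .
    qed (use bdd in \<open>auto simp: X_def\<close>)
    finally show ?thesis .
  qed
  obtain r J where rJ: "strict_mono (r :: nat \<Rightarrow> nat)"
    "\<And>F n. finite F \<Longrightarrow> (\<Sum>j\<in>{J..<n}. (\<Sum>k\<in>F. V (r k) j)^2) \<le> card F + \<epsilon> * (card F)^2"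
    by (rule l2_bounded_subseq_sum_tail[OF V0 V1 e]) (rule that)
  have "tail_sums_le \<Phi> (y \<circ> r) J \<epsilon>"
    unfolding tail_sums_le_def comp_apply
  proof (intro allI impI)
    fix F :: "nat set" and T :: "nat set" and g
    assume F: "finite F" and T: "finite T" "T \<subseteq> {1..}" "T \<subseteq> {J..}" and g: "\<forall>j\<in>T. g j \<in> \<Phi> j"
    obtain n where n: "T \<subseteq> {..<n}" using T(1) by (meson finite_nat_iff_bounded)
    have "(\<Sum>j\<in>T. (act (g j) (\<Sum>k\<in>F. y (r k)))^2) \<le> (\<Sum>j\<in>T. (\<Sum>k\<in>F. V (r k) j)^2)"
    proof (rule sum_mono)
      fix j assume j: "j \<in> T"
      have "\<bar>act (g j) (\<Sum>k\<in>F. y (r k))\<bar> \<le> (\<Sum>k\<in>F. \<bar>act (g j) (y (r k))\<bar>)"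
        by (simp add: act_sum_right)
      also have "\<dots> \<le> (\<Sum>k\<in>F. V (r k) j)" by (rule sum_mono) (use up g j T(2) in auto)
      finally have "\<bar>act (g j) (\<Sum>k\<in>F. y (r k))\<bar> \<le> \<bar>\<Sum>k\<in>F. V (r k) j\<bar>" by linarith
      then show "(act (g j) (\<Sum>k\<in>F. y (r k)))^2 \<le> (\<Sum>k\<in>F. V (r k) j)^2" by (simp only: abs_le_square_iff)
    qed
    also have "\<dots> \<le> (\<Sum>j\<in>{J..<n}. (\<Sum>k\<in>F. V (r k) j)^2)"
      by (rule sum_mono2) (use n T in auto)
    also have "\<dots> \<le> card F + \<epsilon> * (card F)^2" by (rule rJ(2)[OF F])
    finally show "(\<Sum>j\<in>T. (act (g j) (\<Sum>k\<in>F. y (r k)))^2) \<le> card F + \<epsilon> * (card F)^2" .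
  qed
  with rJ(1) show ?thesis by (rule that)
qed

definition block_seq :: "(nat \<Rightarrow> c00) \<Rightarrow> (nat \<Rightarrow> nat) \<Rightarrow> (nat \<Rightarrow> nat) \<Rightarrow> bool" where
  "block_seq y a b \<longleftrightarrow> (\<forall>k. a k < b k \<and> b k \<le> a (Suc k) \<and> supp (y k) \<subseteq> {a k<..b k})"

lemma block_seq_less:
  assumes "block_seq y a b" "k < l" shows "b k \<le> a l"
  using assms(2)
proof (induction l)
  case (Suc l)
  have "a l < b l" "b l \<le> a (Suc l)" using assms(1) by (auto simp: block_seq_def)
  then show ?case using Suc by (cases "k = l") auto
qed simp

lemma block_seq_block_less:
  assumes "block_seq y a b" "k < l" shows "block_less (y k) (y l)"
proof -
  have "supp (y k) \<subseteq> {a k<..b k}" "supp (y l) \<subseteq> {a l<..b l}" using assms(1) by (auto simp: block_seq_def)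
  then show ?thesis using block_seq_less[OF assms] unfolding block_less_def by fastforce
qed

lemma block_seq_subseq:
  assumes y: "block_seq y a b" and r: "strict_mono r"
  shows "block_seq (y \<circ> r) (a \<circ> r) (b \<circ> r)"
  using y block_seq_less[OF y strict_monoD[OF r lessI]] by (auto simp: block_seq_def)

definition chunk :: "nat \<Rightarrow> (nat \<Rightarrow> c00) \<Rightarrow> nat \<Rightarrow> c00" where
  "chunk N y k = (1 / real N) *\<^sub>R (\<Sum>i<N. y (k * N + i))"

lemma act_chunk: "act f (chunk N y k) = (1 / real N) * act f (\<Sum>i<N. y (k * N + i))"
  by (simp add: chunk_def act_scaleR_right)

lemma block_seq_chunk:
  assumes y: "block_seq y a b" and N: "1 \<le> N"
  shows "block_seq (chunk N y) (\<lambda>k. a (k * N)) (\<lambda>k. b (k * N + (N - 1)))"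
  unfolding block_seq_def
proof (intro allI conjI)
  fix k
  have ab: "a l < b l" for l using y by (simp add: block_seq_def)
  have am: "a l \<le> a l'" if "l \<le> l'" for l l'
    using that block_seq_less[OF y, of l l'] ab[of l] by (cases "l = l'") auto
  have bm: "b l \<le> b l'" if "l \<le> l'" for l l'
    using that block_seq_less[OF y, of l l'] ab[of l'] by (cases "l = l'") auto
  show "a (k * N) < b (k * N + (N - 1))" using am[of "k * N" "k * N + (N - 1)"] ab[of "k * N + (N - 1)"] by simp
  show "b (k * N + (N - 1)) \<le> a (Suc k * N)"
    by (rule block_seq_less[OF y]) (use N in simp)
  have "supp (\<Sum>i<N. y (k * N + i)) \<subseteq> (\<Union>i<N. supp (y (k * N + i)))" by (rule supp_sum_subset)
  also have "\<dots> \<subseteq> {a (k * N)<..b (k * N + (N - 1))}"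
  proof (rule UN_least)
    fix i assume "i \<in> {..<N}"
    then have "a (k * N) \<le> a (k * N + i)" "b (k * N + i) \<le> b (k * N + (N - 1))" by (auto intro: am bm)
    moreover have "supp (y (k * N + i)) \<subseteq> {a (k * N + i)<..b (k * N + i)}" using y by (simp add: block_seq_def)
    ultimately show "supp (y (k * N + i)) \<subseteq> {a (k * N)<..b (k * N + (N - 1))}" by fastforce
  qed
  finally show "supp (chunk N y k) \<subseteq> {a (k * N)<..b (k * N + (N - 1))}"
    by (auto simp: chunk_def)
qed

section \<open>Upper bounds and lower estimates under averaging\<close>

definition bounded_on :: "c00 set \<Rightarrow> real \<Rightarrow> (nat \<Rightarrow> c00) \<Rightarrow> bool" where
  "bounded_on K B y \<longleftrightarrow> (\<forall>k. \<forall>f\<in>K. \<bar>act f (y k)\<bar> \<le> B)"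

lemma bounded_on_chunk:
  assumes "bounded_on K B y" "1 \<le> N" shows "bounded_on K B (chunk N y)"
  unfolding bounded_on_def
proof (intro allI ballI)
  fix k f assume f: "f \<in> K"
  have "\<bar>act f (\<Sum>i<N. y (k * N + i))\<bar> \<le> (\<Sum>i<N. \<bar>act f (y (k * N + i))\<bar>)" by (simp add: act_sum_right)
  also have "\<dots> \<le> (\<Sum>i<N. B)" by (rule sum_mono) (use assms f in \<open>simp add: bounded_on_def\<close>)
  finally show "\<bar>act f (chunk N y k)\<bar> \<le> B"
    using assms(2) by (simp add: act_chunk abs_mult field_simps)
qed

lemma bounded_on_subseq: "bounded_on K B y \<Longrightarrow> bounded_on K B (y \<circ> r)"
  by (simp add: bounded_on_def)

text \<open>This is the part of the lower estimate of an \<open>\<ell>\<^sub>1\<close>-spreading model that survives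
  passing to averages of a fixed length.\<close>

definition large_sums :: "c00 set \<Rightarrow> real \<Rightarrow> (nat \<Rightarrow> c00) \<Rightarrow> bool" where
  "large_sums K \<delta> y \<longleftrightarrow> (\<forall>N\<ge>1. \<exists>n0. \<forall>F. finite F \<and> card F = N \<and> F \<subseteq> {n0..} \<longrightarrow>
     (\<exists>f\<in>K. \<delta> * real N \<le> \<bar>act f (\<Sum>k\<in>F. y k)\<bar>))"

lemma large_sumsE:
  assumes "large_sums K \<delta> y" "1 \<le> N"
  obtains n0 where "\<And>F. finite F \<Longrightarrow> card F = N \<Longrightarrow> F \<subseteq> {n0..} \<Longrightarrow>
    \<exists>f\<in>K. \<delta> * real N \<le> \<bar>act f (\<Sum>k\<in>F. y k)\<bar>"
proof -
  have "\<exists>n0. \<forall>F. finite F \<and> card F = N \<and> F \<subseteq> {n0..} \<longrightarrow>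
      (\<exists>f\<in>K. \<delta> * real N \<le> \<bar>act f (\<Sum>k\<in>F. y k)\<bar>)"
    using assms(1)[unfolded large_sums_def, rule_format, OF assms(2)] .
  then obtain n0 where n0: "\<forall>F. finite F \<and> card F = N \<and> F \<subseteq> {n0..} \<longrightarrow>
      (\<exists>f\<in>K. \<delta> * real N \<le> \<bar>act f (\<Sum>k\<in>F. y k)\<bar>)" ..
  show ?thesis by (rule that[of n0]) (use n0 in simp)
qed

lemma large_sums_subseq:
  assumes "large_sums K \<delta> y" "strict_mono r" shows "large_sums K \<delta> (y \<circ> r)"
  unfolding large_sums_def
proof (intro allI impI)
  fix N :: nat assume N: "1 \<le> N"
  obtain n0 where n0: "\<And>F. finite F \<Longrightarrow> card F = N \<Longrightarrow> F \<subseteq> {n0..} \<Longrightarrow> \<exists>f\<in>K. \<delta> * real N \<le> \<bar>act f (\<Sum>k\<in>F. y k)\<bar>"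
    by (rule large_sumsE[OF assms(1) N]) (rule that)
  have inj: "inj_on r F" for F by (rule strict_mono_imp_inj_on[OF assms(2)])
  show "\<exists>n0. \<forall>F. finite F \<and> card F = N \<and> F \<subseteq> {n0..} \<longrightarrow> (\<exists>f\<in>K. \<delta> * real N \<le> \<bar>act f (\<Sum>k\<in>F. (y \<circ> r) k)\<bar>)"
  proof (intro exI[of _ n0] allI impI)
    fix F assume F: "finite F \<and> card F = N \<and> F \<subseteq> {n0..}"
    have "r ` F \<subseteq> {n0..}"
    proof (rule image_subsetI)
      fix k assume "k \<in> F"
      then have "n0 \<le> k" using F by auto
      also have "k \<le> r k" by (rule strict_mono_imp_increasing[OF assms(2)])
      finally show "r k \<in> {n0..}" by simp
    qed
    then have "\<exists>f\<in>K. \<delta> * real N \<le> \<bar>act f (\<Sum>k\<in>r ` F. y k)\<bar>"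
      using F by (intro n0) (auto simp: card_image inj)
    then show "\<exists>f\<in>K. \<delta> * real N \<le> \<bar>act f (\<Sum>k\<in>F. (y \<circ> r) k)\<bar>"
      by (simp add: sum.reindex[OF inj])
  qed
qed

text \<open>A sum of M averages is, up to the factor 1/N, a sum of M N terms of the original
  sequence; the two normalizations cancel and \<open>\<delta>\<close> is unchanged.\<close>

lemma large_sums_chunk:
  assumes "large_sums K \<delta> y" "1 \<le> N" shows "large_sums K \<delta> (chunk N y)"
  unfolding large_sums_def
proof (intro allI impI)
  fix M :: nat assume "1 \<le> M"
  then have MN: "1 \<le> M * N" using assms(2) by simp
  obtain n0 where n0: "\<And>F. finite F \<Longrightarrow> card F = M * N \<Longrightarrow> F \<subseteq> {n0..} \<Longrightarrow>
      \<exists>f\<in>K. \<delta> * real (M * N) \<le> \<bar>act f (\<Sum>k\<in>F. y k)\<bar>"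
    by (rule large_sumsE[OF assms(1) MN]) (rule that)
  define h where "h = (\<lambda>(k, i). k * N + i)"
  show "\<exists>n0. \<forall>F. finite F \<and> card F = M \<and> F \<subseteq> {n0..} \<longrightarrow> (\<exists>f\<in>K. \<delta> * real M \<le> \<bar>act f (\<Sum>k\<in>F. chunk N y k)\<bar>)"
  proof (intro exI[of _ n0] allI impI)
    fix F assume F: "finite F \<and> card F = M \<and> F \<subseteq> {n0..}"
    have inj: "inj_on h (F \<times> {..<N})"
    proof (rule inj_onI, clarsimp simp: h_def)
      fix k i k' i' assume i: "i < N" "i' < N" and eq: "k * N + i = k' * N + i'"
      have "k = (k * N + i) div N" "k' = (k' * N + i') div N" using i by simp_all
      then have "k = k'" using eq by metis
      then show "k = k' \<and> i = i'" using eq by simp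
    qed
    have "n0 \<le> k * N + i" if "k \<in> F" for k i
    proof -
      have "n0 \<le> k" using F that by auto
      also have "k * 1 \<le> k * N" using assms(2) by (rule mult_le_mono2)
      finally show ?thesis by simp
    qed
    then have "h ` (F \<times> {..<N}) \<subseteq> {n0..}" by (auto simp: h_def)
    then obtain f where f: "f \<in> K" "\<delta> * real (M * N) \<le> \<bar>act f (\<Sum>k\<in>h ` (F \<times> {..<N}). y k)\<bar>"
      using n0[of "h ` (F \<times> {..<N})"] F by (auto simp: card_image[OF inj])
    have "(\<Sum>k\<in>h ` (F \<times> {..<N}). y k) = (\<Sum>k\<in>F. \<Sum>i<N. y (k * N + i))"
      unfolding sum.reindex[OF inj] by (simp add: sum.cartesian_product h_def comp_def case_prod_unfold)
    also have "\<dots> = real N *\<^sub>R (\<Sum>k\<in>F. chunk N y k)"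
      using assms(2) by (simp add: chunk_def scaleR_sum_right)
    finally have "\<delta> * real (M * N) \<le> real N * \<bar>act f (\<Sum>k\<in>F. chunk N y k)\<bar>"
      using f(2) by (simp add: act_scaleR_right abs_mult)
    then have "\<delta> * real M \<le> \<bar>act f (\<Sum>k\<in>F. chunk N y k)\<bar>" using assms(2) by (simp add: field_simps)
    then show "\<exists>f\<in>K. \<delta> * real M \<le> \<bar>act f (\<Sum>k\<in>F. chunk N y k)\<bar>" using f(1) by blast
  qed
qed

lemma large_sums_scale:
  assumes "large_sums K \<delta> y" "0 < c" shows "large_sums K (c * \<delta>) (\<lambda>k. c *\<^sub>R y k)"
  unfolding large_sums_def
proof (intro allI impI)
  fix N :: nat assume N: "1 \<le> N"
  obtain n0 where n0: "\<And>F. finite F \<Longrightarrow> card F = N \<Longrightarrow> F \<subseteq> {n0..} \<Longrightarrow>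
      \<exists>f\<in>K. \<delta> * real N \<le> \<bar>act f (\<Sum>k\<in>F. y k)\<bar>"
    by (rule large_sumsE[OF assms(1) N]) (rule that)
  have "\<exists>f\<in>K. c * \<delta> * real N \<le> \<bar>act f (\<Sum>k\<in>F. c *\<^sub>R y k)\<bar>" if F: "finite F \<and> card F = N \<and> F \<subseteq> {n0..}" for F
  proof -
    obtain f where f: "f \<in> K" "\<delta> * real N \<le> \<bar>act f (\<Sum>k\<in>F. y k)\<bar>" using n0[of F] F by blast
    have "c * (\<delta> * real N) \<le> c * \<bar>act f (\<Sum>k\<in>F. y k)\<bar>" using f(2) assms(2) by simp
    then show ?thesis
      using f(1) assms(2) by (intro bexI[of _ f])
        (simp_all add: scaleR_sum_right[symmetric] act_scaleR_right abs_mult mult.assoc)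
  qed
  then show "\<exists>n0. \<forall>F. finite F \<and> card F = N \<and> F \<subseteq> {n0..} \<longrightarrow>
      (\<exists>f\<in>K. c * \<delta> * real N \<le> \<bar>act f (\<Sum>k\<in>F. c *\<^sub>R y k)\<bar>)" by blast
qed

lemma bounded_on_scale:
  "bounded_on K B y \<Longrightarrow> 0 \<le> c \<Longrightarrow> bounded_on K (c * B) (\<lambda>k. c *\<^sub>R y k)"
  by (simp add: bounded_on_def act_scaleR_right abs_mult mult_left_mono)

lemma block_seq_scale: "block_seq y a b \<Longrightarrow> block_seq (\<lambda>k. c *\<^sub>R y k) a b"
  by (simp add: block_seq_def)

section \<open>Halving the norm by averaging\<close>

text \<open>By Cauchy-Schwarz the square of an average is at most the average of the squares, so
  square sum bounds survive further averaging.\<close>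

lemma sum_squares_chunk_le:
  assumes "1 \<le> N" and le: "\<And>l. (\<Sum>j\<in>T. (act (g j) (y l))^2) \<le> B"
  shows "(\<Sum>j\<in>T. (act (g j) (chunk N y k))^2) \<le> B"
proof -
  have "(\<Sum>j\<in>T. (act (g j) (chunk N y k))^2) \<le> (\<Sum>j\<in>T. (1 / real N) * (\<Sum>i<N. (act (g j) (y (k * N + i)))^2))"
  proof (rule sum_mono)
    fix j
    have "(act (g j) (chunk N y k))^2 = (1 / real N)^2 * (\<Sum>i<N. 1 * act (g j) (y (k * N + i)))^2"
      by (simp add: act_chunk act_sum_right power_mult_distrib power_divide)
    also have "\<dots> \<le> (1 / real N)^2 * ((\<Sum>i<N. 1^2) * (\<Sum>i<N. (act (g j) (y (k * N + i)))^2))"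
      by (intro mult_left_mono Cauchy_Schwarz_ineq_sum) simp
    also have "\<dots> = (1 / real N) * (\<Sum>i<N. (act (g j) (y (k * N + i)))^2)"
      using assms(1) by (simp add: power2_eq_square)
    finally show "(act (g j) (chunk N y k))^2 \<le> (1 / real N) * (\<Sum>i<N. (act (g j) (y (k * N + i)))^2)" .
  qed
  also have "\<dots> = (1 / real N) * (\<Sum>i<N. \<Sum>j\<in>T. (act (g j) (y (k * N + i)))^2)"
    unfolding sum_distrib_left[symmetric] by (subst sum.swap) simp
  also have "\<dots> \<le> (1 / real N) * (\<Sum>i<N. B)"
    by (intro mult_left_mono sum_mono le) simp
  also have "\<dots> = B" using assms(1) by simp
  finally show ?thesis .
qed

locale attractor_norm = special_sequences +
  fixes N1 :: "nat set" and \<Lambda> :: "nat \<Rightarrow> nat set" and \<sigma> :: "c00 list \<Rightarrow> nat"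
begin

abbreviation G :: "c00 set" where "G \<equiv> G_set S M1 \<sigma>1"
abbreviation K :: "c00 set" where "K \<equiv> K_set G N1 \<Lambda> \<sigma>"

lemma G_subset_K: "G \<subseteq> K"
  using K_closed_K_set[of G N1 \<Lambda> \<sigma>] unfolding K_closed_def by (elim conjE)

lemma K_minus: "f \<in> K \<Longrightarrow> - f \<in> K"
  using K_closed_K_set[of G N1 \<Lambda> \<sigma>] unfolding K_closed_def by (elim conjE) (rule bspec)

lemma K_restrict: "f \<in> K \<Longrightarrow> nat_interval E \<Longrightarrow> restrict E f \<in> K"
proof -
  have "\<forall>f\<in>K. \<forall>E. nat_interval E \<longrightarrow> restrict E f \<in> K"
    using K_closed_K_set[of G N1 \<Lambda> \<sigma>] unfolding K_closed_def by (elim conjE)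
  then show "f \<in> K \<Longrightarrow> nat_interval E \<Longrightarrow> restrict E f \<in> K" by blast
qed

lemma unit_vec_in_K: "1 \<le> n \<Longrightarrow> unit_vec n \<in> K"
  using G_subset_K by (auto simp: G_set_def G0_set_def)

lemma Gl2_in_K: "g \<in> Gl2_set S M1 \<sigma>1 \<Longrightarrow> g \<in> K"
  using G_subset_K by (auto simp: G_set_def)

text \<open>Dual form of the l2-rule of the norming set: functionals of different weights may be
  combined, as \<open>nseq\<close> is strictly increasing.\<close>

lemma op_squares_le_one:
  assumes x: "\<And>f. f \<in> K \<Longrightarrow> \<bar>act f x\<bar> \<le> 1"
    and T: "finite T" "T \<subseteq> {1..}" and g: "\<And>j. j \<in> T \<Longrightarrow> g j \<in> K \<inter> op_results K j"
  shows "(\<Sum>j\<in>T. (act (g j) x)^2) \<le> 1"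
proof -
  have "(\<Sum>j\<in>T. (act (g j) x)^2) \<le> 1^2"
  proof (rule sum_squares_le_of_rational_dual[OF T(1)])
    fix c :: "nat \<Rightarrow> real" assume c: "\<And>j. c j \<in> \<rat>" "(\<Sum>j\<in>T. (c j)^2) \<le> 1"
    have rule4: "\<forall>(A :: nat set) (c :: nat \<Rightarrow> real) f js. finite A \<and>
        (\<forall>i\<in>A. js i \<ge> 1 \<and> f i \<in> K \<and> f i \<in> op_results K (js i) \<and> c i \<in> \<rat>) \<and>
        (\<forall>i\<in>A. \<forall>k\<in>A. i \<noteq> k \<longrightarrow> nseq (js i) \<noteq> nseq (js k)) \<and> (\<Sum>i\<in>A. (c i)^2) \<le> 1 \<longrightarrow>
        (\<Sum>i\<in>A. c i *\<^sub>R f i) \<in> K"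
      using K_closed_K_set[of G N1 \<Lambda> \<sigma>] unfolding K_closed_def by (elim conjE)
    have neq: "nseq i \<noteq> nseq k" if "i \<in> T" "k \<in> T" "i \<noteq> k" for i k
    proof -
      have "1 \<le> i" "1 \<le> k" using that T(2) by auto
      then show ?thesis using nseq_strict_mono[of i k] nseq_strict_mono[of k i] that(3)
        by (cases i k rule: linorder_cases) auto
    qed
    have "(\<Sum>j\<in>T. c j *\<^sub>R g j) \<in> K"
      by (rule mp[OF rule4[THEN spec[of _ T], THEN spec[of _ c], THEN spec[of _ g], THEN spec[of _ "\<lambda>j. j"]]])
        (use T g c neq in auto)
    then have "\<bar>act (\<Sum>j\<in>T. c j *\<^sub>R g j) x\<bar> \<le> 1" by (rule x)
    then show "(\<Sum>j\<in>T. c j * act (g j) x) \<le> 1" by (simp add: act_sum_left act_scaleR_left)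
  qed simp
  then show ?thesis by simp
qed

lemma G1_squares_le_one:
  assumes x: "\<And>f. f \<in> K \<Longrightarrow> \<bar>act f x\<bar> \<le> 1"
    and T: "finite T" "T \<subseteq> {1..}" and g: "\<And>j. j \<in> T \<Longrightarrow> g j \<in> G1_level j"
  shows "(\<Sum>j\<in>T. (act (g j) x)^2) \<le> 1"
proof -
  have "(\<Sum>j\<in>T. (act (g j) x)^2) \<le> 1^2"
  proof (rule Gl2_squares_le[of S M1 \<sigma>1 x 1 T g "\<lambda>j. {j}"])
    show "has_ind S M1 \<sigma>1 (g j) {j}" if "j \<in> T" for j
      using g[OF that] T(2) that unfolding has_ind_def by auto
  qed (use x Gl2_in_K T in \<open>auto simp: disjoint_family_on_def\<close>)
  then show ?thesis by simp
qed

lemma G1_level_in_K: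
  assumes "1 \<le> j" "f \<in> G1_level j" shows "f \<in> K"
  using G_subset_K assms by (auto simp: G_set_def G1_set_def)

text \<open>A functional of a fixed level has bounded support and meets boundedly many blocks, so
  the finitely many low levels contribute a constant to long sums. The high levels are almost
  orthogonal along a subsequence.\<close>

lemma G1_small_chunks:
  assumes y: "block_seq y a b" and bd: "bounded_on K 1 y" and e: "0 < (\<tau>::real)"
  shows "\<exists>r N. strict_mono (r :: nat \<Rightarrow> nat) \<and> 1 \<le> N \<and>
    (\<forall>k T g. finite T \<longrightarrow> T \<subseteq> {1..} \<longrightarrow> (\<forall>j\<in>T. g j \<in> G1_level j) \<longrightarrow>
      (\<Sum>j\<in>T. (act (g j) (chunk N (y \<circ> r) k))^2) \<le> \<tau>^2)"
proof -
  have e3: "0 < \<tau>^2 / 3" using e by simp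
  have bd1: "\<bar>act f (y k)\<bar> \<le> 1" if "f \<in> K" for f k using bd that by (simp add: bounded_on_def)
  obtain r :: "nat \<Rightarrow> nat" and J where r: "strict_mono r" and tail: "tail_sums_le G1_level (y \<circ> r) J (\<tau>^2 / 3)"
  proof (rule level_sums_subseq[of G1_level y "\<tau>^2 / 3"])
    show "(\<Sum>j\<in>T. (act (g j) (y k))^2) \<le> 1"
      if "finite T" "T \<subseteq> {1..}" "\<And>j. j \<in> T \<Longrightarrow> g j \<in> G1_level j" for k T g
      using bd1 that by (rule G1_squares_le_one)
  qed (rule e3, rule that)
  \<comment> \<open>A bound, independent of \<open>N\<close>, for the total of the levels below
    \<open>J\<close> on a sum of blocks.\<close>
  define C where "C = (\<Sum>j<J. (real (nseq (2 * j - 1)))^2)"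
  have C0: "0 \<le> C" by (simp add: C_def sum_nonneg)
  \<comment> \<open>This size makes \<open>(C + 1) / N\<close> at most a third of
    \<open>\<tau>^2\<close>; it covers the low levels and the diagonal, and the almost orthogonal
    part adds another third.\<close>
  obtain N :: nat where N: "3 * (C + 1) / \<tau>^2 + 1 < N" using reals_Archimedean2 by blast
  have "0 \<le> 3 * (C + 1) / \<tau>^2" using C0 by simp
  then have N1: "1 < real N" using N by linarith
  have "3 * (C + 1) / \<tau>^2 \<le> N" using N by linarith
  then have N2: "(C + 1) / N \<le> \<tau>^2 / 3" using N1 e by (simp add: field_simps)
  have main: "(\<Sum>j\<in>T. (act (g j) (chunk N (y \<circ> r) k))^2) \<le> \<tau>^2"
    if T: "finite T" "T \<subseteq> {1..}" and g: "\<And>j. j \<in> T \<Longrightarrow> g j \<in> G1_level j" for k T g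
  proof -
    define u where "u i = y (r (k * N + i))" for i
    have blk: "block_less (u i) (u i')" if "i < i'" for i i'
      unfolding u_def by (rule block_seq_block_less[OF y]) (use r that in \<open>simp add: strict_mono_less\<close>)
    have eq: "(act (g j) (chunk N (y \<circ> r) k))^2 = (1 / real N)^2 * (act (g j) (\<Sum>i<N. u i))^2" for j
      by (simp add: act_chunk u_def power_mult_distrib power_divide)
    have low: "(\<Sum>j\<in>T \<inter> {..<J}. (act (g j) (\<Sum>i<N. u i))^2) \<le> C"
    proof -
      have "(\<Sum>j\<in>T \<inter> {..<J}. (act (g j) (\<Sum>i<N. u i))^2) \<le> (\<Sum>j\<in>T \<inter> {..<J}. (real (nseq (2 * j - 1)))^2)"
      proof (rule sum_mono)
        fix j assume j: "j \<in> T \<inter> {..<J}"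
        then have j1: "1 \<le> j" and gj: "g j \<in> G1_level j" using T(2) g by auto
        have "\<bar>act (g j) (\<Sum>i<N. u i)\<bar> \<le> real (card (supp (g j)))"
          by (rule abs_act_block_sum_le) (use blk bd1 G1_level_in_K[OF j1 gj] in \<open>auto simp: u_def\<close>)
        also have "\<dots> \<le> real (nseq (2 * j - 1))" using gj G1_level_iff[OF j1] by simp
        finally have "\<bar>act (g j) (\<Sum>i<N. u i)\<bar> \<le> \<bar>real (nseq (2 * j - 1))\<bar>" by simp
        then show "(act (g j) (\<Sum>i<N. u i))^2 \<le> (real (nseq (2 * j - 1)))^2" by (simp only: abs_le_square_iff)
      qed
      also have "\<dots> \<le> C" unfolding C_def by (rule sum_mono2) auto
      finally show ?thesis .
    qed
    have inj: "inj_on (\<lambda>i. k * N + i) {..<N}" by (rule inj_onI) simp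
    have high: "(\<Sum>j\<in>T \<inter> {J..}. (act (g j) (\<Sum>i<N. u i))^2) \<le> real N + (\<tau>^2 / 3) * (real N)^2"
    proof -
      have "(\<Sum>l\<in>(\<lambda>i. k * N + i) ` {..<N}. y (r l)) = (\<Sum>i<N. u i)"
        unfolding sum.reindex[OF inj] by (simp add: u_def)
      moreover have "(\<Sum>j\<in>T \<inter> {J..}. (act (g j) (\<Sum>l\<in>(\<lambda>i. k * N + i) ` {..<N}. y (r l)))^2) \<le>
          card ((\<lambda>i. k * N + i) ` {..<N}) + (\<tau>^2 / 3) * (card ((\<lambda>i. k * N + i) ` {..<N}))^2"
        by (rule tail[unfolded tail_sums_le_def comp_apply, rule_format]) (use T g in auto)
      ultimately show ?thesis by (simp add: card_image[OF inj])
    qed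
    have "(\<Sum>j\<in>T. (act (g j) (\<Sum>i<N. u i))^2) =
        (\<Sum>j\<in>T \<inter> {..<J}. (act (g j) (\<Sum>i<N. u i))^2) + (\<Sum>j\<in>T \<inter> {J..}. (act (g j) (\<Sum>i<N. u i))^2)"
      by (subst sum.union_disjoint[symmetric]) (use T(1) in \<open>auto intro!: sum.cong\<close>)
    then have "(\<Sum>j\<in>T. (act (g j) (\<Sum>i<N. u i))^2) \<le> C + (real N + (\<tau>^2 / 3) * (real N)^2)"
      using low high by linarith
    then have "(1 / real N)^2 * (\<Sum>j\<in>T. (act (g j) (\<Sum>i<N. u i))^2) \<le>
        (1 / real N)^2 * (C + (real N + (\<tau>^2 / 3) * (real N)^2))"
      by (rule mult_left_mono) simp
    also have "\<dots> = C / (real N)^2 + 1 / real N + \<tau>^2 / 3"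
      using N1 by (simp add: field_simps power2_eq_square)
    also have "C / (real N)^2 \<le> C / real N"
      using N1 C0 by (intro divide_left_mono) (auto simp: power2_eq_square)
    also have "C / real N + 1 / real N + \<tau>^2 / 3 \<le> \<tau>^2"
      using N2 e3 unfolding add_divide_distrib by linarith
    finally show ?thesis by (simp add: eq sum_distrib_left)
  qed
  show ?thesis
  proof (intro exI[of _ r] exI[of _ N] conjI allI impI)
    fix k T g
    assume "finite T" "T \<subseteq> {1..}" "\<forall>j\<in>T. g j \<in> G1_level j"
    then show "(\<Sum>j\<in>T. (act (g j) (chunk N (y \<circ> r) k))^2) \<le> \<tau>^2" by (intro main) auto
  qed (use r N1 in auto)
qed

text \<open>The summands of an element of \<open>Gl2_set\<close> fall into level functionals and
  special functionals. Each kind has square sum at most 1/8, together \<open>(1 / 2)^2\<close>, and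
  Cauchy-Schwarz gives the bound.\<close>

lemma ground_part_le_half:
  assumes T: "\<And>T g. finite T \<Longrightarrow> T \<subseteq> {1..} \<Longrightarrow> (\<And>j. j \<in> T \<Longrightarrow> g j \<in> G1_level j) \<Longrightarrow>
      (\<Sum>j\<in>T. (act (g j) x)^2) \<le> 1 / 8"
    and sp: "\<And>(I :: nat set) E e fs. special_family I E e fs \<Longrightarrow>
      (\<Sum>i\<in>I. (act (sp_fun (E i) (e i) (fs i)) x)^2) \<le> 1 / 8"
    and unit: "\<And>n. \<bar>coord x n\<bar> \<le> 1 / 2"
    and g: "g \<in> G" and D: "nat_interval D"
  shows "\<bar>act (restrict D g) x\<bar> \<le> 1 / 2"
proof -
  have fam: "\<bar>act (restrict D (\<Sum>i<d. a i *\<^sub>R \<phi> i)) x\<bar> \<le> 1 / 2"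
    if a: "(\<Sum>i<d. (a i)^2) \<le> 1" and h: "\<And>i. i < d \<Longrightarrow> has_ind S M1 \<sigma>1 (\<phi> i) (J i)"
      and dis: "disjoint_family_on J {..<d}" for d :: nat and a \<phi> J
  proof -
    define z where "z i = act (restrict D (\<phi> i)) x" for i
    define I1 where "I1 = {i \<in> {..<d}. \<exists>j\<ge>1. \<phi> i \<in> G1_level j \<and> J i = {j}}"
    define I1' where "I1' = {i \<in> I1. restrict D (\<phi> i) \<noteq> 0}"
    \<comment> \<open>Summands admitting both descriptions are counted with the level functionals in
      \<open>I1\<close>.\<close>
    define I2 where "I2 = {..<d} - I1"
    have "\<forall>i\<in>I1. \<exists>j. 1 \<le> j \<and> \<phi> i \<in> G1_level j \<and> J i = {j}" by (auto simp: I1_def)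
    then obtain j where j: "\<And>i. i \<in> I1 \<Longrightarrow> 1 \<le> j i \<and> \<phi> i \<in> G1_level (j i) \<and> J i = {j i}" by metis
    have inj: "inj_on j I1'"
    proof (rule inj_onI, rule ccontr)
      fix i i' assume i: "i \<in> I1'" "i' \<in> I1'" "j i = j i'" "i \<noteq> i'"
      have "J i \<inter> J i' = {}" by (rule disjoint_family_onD[OF dis]) (use i in \<open>auto simp: I1'_def I1_def\<close>)
      then show False using j[of i] j[of i'] i by (auto simp: I1'_def)
    qed
    define \<gamma> where "\<gamma> t = restrict D (\<phi> (the_inv_into I1' j t))" for t
    have \<gamma>: "\<gamma> (j i) = restrict D (\<phi> i)" if "i \<in> I1'" for i
      using the_inv_into_f_f[OF inj that] by (simp add: \<gamma>_def)
    have fin1: "finite I1'" by (simp add: I1'_def I1_def)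
    have "(\<Sum>i\<in>I1. (z i)^2) = (\<Sum>i\<in>I1'. (z i)^2)"
      by (rule sum.mono_neutral_right) (auto simp: I1'_def I1_def z_def)
    also have "\<dots> = (\<Sum>i\<in>I1'. (act (\<gamma> (j i)) x)^2)"
      by (rule sum.cong) (auto simp: z_def \<gamma>)
    also have "\<dots> = (\<Sum>t\<in>j ` I1'. (act (\<gamma> t) x)^2)" by (simp add: sum.reindex[OF inj])
    also have "\<dots> \<le> 1 / 8"
    proof (rule T)
      fix t assume "t \<in> j ` I1'"
      then obtain i where i: "i \<in> I1'" "t = j i" by blast
      then have "i \<in> I1" "restrict D (\<phi> i) \<noteq> 0" by (auto simp: I1'_def)
      then show "\<gamma> t \<in> G1_level t" using G1_level_restrict j \<gamma>[OF i(1)] i(2) by auto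
    qed (use fin1 j in \<open>auto simp: I1'_def\<close>)
    finally have s1: "(\<Sum>i\<in>I1. (z i)^2) \<le> 1 / 8" .
    have "\<exists>E e fs. special fs \<and> (\<forall>m<length fs. e m \<in> {-1, 1}) \<and> nat_interval E \<and>
        \<phi> i = sp_fun E e fs \<and> J i = sp_ind E fs" if "i \<in> I2" for i
      using h[of i] that unfolding has_ind_iff I2_def I1_def by auto
    then obtain E e fs where E: "\<And>i. i \<in> I2 \<Longrightarrow> special (fs i) \<and> (\<forall>m<length (fs i). e i m \<in> {-1, 1}) \<and>
        nat_interval (E i) \<and> \<phi> i = sp_fun (E i) (e i) (fs i) \<and> J i = sp_ind (E i) (fs i)"
      by metis
    have "special_family I2 (\<lambda>i. D \<inter> E i) e fs"
      unfolding special_family_def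
    proof (intro conjI ballI)
      show "disjoint_family_on (\<lambda>i. sp_ind (D \<inter> E i) (fs i)) I2"
        unfolding disjoint_family_on_def
      proof (intro ballI impI)
        fix i i' assume i: "i \<in> I2" "i' \<in> I2" "i \<noteq> i'"
        have "J i \<inter> J i' = {}" by (rule disjoint_family_onD[OF dis]) (use i in \<open>auto simp: I2_def\<close>)
        moreover have "sp_ind (D \<inter> E k) (fs k) \<subseteq> J k" if "k \<in> I2" for k
          using E[OF that] sp_ind_mono[of "D \<inter> E k" "E k"] by simp
        ultimately show "sp_ind (D \<inter> E i) (fs i) \<inter> sp_ind (D \<inter> E i') (fs i') = {}" using i by blast
      qed
    qed (use E D in \<open>auto simp: I2_def\<close>)
    then have "(\<Sum>i\<in>I2. (act (sp_fun (D \<inter> E i) (e i) (fs i)) x)^2) \<le> 1 / 8" by (rule sp)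
    moreover have "(\<Sum>i\<in>I2. (z i)^2) = (\<Sum>i\<in>I2. (act (sp_fun (D \<inter> E i) (e i) (fs i)) x)^2)"
      by (rule sum.cong) (use E in \<open>auto simp: z_def restrict_sp_fun\<close>)
    moreover have "(\<Sum>i<d. (z i)^2) = (\<Sum>i\<in>I2. (z i)^2) + (\<Sum>i\<in>I1. (z i)^2)"
      unfolding I2_def by (rule sum.subset_diff) (auto simp: I1_def)
    ultimately have z: "(\<Sum>i<d. (z i)^2) \<le> (1 / 2)^2" using s1 by (simp add: power2_eq_square)
    have "(act (restrict D (\<Sum>i<d. a i *\<^sub>R \<phi> i)) x)^2 = (\<Sum>i<d. a i * z i)^2"
      by (simp add: restrict_sum restrict_scaleR act_sum_left act_scaleR_left z_def)
    also have "\<dots> \<le> (\<Sum>i<d. (a i)^2) * (\<Sum>i<d. (z i)^2)" by (rule Cauchy_Schwarz_ineq_sum)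
    also have "\<dots> \<le> 1 * (1 / 2)^2" by (intro mult_mono a z) (auto intro: sum_nonneg)
    finally show ?thesis by (simp add: abs_le_square_iff[symmetric])
  qed
  have one: "\<bar>act (restrict D g) x\<bar> \<le> 1 / 2" if "has_ind S M1 \<sigma>1 g J" for J
    using fam[of "\<lambda>_. 1" 1 "\<lambda>_. g" "\<lambda>_. J"] that by (simp add: disjoint_family_on_def)
  consider "g \<in> G0_set" | "g \<in> G1_set" | "g \<in> Gsp_set S M1 \<sigma>1" | "g \<in> Gl2_set S M1 \<sigma>1"
    using g by (auto simp: G_set_def)
  then show ?thesis
  proof cases
    case 1
    then obtain n where "g = unit_vec n \<or> g = - unit_vec n" by (auto simp: G0_set_def)
    moreover have "\<bar>act (unit_vec n) (restrict D x)\<bar> \<le> 1 / 2"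
      using unit[of n] by (subst act_commute) (simp add: act_unit_vec)
    ultimately show ?thesis by (auto simp: act_restrict act_minus_left)
  next
    case 2
    then obtain j where "1 \<le> j" "g \<in> G1_level j" by (auto simp: G1_set_def)
    then have "has_ind S M1 \<sigma>1 g {j}" unfolding has_ind_def by blast
    then show ?thesis by (rule one)
  next
    case 3
    then have "\<exists>J. has_ind S M1 \<sigma>1 g J" unfolding has_ind_def Gsp_set_def by blast
    then show ?thesis using one by blast
  next
    case 4
    then obtain d :: nat and a \<phi> J where "g = (\<Sum>i<d. a i *\<^sub>R \<phi> i)" "(\<Sum>i<d. (a i)^2) \<le> 1"
      "\<forall>i<d. has_ind S M1 \<sigma>1 (\<phi> i) (J i)" "disjoint_family_on J {..<d}"
      unfolding Gl2_set_def by blast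
    then show ?thesis using fam[of a d \<phi> J] by simp
  qed
qed

text \<open>The mass on finitely many weights is damped by the factors \<open>1 / mseq j\<close>; since the rule
  for combinations of different weights is an \<open>\<ell>\<^sub>2\<close>-rule, the remaining weights act almost
  orthogonally along a subsequence.\<close>

lemma halving:
  assumes y: "block_seq y a b" and bd: "bounded_on K 1 y" and low: "large_sums K \<delta> y"
  shows "\<exists>y' a' b'. block_seq y' a' b' \<and> bounded_on K (1 / 2) y' \<and> large_sums K \<delta> y'"
proof -
  \<comment> \<open>Chosen so that the special part \<open>1 / real N + 4 * \<tau>\<close> is at
    most 1/16 + 1/16 = 1/8.\<close>
  define \<tau> where "\<tau> = (1 / 64 :: real)"
  have "0 < \<tau>" by (simp add: \<tau>_def)
  from G1_small_chunks[OF y bd this] obtain r1 N1' where r1: "strict_mono (r1 :: nat \<Rightarrow> nat)" "1 \<le> N1'"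
    and G1': "\<forall>k T g. finite T \<longrightarrow> T \<subseteq> {1..} \<longrightarrow> (\<forall>j\<in>T. g j \<in> G1_level j) \<longrightarrow>
      (\<Sum>j\<in>T. (act (g j) (chunk N1' (y \<circ> r1) k))^2) \<le> \<tau>^2"
    by (elim exE conjE) (rule that)
  have G1: "(\<Sum>j\<in>T. (act (g j) (chunk N1' (y \<circ> r1) k))^2) \<le> \<tau>^2"
    if "finite T" "T \<subseteq> {1..}" "\<And>j. j \<in> T \<Longrightarrow> g j \<in> G1_level j" for k T g
    by (rule G1'[rule_format]) (use that in auto)
  define y1 where "y1 = chunk N1' (y \<circ> r1)"
  define a1 where "a1 k = (a \<circ> r1) (k * N1')" for k
  define b1 where "b1 k = (b \<circ> r1) (k * N1' + (N1' - 1))" for k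
  have y1: "block_seq y1 a1 b1"
    using block_seq_chunk[OF block_seq_subseq[OF y r1(1)] r1(2)] unfolding y1_def a1_def b1_def .
  have bd1: "bounded_on K 1 y1"
    unfolding y1_def by (rule bounded_on_chunk[OF bounded_on_subseq[OF bd] r1(2)])
  have low1: "large_sums K \<delta> y1"
    unfolding y1_def by (rule large_sums_chunk[OF large_sums_subseq[OF low r1(1)] r1(2)])
  interpret sb: special_blocks S M1 M2 \<sigma>1 y1 a1 b1 \<tau>
  proof unfold_locales
    fix k g assume "g \<in> Gl2_set S M1 \<sigma>1"
    then show "\<bar>act g (y1 k)\<bar> \<le> 1" using bd1 Gl2_in_K by (simp add: bounded_on_def)
  next
    fix k T g assume "finite T" "T \<subseteq> {1..}" "\<And>j. j \<in> T \<Longrightarrow> g j \<in> G1_level j"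
    then show "(\<Sum>j\<in>T. (act (g j) (y1 k))^2) \<le> \<tau>^2" unfolding y1_def by (rule G1)
  qed (use y1 in \<open>auto simp: block_seq_def \<tau>_def\<close>)
  obtain r2 :: "nat \<Rightarrow> nat" where r2: "strict_mono r2"
    and sp: "\<And>F (I :: nat set) E e fs. finite F \<Longrightarrow> special_family I E e fs \<Longrightarrow>
      (\<Sum>i\<in>I. (\<Sum>k\<in>F. act (sp_fun (E i) (e i) (fs i)) (y1 (r2 k)))^2) \<le> card F + 4 * \<tau> * (card F)^2"
    by (rule sb.special_sums_subseq) (rule that)
  define y2 where "y2 = y1 \<circ> r2"
  have bd2: "\<bar>act f (y2 k)\<bar> \<le> 1" if "f \<in> K" for f k using bd1 that by (simp add: bounded_on_def y2_def)
  obtain r3 :: "nat \<Rightarrow> nat" and J where r3: "strict_mono r3"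
    and tail: "tail_sums_le (\<lambda>j. K \<inter> op_results K j) (y2 \<circ> r3) J (1 / 256)"
  proof (rule level_sums_subseq[of "\<lambda>j. K \<inter> op_results K j" y2 "1 / 256"])
    show "(\<Sum>j\<in>T. (act (g j) (y2 k))^2) \<le> 1"
      if "finite T" "T \<subseteq> {1..}" "\<And>j. j \<in> T \<Longrightarrow> g j \<in> K \<inter> op_results K j" for k T g
      using bd2 that by (rule op_squares_le_one)
  qed (simp, rule that)
  define r where "r = r2 \<circ> r3"
  have r: "strict_mono r" unfolding r_def by (rule strict_mono_o[OF r2 r3])
  define y3 where "y3 = y1 \<circ> r"
  have y3: "block_seq y3 (a1 \<circ> r) (b1 \<circ> r)" unfolding y3_def by (rule block_seq_subseq[OF y1 r])
  have bd3: "bounded_on K 1 y3" unfolding y3_def by (rule bounded_on_subseq[OF bd1])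
  \<comment> \<open>At least 16, and at least \<open>nseq j\<close> for every low \<open>j\<close>,
    so that low weights give at most \<open>2 * real N / real (mseq j)\<close> on a sum of
    \<open>N\<close> blocks.\<close>
  define N where "N = 16 + (\<Sum>j<J. nseq j)"
  have "16 \<le> N" by (simp add: N_def)
  then have N8: "16 \<le> real N" by linarith
  have Nj: "nseq j \<le> N" if "j < J" for j
    using member_le_sum[of j "{..<J}" nseq] that by (simp add: N_def)
  have small: "1 / real N \<le> 1 / 16" using N8 by (simp add: field_simps)
  have "\<bar>act f (chunk N y3 k)\<bar> \<le> 1 / 2" if "f \<in> K" for f k
  proof -
    define u where "u i = y3 (k * N + i)" for i
    have inj: "inj_on (\<lambda>i. k * N + i) {..<N}" by (rule inj_onI) simp
    have blk: "block_less (u i) (u i')" if "i < i'" for i i'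
      unfolding u_def by (rule block_seq_block_less[OF y3]) (use that in simp)
    have ub: "\<bar>act f (u i)\<bar> \<le> 1" if "f \<in> K" for f i using bd3 that by (simp add: bounded_on_def u_def)
    have chunk: "act f (chunk N y3 k) = (1 / real N) * act f (\<Sum>i<N. u i)" for f
      by (simp add: act_chunk u_def)
    have sq: "(1 / real N)^2 * (real N + c * (real N)^2) = 1 / real N + c" for c
      using N8 by (simp add: field_simps power2_eq_square)
    from that show ?thesis
    proof (induction rule: K_set_induct)
      case (minus f)
      then show ?case by (simp add: act_minus_left)
    next
      case (ground g E)
      show ?case
      proof (rule ground_part_le_half[OF _ _ _ ground])
        fix T g assume T: "finite T" "T \<subseteq> {1..}" "\<And>j. j \<in> T \<Longrightarrow> g j \<in> G1_level j"
        have "(\<Sum>j\<in>T. (act (g j) (chunk N y3 k))^2) \<le> \<tau>^2"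
        proof (rule sum_squares_chunk_le)
          show "(\<Sum>j\<in>T. (act (g j) (y3 l))^2) \<le> \<tau>^2" for l
            using G1[OF T] by (simp add: y3_def y1_def)
        qed (use N8 in simp)
        then show "(\<Sum>j\<in>T. (act (g j) (chunk N y3 k))^2) \<le> 1 / 8"
          by (simp add: \<tau>_def power2_eq_square)
      next
        fix I :: "nat set" and E e fs assume fam: "special_family I E e fs"
        \<comment> \<open>The estimate \<open>sp\<close> is stated along \<open>r2\<close>, so the
          positions occupied by this average are transported through \<open>r3\<close>.\<close>
        define F where "F = (\<lambda>i. r3 (k * N + i)) ` {..<N}"
        have injF: "inj_on (\<lambda>i. r3 (k * N + i)) {..<N}"
          by (rule inj_onI) (use r3 in \<open>simp add: strict_mono_eq\<close>)
        have F: "finite F" "card F = N" by (simp_all add: F_def card_image[OF injF])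
        have "(\<Sum>l\<in>F. act g (y1 (r2 l))) = act g (\<Sum>i<N. u i)" for g
          unfolding F_def sum.reindex[OF injF] by (simp add: act_sum_right u_def y3_def r_def)
        then have "(\<Sum>i\<in>I. (act (sp_fun (E i) (e i) (fs i)) (\<Sum>i<N. u i))^2) \<le> real N + 4 * \<tau> * (real N)^2"
          using sp[OF F(1) fam] F(2) by simp
        then have "(1 / real N)^2 * (\<Sum>i\<in>I. (act (sp_fun (E i) (e i) (fs i)) (\<Sum>i<N. u i))^2) \<le>
            (1 / real N)^2 * (real N + 4 * \<tau> * (real N)^2)"
          by (rule mult_left_mono) simp
        then have "(\<Sum>i\<in>I. (act (sp_fun (E i) (e i) (fs i)) (chunk N y3 k))^2) \<le> 1 / real N + 4 * \<tau>"
          unfolding sq chunk power_mult_distrib sum_distrib_left .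
        then show "(\<Sum>i\<in>I. (act (sp_fun (E i) (e i) (fs i)) (chunk N y3 k))^2) \<le> 1 / 8"
          using small by (simp add: \<tau>_def)
      next
        fix n
        show "\<bar>coord (chunk N y3 k) n\<bar> \<le> 1 / 2"
        proof (cases "n = 0")
          case False
          have "supp (unit_vec n) \<subseteq> {n}" by (auto simp: supp_def)
          then have "card (supp (unit_vec n)) \<le> 1" using card_mono[of "{n}"] by fastforce
          moreover have "\<bar>act (unit_vec n) (\<Sum>i<N. u i)\<bar> \<le> card (supp (unit_vec n))"
            by (rule abs_act_block_sum_le) (use blk ub unit_vec_in_K False in auto)
          ultimately have "\<bar>act (unit_vec n) (\<Sum>i<N. u i)\<bar> \<le> 1" by linarith
          then have "(1 / real N) * \<bar>act (unit_vec n) (\<Sum>i<N. u i)\<bar> \<le> (1 / real N) * 1"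
            by (rule mult_left_mono) simp
          then have "\<bar>act (unit_vec n) (chunk N y3 k)\<bar> \<le> 1 / 2"
            using small by (simp add: chunk abs_mult)
          then show ?thesis by (simp add: act_commute[of "unit_vec n"] act_unit_vec)
        qed simp
      qed
    next
      case (l2 A c f js)
      define X where "X = (\<Sum>i<N. u i)"
      define g where "g j = f (the_inv_into A js j)" for j
      define T where "T = js ` A"
      have gjs: "g (js i) = f i" if "i \<in> A" for i
        using the_inv_into_f_f[OF l2(3) that] by (simp add: g_def)
      have T: "finite T" "T \<subseteq> {1..}" using l2(1,4) by (auto simp: T_def)
      have gop: "g j \<in> K \<inter> op_results K j" if "j \<in> T" for j
      proof -
        obtain i where i: "i \<in> A" "j = js i" using \<open>j \<in> T\<close> by (auto simp: T_def)
        have "{g \<in> K. \<bar>act g (chunk N y3 k)\<bar> \<le> 1 / 2} \<subseteq> K" by blast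
        from op_results_mono[OF this] show ?thesis using l2(4)[OF i(1)] gjs[OF i(1)] i(2) by auto
      qed
      have low: "(\<Sum>j\<in>T \<inter> {..<J}. (act (g j) X)^2) \<le> (2 * real N)^2 * (1 / 256)"
      proof -
        have "(\<Sum>j\<in>T \<inter> {..<J}. (act (g j) X)^2) \<le> (\<Sum>j\<in>T \<inter> {..<J}. (2 * real N)^2 * (1 / real (mseq j))^2)"
        proof (rule sum_mono)
          fix j assume j: "j \<in> T \<inter> {..<J}"
          have "\<bar>act (g j) X\<bar> \<le> (real N + real (nseq j)) / real (mseq j)"
            unfolding X_def by (rule abs_act_op_result_le[of _ K]) (use gop j blk ub in auto)
          also have "\<dots> \<le> (2 * real N) / real (mseq j)"
            by (rule divide_right_mono) (use Nj[of j] j in auto)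
          finally have "\<bar>act (g j) X\<bar> \<le> \<bar>2 * real N * (1 / real (mseq j))\<bar>" by simp
          then have "(act (g j) X)^2 \<le> (2 * real N * (1 / real (mseq j)))^2" by (simp only: abs_le_square_iff)
          then show "(act (g j) X)^2 \<le> (2 * real N)^2 * (1 / real (mseq j))^2"
            by (simp only: power_mult_distrib)
        qed
        also have "\<dots> = (2 * real N)^2 * (\<Sum>j\<in>T \<inter> {..<J}. (1 / real (mseq j))^2)"
          by (simp only: sum_distrib_left)
        also have "\<dots> \<le> (2 * real N)^2 * (1 / 256)"
          by (intro mult_left_mono sum_inverse_mseq_squares) (use T in auto)
        finally show ?thesis .
      qed
      have high: "(\<Sum>j\<in>T \<inter> {J..}. (act (g j) X)^2) \<le> real N + (1 / 256) * (real N)^2"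
      proof -
        have "(\<Sum>l\<in>(\<lambda>i. k * N + i) ` {..<N}. y2 (r3 l)) = X"
          unfolding sum.reindex[OF inj] by (simp add: u_def X_def y3_def y2_def r_def)
        moreover have "(\<Sum>j\<in>T \<inter> {J..}. (act (g j) (\<Sum>l\<in>(\<lambda>i. k * N + i) ` {..<N}. y2 (r3 l)))^2) \<le>
            card ((\<lambda>i. k * N + i) ` {..<N}) + (1 / 256) * (card ((\<lambda>i. k * N + i) ` {..<N}))^2"
          by (rule tail[unfolded tail_sums_le_def comp_apply, rule_format]) (use T gop in auto)
        ultimately show ?thesis by (simp add: card_image[OF inj])
      qed
      have "(\<Sum>i\<in>A. (act (f i) X)^2) = (\<Sum>i\<in>A. (act (g (js i)) X)^2)"
        by (rule sum.cong) (simp_all add: gjs)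
      also have "\<dots> = (\<Sum>j\<in>T. (act (g j) X)^2)"
        unfolding T_def by (simp add: sum.reindex[OF l2(3)])
      also have "\<dots> = (\<Sum>j\<in>T \<inter> {..<J}. (act (g j) X)^2) + (\<Sum>j\<in>T \<inter> {J..}. (act (g j) X)^2)"
        by (subst sum.union_disjoint[symmetric]) (use T(1) in \<open>auto intro!: sum.cong\<close>)
      \<comment> \<open>The low weights give \<open>4 / 256 = 1 / 64\<close> of
        \<open>(real N)^2\<close>. After division the total 1/16 + 1/64 + 1/256 is below
        1/4.\<close>
      finally have "(\<Sum>i\<in>A. (act (f i) X)^2) \<le> real N + (1 / 64 + 1 / 256) * (real N)^2"
        using low high by (simp add: power_mult_distrib algebra_simps)
      then have "(1 / real N)^2 * (\<Sum>i\<in>A. (act (f i) X)^2) \<le>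
          (1 / real N)^2 * (real N + (1 / 64 + 1 / 256) * (real N)^2)"
        by (rule mult_left_mono) simp
      then have "(\<Sum>i\<in>A. (act (f i) (chunk N y3 k))^2) \<le> 1 / real N + (1 / 64 + 1 / 256)"
        unfolding sq chunk power_mult_distrib sum_distrib_left X_def .
      then have sum4: "(\<Sum>i\<in>A. (act (f i) (chunk N y3 k))^2) \<le> (1 / 2)^2"
        using small by (simp add: power2_eq_square)
      have "(act (\<Sum>i\<in>A. c i *\<^sub>R f i) (chunk N y3 k))^2 = (\<Sum>i\<in>A. c i * act (f i) (chunk N y3 k))^2"
        by (simp add: act_sum_left act_scaleR_left)
      also have "\<dots> \<le> (\<Sum>i\<in>A. (c i)^2) * (\<Sum>i\<in>A. (act (f i) (chunk N y3 k))^2)"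
        by (rule Cauchy_Schwarz_ineq_sum)
      also have "\<dots> \<le> 1 * (1 / 2)^2" by (intro mult_mono l2(2) sum4) (auto intro: sum_nonneg)
      finally show ?case by (simp add: abs_le_square_iff[symmetric])
    next
      case (convex A c f)
      have "\<bar>act (\<Sum>i\<in>A. c i *\<^sub>R f i) (chunk N y3 k)\<bar> \<le> (\<Sum>i\<in>A. \<bar>c i * act (f i) (chunk N y3 k)\<bar>)"
        by (simp add: act_sum_left act_scaleR_left)
      also have "\<dots> \<le> (\<Sum>i\<in>A. c i * (1 / 2))"
      proof (rule sum_mono)
        fix i assume i: "i \<in> A"
        have "0 \<le> c i" "\<bar>act (f i) (chunk N y3 k)\<bar> \<le> 1 / 2" using convex i by auto
        then show "\<bar>c i * act (f i) (chunk N y3 k)\<bar> \<le> c i * (1 / 2)"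
          unfolding abs_mult by (intro mult_mono) auto
      qed
      also have "\<dots> = 1 / 2" unfolding sum_distrib_right[symmetric] using convex by simp
      finally show ?case .
    qed
  qed
  then have "bounded_on K (1 / 2) (chunk N y3)" by (simp add: bounded_on_def)
  moreover have N1: "1 \<le> N" using N8 by simp
  moreover have "large_sums K \<delta> (chunk N y3)"
    unfolding y3_def by (rule large_sums_chunk[OF large_sums_subseq[OF low1 r] N1])
  ultimately show ?thesis using block_seq_chunk[OF y3 N1] by (intro exI conjI)
qed

end

section \<open>Iterated halving and the gliding hump\<close>

context attractor_norm
begin

lemma halving_scaled:
  assumes y: "block_seq y a b" and bd: "bounded_on K B y" and B: "0 < B" and low: "large_sums K \<delta> y"
  shows "\<exists>y' a' b'. block_seq y' a' b' \<and> bounded_on K (B / 2) y' \<and> large_sums K \<delta> y'"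
proof -
  have "block_seq (\<lambda>k. (1 / B) *\<^sub>R y k) a b" by (rule block_seq_scale[OF y])
  moreover have "bounded_on K 1 (\<lambda>k. (1 / B) *\<^sub>R y k)"
    using bounded_on_scale[OF bd, of "1 / B"] B by simp
  moreover have "large_sums K (1 / B * \<delta>) (\<lambda>k. (1 / B) *\<^sub>R y k)"
    by (rule large_sums_scale[OF low]) (use B in simp)
  ultimately obtain y' a' b' where y': "block_seq y' a' b'" "bounded_on K (1 / 2) y'" "large_sums K (1 / B * \<delta>) y'"
    using halving by blast
  have "block_seq (\<lambda>k. B *\<^sub>R y' k) a' b'" by (rule block_seq_scale[OF y'(1)])
  moreover have "bounded_on K (B / 2) (\<lambda>k. B *\<^sub>R y' k)"
    using bounded_on_scale[OF y'(2), of B] B by simp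
  moreover have "large_sums K \<delta> (\<lambda>k. B *\<^sub>R y' k)"
    using large_sums_scale[OF y'(3) B] B by simp
  ultimately show ?thesis by blast
qed

text \<open>After enough halvings the uniform bound is below \<open>\<delta>\<close>, contradicting
  the lower estimate for a single late block.\<close>

lemma no_large_sums:
  assumes y: "block_seq y a b" and bd: "bounded_on K B y" and B: "0 < B" and low: "large_sums K \<delta> y" and d: "0 < \<delta>"
  shows False
proof -
  have "\<exists>y' a' b'. block_seq y' a' b' \<and> bounded_on K (B / 2 ^ n) y' \<and> large_sums K \<delta> y'" for n
  proof (induction n)
    case 0
    then show ?case using y bd low by auto
  next
    case (Suc n)
    then obtain y' a' b' where y': "block_seq y' a' b'" "bounded_on K (B / 2 ^ n) y'" "large_sums K \<delta> y'" by blast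
    have "0 < B / 2 ^ n" using B by simp
    from halving_scaled[OF y'(1,2) this y'(3)] show ?case by (simp add: mult.commute)
  qed
  moreover obtain n :: nat where n: "B / \<delta> < 2 ^ n" using real_arch_pow[of 2 "B / \<delta>"] by auto
  ultimately obtain y' a' b' where y': "bounded_on K (B / 2 ^ n) y'" "large_sums K \<delta> y'" by blast
  obtain n0 where n0: "\<And>F. finite F \<Longrightarrow> card F = 1 \<Longrightarrow> F \<subseteq> {n0..} \<Longrightarrow>
    \<exists>f\<in>K. \<delta> * real 1 \<le> \<bar>act f (\<Sum>k\<in>F. y' k)\<bar>"
    by (rule large_sumsE[OF y'(2) order_refl]) (rule that)
  obtain f where f: "f \<in> K" "\<delta> \<le> \<bar>act f (y' n0)\<bar>" using n0[of "{n0}"] by auto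
  have "\<bar>act f (y' n0)\<bar> \<le> B / 2 ^ n" using y'(1) f(1) by (simp add: bounded_on_def)
  then have "\<delta> \<le> B / 2 ^ n" using f(2) by linarith
  then show False using n d by (simp add: field_simps)
qed

text \<open>Differences along a coordinatewise convergent subsequence are coordinatewise null and
  can be cut to blocks with error \<open>\<delta> / 2\<close>. The coefficients 1 and -1 give a sum
  of N differences the lower estimate of 2N vectors, which leaves room for the error.\<close>

lemma no_l1_lower_estimates:
  fixes u :: "nat \<Rightarrow> c00" and B \<delta> :: real
  assumes bd: "\<And>i f. 1 \<le> i \<Longrightarrow> f \<in> K \<Longrightarrow> \<bar>act f (u i)\<bar> \<le> B" and B: "0 < B"
    and low: "\<And>F c. F \<in> schreier_one \<Longrightarrow> \<exists>f\<in>K. \<delta> * (\<Sum>i\<in>F. \<bar>c i\<bar>) \<le> \<bar>act f (\<Sum>i\<in>F. c i *\<^sub>R u i)\<bar>"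
    and d: "0 < \<delta>"
  shows False
proof -
  have cb: "norm (coord (u (Suc i)) n) \<le> B" for i n
  proof (cases "n = 0")
    case False
    then have "\<bar>act (unit_vec n) (u (Suc i))\<bar> \<le> B" by (intro bd unit_vec_in_K) auto
    then show ?thesis by (simp add: act_commute[of "unit_vec n"] act_unit_vec)
  qed (use B in simp)
  obtain r0 :: "nat \<Rightarrow> nat" where r0: "strict_mono r0"
      "\<And>n. \<exists>l. (\<lambda>i. coord (u (Suc (r0 i))) n) \<longlonglongrightarrow> l"
    using function_convergent_subsequence[of UNIV "\<lambda>i n. coord (u (Suc i)) n" B] cb by auto
  define w where "w i = u (Suc (r0 i))" for i
  define v where "v i = w (2 * i + 1) - w (2 * i)" for i
  have v0: "(\<lambda>i. coord (v i) n) \<longlonglongrightarrow> 0" for n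
  proof -
    obtain l where l: "(\<lambda>i. coord (w i) n) \<longlonglongrightarrow> l" using r0(2) by (auto simp: w_def)
    have "(\<lambda>i. coord (w (2 * i + 1)) n) \<longlonglongrightarrow> l" "(\<lambda>i. coord (w (2 * i)) n) \<longlonglongrightarrow> l"
      using LIMSEQ_subseq_LIMSEQ[OF l, of "\<lambda>i. 2 * i + 1"] LIMSEQ_subseq_LIMSEQ[OF l, of "\<lambda>i. 2 * i"]
      by (auto simp: strict_mono_def comp_def)
    from tendsto_diff[OF this] show ?thesis by (simp add: v_def)
  qed
  have vb: "\<bar>act f (v i)\<bar> \<le> 2 * B" if "f \<in> K" for f i
  proof -
    have "\<bar>act f (w j)\<bar> \<le> B" for j using bd that by (simp add: w_def)
    from this[of "2 * i + 1"] this[of "2 * i"] show ?thesis by (simp add: v_def act_diff_right)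
  qed
  have "\<exists>p. supp (v i) \<subseteq> {..p}" for i using finite_supp[of "v i"] finite_nat_iff_bounded_le by blast
  then obtain p' where p': "\<And>i. supp (v i) \<subseteq> {..p' i}" by metis
  \<comment> \<open>The summand \<open>i\<close> makes \<open>p\<close> unbounded, so late vectors
    end strictly later than any given one.\<close>
  define p where "p i = p' i + i" for i
  have p: "supp (v i) \<subseteq> {..p i}" for i using p'[of i] by (auto simp: p_def)
  define P where "P k l \<longleftrightarrow> p k < p l \<and> (\<Sum>n\<le>p k. \<bar>coord (v l) n\<bar>) \<le> \<delta> / 2" for k l
  have "\<forall>\<^sub>F l in sequentially. P k l" for k
  proof -
    have "(\<lambda>l. \<Sum>n\<le>p k. \<bar>coord (v l) n\<bar>) \<longlonglongrightarrow> (\<Sum>n\<le>p k. \<bar>0\<bar>)"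
      by (intro tendsto_sum tendsto_rabs v0)
    then have "\<forall>\<^sub>F l in sequentially. (\<Sum>n\<le>p k. \<bar>coord (v l) n\<bar>) < \<delta> / 2"
      by (rule order_tendstoD(2)) (use d in simp)
    moreover have "\<forall>\<^sub>F l in sequentially. p k < l" by (rule eventually_gt_at_top)
    ultimately show ?thesis by eventually_elim (auto simp: P_def p_def)
  qed
  then have "\<forall>\<^sub>F k in sequentially. \<forall>\<^sub>F l in sequentially. P k l" by simp
  then obtain t :: "nat \<Rightarrow> nat" where t: "strict_mono t" "\<And>k l. k < l \<Longrightarrow> P (t k) (t l)"
    by (rule strict_mono_subseq_pairwise) blast
  \<comment> \<open>Only the beginning is removed: the vector already ends at
    \<open>p (t (Suc k))\<close>, where the next block starts.\<close>
  define y where "y k = restrict {p (t k)<..} (v (t (Suc k)))" for k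
  have Pk: "p (t k) < p (t (Suc k))" "(\<Sum>n\<le>p (t k). \<bar>coord (v (t (Suc k))) n\<bar>) \<le> \<delta> / 2" for k
    using t(2)[of k "Suc k"] by (auto simp: P_def)
  have blk: "block_seq y (\<lambda>k. p (t k)) (\<lambda>k. p (t (Suc k)))"
    unfolding block_seq_def using Pk(1) p by (fastforce simp: y_def)
  have int: "nat_interval {m<..}" for m by (auto simp: nat_interval_def)
  have by': "bounded_on K (2 * B) y"
    unfolding bounded_on_def y_def act_restrict[symmetric] using vb K_restrict int by blast
  have diff: "\<bar>act f (v (t (Suc k))) - act f (y k)\<bar> \<le> \<delta> / 2" if f: "f \<in> K" for f k
  proof -
    have "v (t (Suc k)) = y k + restrict {..p (t k)} (v (t (Suc k)))"
      by (rule c00_eqI) (simp add: y_def)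
    then have "act f (v (t (Suc k))) - act f (y k) = act f (restrict {..p (t k)} (v (t (Suc k))))"
      using act_add_right[of f "y k" "restrict {..p (t k)} (v (t (Suc k)))"] by simp
    moreover have "\<bar>act f (restrict {..p (t k)} (v (t (Suc k))))\<bar> \<le>
        1 * (\<Sum>n\<in>supp (restrict {..p (t k)} (v (t (Suc k)))). \<bar>coord (restrict {..p (t k)} (v (t (Suc k)))) n\<bar>)"
      by (rule abs_act_le) (rule K_set_coord_le[OF f])
    moreover have "(\<Sum>n\<in>supp (restrict {..p (t k)} (v (t (Suc k)))). \<bar>coord (restrict {..p (t k)} (v (t (Suc k)))) n\<bar>) \<le>
        (\<Sum>n\<le>p (t k). \<bar>coord (v (t (Suc k))) n\<bar>)"
      by (rule sum_le_included[where i = "\<lambda>n. n"]) auto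
    ultimately show ?thesis using Pk(2)[of k] by linarith
  qed
  have "large_sums K \<delta> y"
    unfolding large_sums_def
  proof (intro allI impI)
    fix N :: nat assume N: "1 \<le> N"
    show "\<exists>n0. \<forall>F. finite F \<and> card F = N \<and> F \<subseteq> {n0..} \<longrightarrow> (\<exists>f\<in>K. \<delta> * real N \<le> \<bar>act f (\<Sum>k\<in>F. y k)\<bar>)"
    \<comment> \<open>For \<open>k\<close> at least \<open>N\<close> all 2N positions used in
      \<open>u\<close> are at least 2N, so they form a Schreier set. \<open>\<alpha>\<close> and
      \<open>\<beta>\<close> locate the two halves of a difference, shifted by one because
      \<open>u\<close> is indexed from 1.\<close>
    proof (intro exI[of _ N] allI impI)
      fix F assume F: "finite F \<and> card F = N \<and> F \<subseteq> {N..}"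
      define \<alpha> where "\<alpha> k = Suc (r0 (2 * t (Suc k) + 1))" for k
      define \<beta> where "\<beta> k = Suc (r0 (2 * t (Suc k)))" for k
      have r0eq: "r0 m = r0 n \<longleftrightarrow> m = n" for m n using r0(1) by (simp add: strict_mono_eq)
      have teq: "t m = t n \<longleftrightarrow> m = n" for m n using t(1) by (simp add: strict_mono_eq)
      have inj: "inj_on \<alpha> F" "inj_on \<beta> F"
        by (auto intro!: inj_onI simp: \<alpha>_def \<beta>_def r0eq teq)
      have "\<alpha> k \<noteq> \<beta> l" for k l
      proof
        assume "\<alpha> k = \<beta> l"
        then have "2 * t (Suc k) + 1 = 2 * t (Suc l)" by (simp add: \<alpha>_def \<beta>_def r0eq)
        then show False by presburger
      qed
      then have disj: "\<alpha> ` F \<inter> \<beta> ` F = {}" by blast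
      define H where "H = \<alpha> ` F \<union> \<beta> ` F"
      define c where "c i = (if i \<in> \<alpha> ` F then 1 else - 1 :: real)" for i
      have fin: "finite H" using F by (simp add: H_def)
      have cardH: "card H = 2 * N"
        unfolding H_def using F disj by (simp add: card_Un_disjoint card_image inj)
      have large: "2 * N \<le> i" if "i \<in> H" for i
      proof -
        have inc: "m \<le> r0 m" "m \<le> t m" for m
          using strict_mono_imp_increasing[OF r0(1)] strict_mono_imp_increasing[OF t(1)] by auto
        have "2 * N \<le> \<alpha> k" "2 * N \<le> \<beta> k" if "k \<in> F" for k
          using F that inc(1)[of "2 * t (Suc k) + 1"] inc(1)[of "2 * t (Suc k)"] inc(2)[of "Suc k"]
          unfolding \<alpha>_def \<beta>_def by fastforce+
        then show ?thesis using that by (auto simp: H_def)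
      qed
      have ne: "H \<noteq> {}" using cardH N by auto
      have "card H \<le> Min H" using large[OF Min_in[OF fin ne]] cardH by simp
      moreover have "H \<subseteq> {1..}"
      proof
        fix i assume "i \<in> H"
        then show "i \<in> {1..}" using large[of i] N by simp
      qed
      ultimately have "H \<in> schreier_one" unfolding schreier_one_def using fin ne by simp
      from low[OF this, of c] obtain f where f: "f \<in> K"
        "\<delta> * (\<Sum>i\<in>H. \<bar>c i\<bar>) \<le> \<bar>act f (\<Sum>i\<in>H. c i *\<^sub>R u i)\<bar>" by blast
      have "(\<Sum>i\<in>H. \<bar>c i\<bar>) = (\<Sum>i\<in>H. 1)" by (rule sum.cong) (auto simp: c_def)
      then have c2: "(\<Sum>i\<in>H. \<bar>c i\<bar>) = 2 * real N" using cardH by simp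
      have "(\<Sum>i\<in>H. c i *\<^sub>R u i) = (\<Sum>i\<in>\<alpha> ` F. c i *\<^sub>R u i) + (\<Sum>i\<in>\<beta> ` F. c i *\<^sub>R u i)"
        unfolding H_def by (rule sum.union_disjoint) (use F disj in auto)
      also have "(\<Sum>i\<in>\<alpha> ` F. c i *\<^sub>R u i) = (\<Sum>k\<in>F. u (\<alpha> k))"
        unfolding sum.reindex[OF inj(1)] by (rule sum.cong) (auto simp: c_def)
      also have "(\<Sum>i\<in>\<beta> ` F. c i *\<^sub>R u i) = (\<Sum>k\<in>F. - u (\<beta> k))"
        unfolding sum.reindex[OF inj(2)] by (rule sum.cong) (use disj in \<open>auto simp: c_def\<close>)
      also have "(\<Sum>k\<in>F. u (\<alpha> k)) + (\<Sum>k\<in>F. - u (\<beta> k)) = (\<Sum>k\<in>F. v (t (Suc k)))"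
        by (simp add: sum.distrib[symmetric] v_def w_def \<alpha>_def \<beta>_def)
      finally have eq: "(\<Sum>i\<in>H. c i *\<^sub>R u i) = (\<Sum>k\<in>F. v (t (Suc k)))" .
      have "\<bar>act f (\<Sum>k\<in>F. v (t (Suc k))) - act f (\<Sum>k\<in>F. y k)\<bar> \<le> (\<Sum>k\<in>F. \<bar>act f (v (t (Suc k))) - act f (y k)\<bar>)"
        by (simp add: act_sum_right sum_subtractf[symmetric])
      also have "\<dots> \<le> (\<Sum>k\<in>F. \<delta> / 2)" by (rule sum_mono) (rule diff[OF f(1)])
      also have "\<dots> = \<delta> / 2 * real N" using F by simp
      finally have "\<delta> * (2 * real N) - \<delta> / 2 * real N \<le> \<bar>act f (\<Sum>k\<in>F. y k)\<bar>"
        using f(2) unfolding c2 eq by linarith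
      moreover have "\<delta> * real N \<le> \<delta> * (2 * real N) - \<delta> / 2 * real N" using d by (simp add: field_simps)
      ultimately show "\<exists>f\<in>K. \<delta> * real N \<le> \<bar>act f (\<Sum>k\<in>F. y k)\<bar>" using f(1) by (intro bexI[of _ f]) linarith
    qed
  qed
  then show False using no_large_sums[OF blk by'] B d by simp
qed

lemma abs_act_le_K_norm: "f \<in> K \<Longrightarrow> \<bar>act f x\<bar> \<le> K_norm K x"
proof -
  have bdd: "bdd_above ((\<lambda>f. act f x) ` K)"
  proof (rule bdd_aboveI2)
    fix f assume "f \<in> K"
    then have "\<bar>act f x\<bar> \<le> 1 * (\<Sum>n\<in>supp x. \<bar>coord x n\<bar>)" by (intro abs_act_le K_set_coord_le)
    then show "act f x \<le> (\<Sum>n\<in>supp x. \<bar>coord x n\<bar>)" by simp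
  qed
  assume f: "f \<in> K"
  have "act f x \<le> K_norm K x" "act (- f) x \<le> K_norm K x"
    unfolding K_norm_def by (rule cSUP_upper[OF _ bdd], use f K_minus in simp)+
  then show ?thesis by (simp add: act_minus_left)
qed

lemma K_norm_approx:
  assumes "e < K_norm K x" shows "\<exists>f\<in>K. e < act f x"
proof -
  have "K \<noteq> {}" using unit_vec_in_K[of 1] by auto
  then have "\<not> (\<forall>f\<in>K. act f x \<le> e)" using assms cSUP_least[of K "\<lambda>f. act f x" e] by (force simp: K_norm_def)
  then show ?thesis by (auto simp: not_le)
qed

end

section \<open>Lifting from the quotient to finitely supported vectors\<close>

theorem corollary13p6:
  fixes \<xi> :: omega1 and s :: "omega1 \<Rightarrow> nat \<Rightarrow> omega1"
    and M1 M2 N1 N2 L :: "nat set" and \<Lambda> :: "nat \<Rightarrow> nat set"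
    and \<sigma>1 \<sigma> :: "c00 list \<Rightarrow> nat"
    and \<iota> :: "c00 \<Rightarrow> 'x::banach" and q :: "'x \<Rightarrow> 'y::banach"
  assumes "fundamental_sequences s"
    and "infinite_split M1 M2" and "coding1 M2 \<sigma>1"
    and "(\<Union>i\<in>{1..}. \<Lambda> i) = {1..}" and "disjoint_family_on \<Lambda> {1..}" and "\<forall>i\<ge>1. infinite (\<Lambda> i)"
    and "infinite_split N1 N2" and "coding N2 \<sigma>"
    and "is_completion (K_norm (K_set (G_set (schreier s \<xi>) M1 \<sigma>1) N1 \<Lambda> \<sigma>)) \<iota>"
    and "L \<subseteq> {1..}" and "infinite L" and "infinite ({1..} - L)"
    and "\<forall>i\<ge>1. infinite (L \<inter> \<Lambda> i)"
    and "is_quotient_map (closed_span ((\<lambda>n. \<iota> (unit_vec n)) ` L)) q"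
  shows "\<not> (\<exists>x :: nat \<Rightarrow> 'y. normalized x \<and> basic_sequence x \<and> generates_l1_spreading_model x)"
proof
  assume "\<exists>x :: nat \<Rightarrow> 'y. normalized x \<and> basic_sequence x \<and> generates_l1_spreading_model x"
  then obtain x :: "nat \<Rightarrow> 'y" and C where x: "\<And>i. 1 \<le> i \<Longrightarrow> norm (x i) = 1" and C: "1 \<le> C"
    and l1: "\<And>F c. F \<in> schreier_one \<Longrightarrow> (1 / C) * (\<Sum>i\<in>F. \<bar>c i\<bar>) \<le> norm (\<Sum>i\<in>F. c i *\<^sub>R x i)"
    unfolding normalized_def generates_l1_spreading_model_def equivalent_to_l1_def by blast
  interpret attractor_norm "schreier s \<xi>" M1 M2 \<sigma>1 N1 \<Lambda> \<sigma>
    by unfold_locales (use assms(2,3) schreier_compact[OF assms(1)] in auto)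
  have \<iota>: "linear \<iota>" "\<And>z. norm (\<iota> z) = K_norm K z" "closure (range \<iota>) = UNIV"
    using assms(9) by (auto simp: is_completion_def)
  define Z where "Z = closed_span ((\<lambda>n. \<iota> (unit_vec n)) ` L)"
  have q: "linear q" "surj q" "\<And>z. norm (q z) = infdist z Z"
    using assms(14) by (auto simp: is_quotient_map_def Z_def)
  have Z0: "0 \<in> Z" unfolding Z_def closed_span_def by (rule subsetD[OF closure_subset]) (rule span_zero)
  have qle: "norm (q z) \<le> norm z" for z
    using infdist_le[OF Z0, of z] q(3)[of z] by simp
  \<comment> \<open>A representative at distance less than 2 from the subspace can be moved within
    its coset to norm at most 2.\<close>
  have "\<exists>z. q z = x i \<and> norm z \<le> 2" if i: "1 \<le> i" for i
  proof -
    obtain z where z: "q z = x i" using q(2) by (metis surjD)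
    have "infdist z Z < 2" using q(3)[of z] x[OF i] z by simp
    moreover have "Z \<noteq> {}" using Z0 by blast
    ultimately have "Inf (dist z ` Z) < 2" by (simp add: infdist_notempty)
    then obtain h where h: "h \<in> Z" "dist z h < 2"
      using cInf_lessD[of "dist z ` Z" 2] Z0 by blast
    have "q h = 0" using q(3)[of h] h(1) by simp
    then have "q (z - h) = x i" using linear_diff[OF q(1)] z by simp
    then show ?thesis using h(2) by (intro exI[of _ "z - h"]) (simp add: dist_norm)
  qed
  then obtain z where z: "\<And>i. 1 \<le> i \<Longrightarrow> q (z i) = x i \<and> norm (z i) \<le> 2" by metis
  \<comment> \<open>Approximation by finitely supported vectors costs at most a quarter of the lower
    constant \<open>1 / C\<close>.\<close>
  define e where "e = 1 / (4 * C)"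
  have e: "0 < e" "e \<le> 1" using C by (auto simp: e_def field_simps)
  have "\<exists>u. dist (\<iota> u) (z i) < e" for i
    using \<iota>(3) e(1) closure_approachable[of "z i" "range \<iota>"] by auto
  then obtain u where u: "\<And>i. dist (\<iota> (u i)) (z i) < e" by metis
  show False
  proof (rule no_l1_lower_estimates[of u 3 "1 / (2 * C)"])
    fix i f assume i: "1 \<le> (i::nat)" and f: "f \<in> K"
    have "norm (\<iota> (u i)) \<le> norm (z i) + dist (\<iota> (u i)) (z i)"
      by (metis add.commute diff_add_cancel dist_norm norm_triangle_ineq)
    then have "K_norm K (u i) \<le> 3" using z[OF i] u[of i] e(2) \<iota>(2)[of "u i"] by linarith
    then show "\<bar>act f (u i)\<bar> \<le> 3" using abs_act_le_K_norm[OF f, of "u i"] by linarith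
  next
    fix F and c :: "nat \<Rightarrow> real" assume F: "F \<in> schreier_one"
    have F1: "1 \<le> i" if "i \<in> F" for i using F that by (auto simp: schreier_one_def)
    have xz: "(\<Sum>i\<in>F. c i *\<^sub>R x i) = q (\<Sum>i\<in>F. c i *\<^sub>R z i)"
      using z F1 by (simp add: linear_sum[OF q(1)] linear_scale[OF q(1)])
    define m where "m = (\<Sum>i\<in>F. \<bar>c i\<bar>)"
    have "norm (\<Sum>i\<in>F. c i *\<^sub>R z i - c i *\<^sub>R \<iota> (u i)) \<le> (\<Sum>i\<in>F. \<bar>c i\<bar> * e)"
    proof (rule sum_norm_le)
      fix i assume "i \<in> F"
      have "norm (c i *\<^sub>R z i - c i *\<^sub>R \<iota> (u i)) = \<bar>c i\<bar> * dist (\<iota> (u i)) (z i)"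
        by (simp add: scaleR_diff_right[symmetric] dist_norm norm_minus_commute)
      also have "\<dots> \<le> \<bar>c i\<bar> * e" using u[of i] by (intro mult_left_mono) auto
      finally show "norm (c i *\<^sub>R z i - c i *\<^sub>R \<iota> (u i)) \<le> \<bar>c i\<bar> * e" .
    qed
    then have "norm ((\<Sum>i\<in>F. c i *\<^sub>R z i) - (\<Sum>i\<in>F. c i *\<^sub>R \<iota> (u i))) \<le> m * e"
      by (simp add: sum_subtractf sum_distrib_right m_def)
    then have "norm (\<Sum>i\<in>F. c i *\<^sub>R z i) - m * e \<le> norm (\<Sum>i\<in>F. c i *\<^sub>R \<iota> (u i))"
      using norm_triangle_ineq2[of "\<Sum>i\<in>F. c i *\<^sub>R z i" "\<Sum>i\<in>F. c i *\<^sub>R \<iota> (u i)"] by linarith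
    moreover have "(\<Sum>i\<in>F. c i *\<^sub>R \<iota> (u i)) = \<iota> (\<Sum>i\<in>F. c i *\<^sub>R u i)"
      by (simp add: linear_sum[OF \<iota>(1)] linear_scale[OF \<iota>(1)])
    moreover have "(1 / C) * m \<le> norm (\<Sum>i\<in>F. c i *\<^sub>R z i)"
      using l1[OF F, of c] qle[of "\<Sum>i\<in>F. c i *\<^sub>R z i"] unfolding xz m_def by linarith
    ultimately have K: "(1 / C) * m - m * e \<le> K_norm K (\<Sum>i\<in>F. c i *\<^sub>R u i)"
      using \<iota>(2) by simp
    have m0: "0 \<le> m" by (simp add: m_def sum_nonneg)
    show "\<exists>f\<in>K. 1 / (2 * C) * (\<Sum>i\<in>F. \<bar>c i\<bar>) \<le> \<bar>act f (\<Sum>i\<in>F. c i *\<^sub>R u i)\<bar>"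
    proof (cases "m = 0")
      case True
      then show ?thesis using unit_vec_in_K[of 1] by (intro bexI[of _ "unit_vec 1"]) (auto simp: m_def)
    next
      case False
      \<comment> \<open>What remains is \<open>3 / (4 * C)\<close>, strictly above
        \<open>1 / (2 * C)\<close>. Strictness gives a functional even if the supremum is not
        attained; for \<open>m = 0\<close> any functional will do.\<close>
      have "1 / (2 * C) * m < (1 / C) * m - m * e"
        using False m0 C by (simp add: e_def field_simps)
      then obtain f where "f \<in> K" "1 / (2 * C) * m < act f (\<Sum>i\<in>F. c i *\<^sub>R u i)"
        using K_norm_approx[OF less_le_trans[OF _ K]] by blast
      then show ?thesis unfolding m_def by (intro bexI[of _ f]) auto
    qed
  qed (use C in auto)
qed

end
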